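(* Let $u$ be the weak solution of the stochastic heat equation on $\mathbb{R}_+\times[-\pi,\pi]$ with Dirichlet boundary conditions and zero initial condition, $$\partial_tu(t,x)=\Delta u(t,x)+\xi(t,x),\qquad u(t,-\pi)=u(t,\pi)=0,\qquad u(0,x)=0,$$ driven by space-time white noise $\xi$. Let $T>0$, $a\in(0,1)$ and $1\le q\le p$ with $p$ an even integer. If $\overline\alpha=\big(\tfrac a4-\tfrac1q,\ \tfrac{1-a}2-\tfrac1q\big)\in(0,1]^2$, then, with $\overline p=(p,p)$ and $\overline q=(q,q)$, $$u\in B^{\overline\alpha}_{\overline p,\overline q}([0,T]\times\mathbb{T})\quad\text{almost surely}.$$
   Context: $\mathbb{T}$ is the one-dimensional torus, identified with $[-\pi,\pi]$; since $u(t,\pm\pi)=0$, $u(t,\cdot)$ is viewed as a $2\pi$-periodic function. The first coordinate is time $t$, the second is space $x$. The noise is $\xi=dW_t(x)$ for the cylindrical Brownian motion $W_t(x)=\sum_{j\ge1}B_j(t)\phi_j(x)$, where $B_j=(B_j(t),t\ge0)$, $j\ge1$, are independent Brownian motions on a probability space and $(\phi_j)_{j\ge1}$ is the orthonormal basis given by the eigenfunctions of the Laplace operator on $\{g\in H^2((-\pi,\pi)):g(-\pi)=g(\pi)=0\}$. With $\Delta\phi_j=-\lambda_j\phi_j$, the weak solution is the centred Gaussian field $u(t,x)=\sum_{j\ge1}\int_0^te^{-\lambda_j(t-s)}\,dB_j(s)\,\phi_j(x)$, taken in its continuous version. Besov spaces with dominating mixed smoothness on $\mathbb{R}\times\mathbb{T}$.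 Functions and distributions on $\mathbb{R}\times\mathbb{T}$ are identified with elements of $\mathcal{S}'_{\pi_2}(\mathbb{R}^2)$, the space of tempered distributions on $\mathbb{R}^2$ that are $2\pi$-periodic in the second variable. Let $(\chi,\rho)$ be a dyadic partition of unity in dimension one: smooth functions on $\mathbb{R}$ with $\operatorname{supp}\chi\subseteq\{|z|\le\frac43\}$, $\operatorname{supp}\rho\subseteq\{\frac34\le|z|\le\frac83\}$ and $\chi(z)+\sum_{j\ge0}\rho(2^{-j}z)=1$ for all $z\in\mathbb{R}$; put $\rho_{-1}:=\chi$ and $\rho_j:=\rho(2^{-j}\cdot)$ for $j\ge0$. With $\mathcal{F}$ the Fourier transform on $\mathbb{R}^2$, set $\Delta_{j,k}f:=\mathcal{F}^{-1}[\rho_j(\xi_1)\rho_k(\xi_2)\mathcal{F}f(\xi_1,\xi_2)]$ for $j,k\ge-1$. For $\overline p=(p_1,p_2)$ let $\|f\|_{\overline p}:=\big(\int_{\mathbb{R}}\big(\int_{\mathbb{T}}|f(x_1,x_2)|^{p_2}dx_2\big)^{p_1/p_2}dx_1\big)^{1/p_1}$. For $\overline\alpha=(\alpha_1,\alpha_2)\in\mathbb{R}^2$ and $\overline q=(q_1,q_2)$, $$B^{\overline\alpha}_{\overline p,\overline q}(\mathbb{R}\times\mathbb{T}):=\{f\in\mathcal{S}'_{\pi_2}(\mathbb{R}^2):\|f\|_{\overline\alpha,\overline p,\overline q}<\infty\},\qquad \|f\|_{\overline\alpha,\overline p,\overline q}:=\Big\|\Big(2^{\alpha_1j}\big\|\big(2^{\alpha_2k}\|\Delta_{j,k}f\|_{\overline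 p}\big)_{k\ge-1}\big\|_{\ell^{q_2}}\Big)_{j\ge-1}\Big\|_{\ell^{q_1}}.$$ Besov space on the domain $D=[0,T]\times\mathbb{T}$: $$B^{\overline\alpha}_{\overline p,\overline q}(D):=\{f\in B^{\overline\alpha}_{\overline p,\overline q}(\mathbb{R}\times\mathbb{T}):\operatorname{supp}f\subseteq D\}.$$
   Formalization: Extended by zero outside [0,T], u jumps at T, so the claim fails if α₁ ≥ 1/p. Proved: for α₁ < 1/p the zero extension lies in the space on [0,T]×𝕋; for all stated parameters, for every T' > T, u on [0,T]×𝕋 is the restriction of an element of the space on [0,T']×𝕋. *)

theory Defs
  imports "HOL-Probability.Probability"
begin

section \<open>Tempered distributions on the plane\<close>

definition pd1 :: "(real \<times> real \<Rightarrow> complex) \<Rightarrow> real \<times> real \<Rightarrow> complex" where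
  "pd1 f z = vector_derivative (\<lambda>s. f (s, snd z)) (at (fst z))"

definition pd2 :: "(real \<times> real \<Rightarrow> complex) \<Rightarrow> real \<times> real \<Rightarrow> complex" where
  "pd2 f z = vector_derivative (\<lambda>s. f (fst z, s)) (at (snd z))"

definition pd :: "nat \<Rightarrow> nat \<Rightarrow> (real \<times> real \<Rightarrow> complex) \<Rightarrow> real \<times> real \<Rightarrow> complex" where
  "pd m n f = (pd1 ^^ m) ((pd2 ^^ n) f)"

text \<open>
  The first two conditions say that all iterated partial derivatives exist and commute. Together
  with the decay condition, which bounds them all, they force joint smoothness: a function with
  bounded partial derivatives is Lipschitz, so every \<open>pd m n f\<close> is continuous.
\<close>

definition schwartz :: "(real \<times> real \<Rightarrow> complex) set" where
  "schwartz = {f. \<forall>m n.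
     (\<forall>x y. ((\<lambda>s. pd m n f (s, y)) has_vector_derivative pd (Suc m) n f (x, y)) (at x)) \<and>
     (\<forall>x y. ((\<lambda>s. pd m n f (x, s)) has_vector_derivative pd m (Suc n) f (x, y)) (at y)) \<and>
     (\<forall>k::nat. bdd_above (range (\<lambda>z. (1 + norm z) ^ k * norm (pd m n f z))))}"

definition schwartz_norm :: "nat \<Rightarrow> (real \<times> real \<Rightarrow> complex) \<Rightarrow> real" where
  "schwartz_norm N f = (\<Sum>m\<le>N. \<Sum>n\<le>N. SUP z. (1 + norm z) ^ N * norm (pd m n f z))"

text \<open>
  A distribution is a functional on all of \<open>real \<times> real \<Rightarrow> complex\<close>; only its values on
  \<^const>\<open>schwartz\<close> matter.
\<close>

type_synonym dist2 = "(real \<times> real \<Rightarrow> complex) \<Rightarrow> complex"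

definition tempered :: "dist2 set" where
  "tempered = {F.
     (\<forall>\<phi>\<in>schwartz. \<forall>\<psi>\<in>schwartz. \<forall>c. F (\<lambda>z. c * \<phi> z + \<psi> z) = c * F \<phi> + F \<psi>) \<and>
     (\<exists>N C. \<forall>\<psi>\<in>schwartz. norm (F \<psi>) \<le> C * schwartz_norm N \<psi>)}"

definition periodic2 :: "dist2 \<Rightarrow> bool" where
  "periodic2 F \<longleftrightarrow> (\<forall>\<psi>\<in>schwartz. F (\<lambda>(x, y). \<psi> (x, y + 2 * pi)) = F \<psi>)"

definition represents :: "(real \<times> real \<Rightarrow> complex) \<Rightarrow> dist2 \<Rightarrow> bool" where
  "represents g F \<longleftrightarrow> (\<forall>\<psi>\<in>schwartz.
     integrable lborel (\<lambda>z. g z * \<psi> z) \<and> F \<psi> = (LINT z|lborel. g z * \<psi> z))"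

definition dist_support :: "dist2 \<Rightarrow> (real \<times> real) set" where
  "dist_support F = - \<Union>{U. open U \<and> (\<forall>\<psi>\<in>schwartz.
     compact (closure {z. \<psi> z \<noteq> 0}) \<and> closure {z. \<psi> z \<noteq> 0} \<subseteq> U \<longrightarrow> F \<psi> = 0)}"

definition fourier :: "(real \<times> real \<Rightarrow> complex) \<Rightarrow> real \<times> real \<Rightarrow> complex" where
  "fourier \<psi> \<xi> = (LINT z|lborel. cis (- (z \<bullet> \<xi>)) * \<psi> z)"

definition inv_fourier :: "(real \<times> real \<Rightarrow> complex) \<Rightarrow> real \<times> real \<Rightarrow> complex" where
  "inv_fourier \<psi> z = (LINT \<xi>|lborel. cis (z \<bullet> \<xi>) * \<psi> \<xi>) / (2 * of_real pi)\<^sup>2"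

definition dist_fourier :: "dist2 \<Rightarrow> dist2" where
  "dist_fourier F = (\<lambda>\<psi>. F (fourier \<psi>))"

definition dist_inv_fourier :: "dist2 \<Rightarrow> dist2" where
  "dist_inv_fourier F = (\<lambda>\<psi>. F (inv_fourier \<psi>))"

definition dist_mult :: "(real \<times> real \<Rightarrow> real) \<Rightarrow> dist2 \<Rightarrow> dist2" where
  "dist_mult m F = (\<lambda>\<psi>. F (\<lambda>z. of_real (m z) * \<psi> z))"


section \<open>Besov spaces with dominating mixed smoothness\<close>

definition smooth_real :: "(real \<Rightarrow> real) \<Rightarrow> bool" where
  "smooth_real f \<longleftrightarrow> (\<forall>n x. (deriv ^^ n) f field_differentiable at x)"

definition dyadic_partition :: "(real \<Rightarrow> real) \<Rightarrow> (real \<Rightarrow> real) \<Rightarrow> bool" where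
  "dyadic_partition \<theta> \<rho> \<longleftrightarrow>
     smooth_real \<theta> \<and> smooth_real \<rho> \<and>
     closure {z. \<theta> z \<noteq> 0} \<subseteq> {z. \<bar>z\<bar> \<le> 4 / 3} \<and>
     closure {z. \<rho> z \<noteq> 0} \<subseteq> {z. 3 / 4 \<le> \<bar>z\<bar> \<and> \<bar>z\<bar> \<le> 8 / 3} \<and>
     (\<forall>z. (\<lambda>j::nat. \<rho> (z / 2 ^ j)) sums (1 - \<theta> z))"

definition dyadic :: "(real \<Rightarrow> real) \<Rightarrow> (real \<Rightarrow> real) \<Rightarrow> int \<Rightarrow> real \<Rightarrow> real" where
  "dyadic \<theta> \<rho> j z = (if j = -1 then \<theta> z else \<rho> (2 powr (- of_int j) * z))"

definition block :: "(real \<Rightarrow> real) \<Rightarrow> (real \<Rightarrow> real) \<Rightarrow> int \<Rightarrow> int \<Rightarrow> dist2 \<Rightarrow> dist2" where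
  "block \<theta> \<rho> j k F =
     dist_inv_fourier (dist_mult (\<lambda>(\<xi>1, \<xi>2). dyadic \<theta> \<rho> j \<xi>1 * dyadic \<theta> \<rho> k \<xi>2) (dist_fourier F))"

text \<open>Only used with exponents \<open>r > 0\<close>.\<close>

definition ennreal_rpow :: "ennreal \<Rightarrow> real \<Rightarrow> ennreal" where
  "ennreal_rpow x r = (if x = \<top> then \<top> else ennreal (enn2real x powr r))"

definition mixed_norm :: "real \<times> real \<Rightarrow> (real \<times> real \<Rightarrow> complex) \<Rightarrow> ennreal" where
  "mixed_norm p g = ennreal_rpow
     (\<integral>\<^sup>+x1. ennreal_rpow
        (\<integral>\<^sup>+x2\<in>{-pi..pi}. ennreal (norm (g (x1, x2)) powr snd p) \<partial>lborel) (fst p / snd p)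
      \<partial>lborel) (1 / fst p)"

text \<open>
  The infimum runs over the representing functions, all equal almost everywhere, so it is the norm
  of the function representing \<open>F\<close>, and \<open>\<top>\<close> if \<open>F\<close> is not a function.
\<close>

definition dist_mixed_norm :: "real \<times> real \<Rightarrow> dist2 \<Rightarrow> ennreal" where
  "dist_mixed_norm p F = (INF g \<in> {g \<in> borel_measurable borel. represents g F}. mixed_norm p g)"

text \<open>The \<open>\<ell>\<^sup>q\<close> norm of a sequence indexed by the integers \<open>j \<ge> -1\<close>.\<close>

definition lq_norm :: "real \<Rightarrow> (int \<Rightarrow> ennreal) \<Rightarrow> ennreal" where
  "lq_norm q a = ennreal_rpow (\<Sum>i::nat. ennreal_rpow (a (int i - 1)) q) (1 / q)"

definition besov_norm ::
  "(real \<Rightarrow> real) \<Rightarrow> (real \<Rightarrow> real) \<Rightarrow> real \<times> real \<Rightarrow> real \<times> real \<Rightarrow> real \<times> real \<Rightarrow> dist2 \<Rightarrow> ennreal"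
where
  "besov_norm \<theta> \<rho> \<alpha> p q F =
     lq_norm (fst q) (\<lambda>j. ennreal (2 powr (fst \<alpha> * of_int j)) *
       lq_norm (snd q) (\<lambda>k. ennreal (2 powr (snd \<alpha> * of_int k)) *
         dist_mixed_norm p (block \<theta> \<rho> j k F)))"

definition besov ::
  "(real \<Rightarrow> real) \<Rightarrow> (real \<Rightarrow> real) \<Rightarrow> real \<times> real \<Rightarrow> real \<times> real \<Rightarrow> real \<times> real \<Rightarrow> dist2 set"
where
  "besov \<theta> \<rho> \<alpha> p q = {F \<in> tempered. periodic2 F \<and> besov_norm \<theta> \<rho> \<alpha> p q F < \<top>}"

text \<open>The space on \<open>[0,T]\<close> times the torus; periodicity turns the torus factor into \<open>UNIV\<close>.\<close>

definition besov_strip ::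
  "(real \<Rightarrow> real) \<Rightarrow> (real \<Rightarrow> real) \<Rightarrow> real \<times> real \<Rightarrow> real \<times> real \<Rightarrow> real \<times> real \<Rightarrow> real \<Rightarrow> dist2 set"
where
  "besov_strip \<theta> \<rho> \<alpha> p q T = {F \<in> besov \<theta> \<rho> \<alpha> p q. dist_support F \<subseteq> {0..T} \<times> UNIV}"


section \<open>The stochastic heat equation\<close>

definition brownian_motion :: "'w measure \<Rightarrow> (real \<Rightarrow> 'w \<Rightarrow> real) \<Rightarrow> bool" where
  "brownian_motion M W \<longleftrightarrow>
     (\<forall>t\<ge>0. W t \<in> borel_measurable M) \<and>
     (AE \<omega> in M. W 0 \<omega> = 0) \<and>
     (AE \<omega> in M. continuous_on {0..} (\<lambda>t. W t \<omega>)) \<and>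
     (\<forall>s\<ge>0. \<forall>t>s. distributed M lborel (\<lambda>\<omega>. W t \<omega> - W s \<omega>)
        (\<lambda>x. ennreal (normal_density 0 (sqrt (t - s)) x))) \<and>
     (\<forall>n (t::nat \<Rightarrow> real). 0 \<le> t 0 \<and> (\<forall>i<n. t i \<le> t (Suc i)) \<longrightarrow>
        prob_space.indep_vars M (\<lambda>_. borel) (\<lambda>i \<omega>. W (t (Suc i)) \<omega> - W (t i) \<omega>) {..<n})"

text \<open>Independence of the processes means independence of the path-valued random variables.\<close>

definition independent_brownian_motions :: "'w measure \<Rightarrow> (nat \<Rightarrow> real \<Rightarrow> 'w \<Rightarrow> real) \<Rightarrow> bool" where
  "independent_brownian_motions M B \<longleftrightarrow>
     (\<forall>j\<ge>1. brownian_motion M (B j)) \<and>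
     prob_space.indep_vars M (\<lambda>_. Pi\<^sub>M {0..} (\<lambda>_. borel)) (\<lambda>j \<omega>. \<lambda>t\<in>{0..}. B j t \<omega>) {1..}"

definition L2_limit :: "'w measure \<Rightarrow> (nat \<Rightarrow> 'w \<Rightarrow> real) \<Rightarrow> ('w \<Rightarrow> real) \<Rightarrow> bool" where
  "L2_limit M X Y \<longleftrightarrow>
     (\<forall>n. X n \<in> borel_measurable M) \<and> Y \<in> borel_measurable M \<and>
     (\<lambda>n. \<integral>\<^sup>+\<omega>. ennreal ((X n \<omega> - Y \<omega>)\<^sup>2) \<partial>M) \<longlonglongrightarrow> 0"

text \<open>
  Step functions are given by a number \<open>N\<close> of intervals, partition points \<open>s\<close> and values \<open>c\<close>.
\<close>

definition step_fun :: "nat \<Rightarrow> (nat \<Rightarrow> real) \<Rightarrow> (nat \<Rightarrow> real) \<Rightarrow> real \<Rightarrow> real" where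
  "step_fun N s c r = (\<Sum>i<N. c i * indicator {s i<..s (Suc i)} r)"

definition step_integral ::
  "(real \<Rightarrow> 'w \<Rightarrow> real) \<Rightarrow> nat \<Rightarrow> (nat \<Rightarrow> real) \<Rightarrow> (nat \<Rightarrow> real) \<Rightarrow> 'w \<Rightarrow> real"
where
  "step_integral W N s c \<omega> = (\<Sum>i<N. c i * (W (s (Suc i)) \<omega> - W (s i) \<omega>))"

text \<open>
  \<open>wiener_integral M W t h Y\<close>: \<open>Y\<close> is (a version of) the integral of the deterministic function
  \<open>h\<close> over \<open>[0,t]\<close> with respect to \<open>W\<close>, the limit in mean square of the integrals of step functions
  approximating \<open>h\<close> in mean square. By the isometry it does not depend on the approximation.
\<close>

definition wiener_integral ::
  "'w measure \<Rightarrow> (real \<Rightarrow> 'w \<Rightarrow> real) \<Rightarrow> real \<Rightarrow> (real \<Rightarrow> real) \<Rightarrow> ('w \<Rightarrow> real) \<Rightarrow> bool"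
where
  "wiener_integral M W t h Y \<longleftrightarrow> (\<exists>(N :: nat \<Rightarrow> nat) s c.
     (\<forall>n. 0 \<le> s n 0 \<and> (\<forall>i<N n. s n i \<le> s n (Suc i)) \<and> s n (N n) \<le> t) \<and>
     (\<lambda>n. \<integral>\<^sup>+r\<in>{0..t}. ennreal ((step_fun (N n) (s n) (c n) r - h r)\<^sup>2) \<partial>lborel) \<longlonglongrightarrow> 0 \<and>
     L2_limit M (\<lambda>n. step_integral W (N n) (s n) (c n)) Y)"

definition square_integrable :: "(real \<Rightarrow> real) \<Rightarrow> bool" where
  "square_integrable g \<longleftrightarrow>
     set_borel_measurable lborel {-pi..pi} g \<and> set_integrable lborel {-pi..pi} (\<lambda>x. (g x)\<^sup>2)"

text \<open>
  \<open>H2_laplacian g w\<close>: \<open>g\<close>, in its continuous representative on \<open>[-\<pi>,\<pi>]\<close>, is in \<open>H\<^sup>2((-\<pi>,\<pi>))\<close> with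
  weak second derivative \<open>w\<close>.
\<close>

definition H2_laplacian :: "(real \<Rightarrow> real) \<Rightarrow> (real \<Rightarrow> real) \<Rightarrow> bool" where
  "H2_laplacian g w \<longleftrightarrow> square_integrable w \<and> (\<exists>v.
     (\<forall>x\<in>{-pi..pi}. v x = v (-pi) + (LINT y:{-pi..x}|lborel. w y)) \<and>
     (\<forall>x\<in>{-pi..pi}. g x = g (-pi) + (LINT y:{-pi..x}|lborel. v y)))"

definition dirichlet_eigenbasis :: "(nat \<Rightarrow> real) \<Rightarrow> (nat \<Rightarrow> real \<Rightarrow> real) \<Rightarrow> bool" where
  "dirichlet_eigenbasis lam \<phi> \<longleftrightarrow>
     (\<forall>j\<ge>1. H2_laplacian (\<phi> j) (\<lambda>x. - lam j * \<phi> j x) \<and> \<phi> j (-pi) = 0 \<and> \<phi> j pi = 0) \<and>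
     (\<forall>i\<ge>1. \<forall>j\<ge>1. (LINT x:{-pi..pi}|lborel. \<phi> i x * \<phi> j x) = (if i = j then 1 else 0)) \<and>
     (\<forall>g. square_integrable g \<and> (\<forall>j\<ge>1. (LINT x:{-pi..pi}|lborel. g x * \<phi> j x) = 0) \<longrightarrow>
        (AE x in lborel. x \<in> {-pi..pi} \<longrightarrow> g x = 0))"

text \<open>
  The weak solution with zero initial condition driven by \<open>\<Sum>j\<ge>1. B j \<phi> j\<close>, in a continuous version;
  \<open>Z j t\<close> is the stochastic convolution of the \<open>j\<close>-th mode.
\<close>

definition stochastic_heat_solution ::
  "'w measure \<Rightarrow> (nat \<Rightarrow> real \<Rightarrow> 'w \<Rightarrow> real) \<Rightarrow> (nat \<Rightarrow> real) \<Rightarrow> (nat \<Rightarrow> real \<Rightarrow> real) \<Rightarrow>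
     (real \<Rightarrow> real \<Rightarrow> 'w \<Rightarrow> real) \<Rightarrow> bool"
where
  "stochastic_heat_solution M B lam \<phi> u \<longleftrightarrow>
     (\<exists>Z. (\<forall>j\<ge>1. \<forall>t\<ge>0. wiener_integral M (B j) t (\<lambda>s. exp (- lam j * (t - s))) (Z j t)) \<and>
          (\<forall>t\<ge>0. \<forall>x\<in>{-pi..pi}. L2_limit M (\<lambda>n \<omega>. \<Sum>j=1..n. Z j t \<omega> * \<phi> j x) (u t x))) \<and>
     (AE \<omega> in M. continuous_on ({0..} \<times> {-pi..pi}) (\<lambda>(t, x). u t x \<omega>))"


section \<open>Functions on the strip as distributions\<close>

text \<open>The \<open>2\<pi>\<close>-periodic function that agrees with \<open>h\<close> on \<open>[-\<pi>,\<pi>)\<close>.\<close>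

definition periodize :: "(real \<Rightarrow> real) \<Rightarrow> real \<Rightarrow> real" where
  "periodize h x = h (x - 2 * pi * of_int \<lfloor>(x + pi) / (2 * pi)\<rfloor>)"

definition strip_extension :: "real \<Rightarrow> (real \<Rightarrow> real \<Rightarrow> real) \<Rightarrow> real \<times> real \<Rightarrow> complex" where
  "strip_extension T h = (\<lambda>(t, x). if t \<in> {0..T} then of_real (periodize (h t) x) else 0)"

text \<open>
  Two ways in which a function on \<open>[0,T] \<times> [-\<pi>,\<pi>]\<close> can belong to the space on the strip.
  With extension by zero, a function with \<open>h T \<noteq> 0\<close> has a jump in time at \<open>T\<close>, so it is never a
  member if \<open>fst \<alpha> > 1 / fst p\<close>, however regular it is on the strip. The local notion asks only
  about the regularity on the strip: for all \<open>T' > T\<close> the function is the restriction of a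
  member of the space on \<open>[0,T']\<close>. Here too the support condition forces the extension to vanish
  for negative times.
\<close>

definition in_besov_strip ::
  "(real \<Rightarrow> real) \<Rightarrow> (real \<Rightarrow> real) \<Rightarrow> real \<times> real \<Rightarrow> real \<times> real \<Rightarrow> real \<times> real \<Rightarrow> real \<Rightarrow>
     (real \<Rightarrow> real \<Rightarrow> real) \<Rightarrow> bool"
where
  "in_besov_strip \<theta> \<rho> \<alpha> p q T h \<longleftrightarrow>
     (\<exists>F \<in> besov_strip \<theta> \<rho> \<alpha> p q T. represents (strip_extension T h) F)"

definition locally_in_besov_strip ::
  "(real \<Rightarrow> real) \<Rightarrow> (real \<Rightarrow> real) \<Rightarrow> real \<times> real \<Rightarrow> real \<times> real \<Rightarrow> real \<times> real \<Rightarrow> real \<Rightarrow>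
     (real \<Rightarrow> real \<Rightarrow> real) \<Rightarrow> bool"
where
  "locally_in_besov_strip \<theta> \<rho> \<alpha> p q T h \<longleftrightarrow>
     (\<forall>T'>T. \<exists>F \<in> besov_strip \<theta> \<rho> \<alpha> p q T'. \<exists>g. represents g F \<and>
        (\<forall>t\<in>{0..T}. \<forall>x. g (t, x) = strip_extension T h (t, x)))"

end

theory Submission
  imports Defs
begin

text \<open>
  Increments of \<open>u\<close> are centred Gaussian. With \<open>\<phi> j'' = - lam j * \<phi> j\<close>, both \<open>\<phi> j\<close> and \<open>\<phi> j' / sqrt (lam j)\<close>
  are orthonormal, and Bessel's inequality for indicator functions of intervals bounds the variance of
  a time increment by a multiple of \<open>sqrt \<bar>t - s\<bar>\<close> and that of a space increment by \<open>\<bar>x - y\<bar>\<close>; the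
  eigenfunctions need not be computed. A rectangular increment satisfies both bounds, hence their
  geometric mean with weights \<open>a\<close> and \<open>1 - a\<close>, and its moments are controlled by its variance.

  The block \<open>(j, k)\<close> of a bounded function \<open>g\<close> is the convolution of \<open>g\<close> with a product of two kernels;
  those with positive index have mean zero, so \<open>g\<close> may be replaced by its increments. Minkowski's
  inequality then bounds the \<open>p\<close>-th moment of the \<open>L\<^sup>p\<close> norm of the block by
  \<open>2 powr (- p * (j * \<beta>1 + k * \<beta>2))\<close>, and the expected sum over all blocks is finite. The function
  \<open>g\<close> is \<open>u\<close> times a cut-off in time. A Lipschitz cut-off leaves \<open>\<beta>1 = a / 4\<close>; a jump at \<open>T\<close> contributes
  \<open>\<bar>s\<bar>\<close> to the \<open>p\<close>-th power of the \<open>L\<^sup>p\<close> norm of an increment and so costs \<open>\<beta>1 \<le> 1 / p\<close>.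
\<close>

section \<open>Gaussian random variables\<close>

text \<open>The term 1/q in \<alpha> is the room for summation: \<alpha> lies below (a/4, (1 - a)/2)
  by 1/q in both coordinates, so the weighted block sizes decay geometrically in both indices. As p
  is even, the p-th moment of a Gaussian is a constant times the power p/2 of its variance. A time
  increment thus contributes |s| to the power p/4 and a space increment |y| to the power p/2, and
  interpolation turns these into p a/4 and p (1 - a)/2. The bounds available are for p-th moments,
  while the norm sums q-th powers; q <= p allows the passage at the expected size of each block.

  A second obstacle is that blocks need a function on the whole plane. Zero boundary values allow a
  continuous periodic extension in space, and zero initial values allow a continuous extension by 0
  to negative times. Each of these values vanishes only almost surely for a fixed point; continuity
  makes one null set serve for all points, and the field is replaced by 0 on that set. At time T no
  such vanishing is available, which is where the two notions of membership part.\<close>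

definition centered_gaussian :: "'a measure \<Rightarrow> ('a \<Rightarrow> real) \<Rightarrow> real \<Rightarrow> bool" where
  "centered_gaussian M X v \<longleftrightarrow> X \<in> borel_measurable M \<and> 0 \<le> v \<and>
     distr M borel X = distr std_normal_distribution borel (\<lambda>x. sqrt v * x)"

context prob_space
begin

lemma char_scaled_std_normal:
  assumes "0 \<le> v"
  shows "char (distr std_normal_distribution borel (\<lambda>x. sqrt v * x)) t
    = complex_of_real (exp (- (v * t\<^sup>2) / 2))"
proof -
  have "char (distr std_normal_distribution borel (\<lambda>x. sqrt v * x)) t
      = char std_normal_distribution (t * sqrt v)"
    unfolding char_def by (subst integral_distr) (auto simp: mult.assoc)
  then show ?thesis
    using assms by (simp add: char_std_normal_distribution power_mult_distrib mult.commute)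
qed

text \<open>Characteristic functions turn independent sums into products and survive mean-square
  limits, so all closure properties below are read off from this form. Variance 0 is included, hence
  degenerate increments are Gaussian too.\<close>

lemma centered_gaussian_iff_char:
  "centered_gaussian M X v \<longleftrightarrow> X \<in> borel_measurable M \<and> 0 \<le> v \<and>
     (\<forall>t. char (distr M borel X) t = complex_of_real (exp (- (v * t\<^sup>2) / 2)))"
    (is "?L \<longleftrightarrow> ?R")
proof
  assume ?R
  interpret N: prob_space std_normal_distribution
    using prob_space_normal_density by simp
  have "distr M borel X = distr std_normal_distribution borel (\<lambda>x. sqrt v * x)"
  proof (rule Levy_uniqueness)
    show "real_distribution (distr M borel X)"
      using \<open>?R\<close> by (intro real_distribution_distr) auto
    show "real_distribution (distr std_normal_distribution borel (\<lambda>x. sqrt v * x))"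
      by (intro N.real_distribution_distr) auto
    show "char (distr M borel X) = char (distr std_normal_distribution borel (\<lambda>x. sqrt v * x))"
      using \<open>?R\<close> char_scaled_std_normal by auto
  qed
  then show ?L using \<open>?R\<close> by (simp add: centered_gaussian_def)
qed (auto simp: centered_gaussian_def char_scaled_std_normal)

lemma distributed_normal_centered_gaussian:
  assumes "distributed M lborel X (\<lambda>x. ennreal (normal_density 0 \<sigma> x))" "0 < \<sigma>"
  shows "centered_gaussian M X (\<sigma>\<^sup>2)"
proof -
  have X: "X \<in> borel_measurable M"
    using distributed_measurable[OF assms(1)] by simp
  have "distributed M lborel (\<lambda>x. 0 + X x * (1 / \<sigma>)) (\<lambda>x. ennreal (normal_density (0 + 0 * (1 / \<sigma>)) (\<bar>1 / \<sigma>\<bar> * \<sigma>) x))"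
    using normal_density_affine[OF assms, of "1 / \<sigma>" 0] assms(2) by (simp add: mult.commute)
  then have "distributed M lborel (\<lambda>x. X x / \<sigma>) (\<lambda>x. ennreal (std_normal_density x))"
    using assms(2) by simp
  then have "distr M lborel (\<lambda>x. X x / \<sigma>) = std_normal_distribution"
    by (simp add: distributed_def)
  then have *: "distr M borel (\<lambda>x. X x / \<sigma>) = std_normal_distribution"
    by (metis distr_cong sets_lborel)
  have "distr M borel X = distr (distr M borel (\<lambda>x. X x / \<sigma>)) borel (\<lambda>x. \<sigma> * x)"
    using assms(2) X by (subst distr_distr) (auto simp: comp_def)
  then show ?thesis
    using * X assms(2) by (simp add: centered_gaussian_def)
qed

lemma centered_gaussian_AE_cong:
  assumes "centered_gaussian M X v" "AE \<omega> in M. X \<omega> = Y \<omega>" "Y \<in> borel_measurable M"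
  shows "centered_gaussian M Y v"
proof -
  have "distr M borel X = distr M borel Y"
    using assms by (intro distr_cong_AE) (auto simp: centered_gaussian_def)
  then show ?thesis using assms by (simp add: centered_gaussian_def)
qed

lemma centered_gaussian_zero: "centered_gaussian M (\<lambda>_. 0) 0"
  by (simp add: centered_gaussian_iff_char char_def integral_distr prob_space del: distr_const)

lemma centered_gaussian_scale:
  assumes "centered_gaussian M X v"
  shows "centered_gaussian M (\<lambda>\<omega>. c * X \<omega>) (c\<^sup>2 * v)"
proof -
  have [measurable]: "X \<in> borel_measurable M" using assms by (simp add: centered_gaussian_def)
  have "char (distr M borel (\<lambda>\<omega>. c * X \<omega>)) t = char (distr M borel X) (t * c)" for t
    by (simp add: char_def integral_distr mult.assoc)
  then show ?thesis using assms by (simp add: centered_gaussian_iff_char power_mult_distrib mult_ac)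
qed

lemma centered_gaussian_sum:
  assumes "indep_vars (\<lambda>_. borel) X I" "\<And>i. i \<in> I \<Longrightarrow> centered_gaussian M (X i) (v i)" "finite I"
  shows "centered_gaussian M (\<lambda>\<omega>. \<Sum>i\<in>I. X i \<omega>) (\<Sum>i\<in>I. v i)"
proof -
  have "char (distr M borel (\<lambda>\<omega>. \<Sum>i\<in>I. X i \<omega>)) t
      = complex_of_real (exp (- ((\<Sum>i\<in>I. v i) * t\<^sup>2) / 2))" for t
  proof -
    have "char (distr M borel (\<lambda>\<omega>. \<Sum>i\<in>I. X i \<omega>)) t
        = (\<Prod>i\<in>I. complex_of_real (exp (- (v i * t\<^sup>2) / 2)))"
      using assms by (simp add: char_distr_sum centered_gaussian_iff_char)
    also have "\<dots> = complex_of_real (exp (\<Sum>i\<in>I. - (v i * t\<^sup>2) / 2))"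
      by (subst exp_sum[OF assms(3)]) (simp only: of_real_prod)
    finally show ?thesis
      by (simp add: sum_negf sum_divide_distrib sum_distrib_right)
  qed
  then show ?thesis
    using assms(2) by (auto simp: centered_gaussian_iff_char intro!: sum_nonneg borel_measurable_sum)
qed

text \<open>The constant is the double factorial (2m - 1)!!. Through this identity a variance bound
  becomes a moment bound of any even order.\<close>

lemma centered_gaussian_moment:
  assumes "centered_gaussian M X v"
  shows "(\<integral>\<^sup>+\<omega>. ennreal (\<bar>X \<omega>\<bar> ^ (2 * m)) \<partial>M) = ennreal (fact (2 * m) / (2 ^ m * fact m) * v ^ m)"
proof -
  have [measurable]: "X \<in> borel_measurable M" and v: "0 \<le> v"
    and D: "distr M borel X = distr std_normal_distribution borel (\<lambda>x. sqrt v * x)"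
    using assms by (auto simp: centered_gaussian_def)
  have "(\<integral>\<^sup>+\<omega>. ennreal (\<bar>X \<omega>\<bar> ^ (2 * m)) \<partial>M) = (\<integral>\<^sup>+x. ennreal (\<bar>x\<bar> ^ (2 * m)) \<partial>distr M borel X)"
    by (subst nn_integral_distr) auto
  also have "\<dots> = (\<integral>\<^sup>+x. ennreal (v ^ m * x ^ (2 * m)) \<partial>std_normal_distribution)"
    unfolding D by (subst nn_integral_distr)
      (use v in \<open>auto simp: power_mult power_mult_distrib power2_abs\<close>)
  also have "\<dots> = ennreal (LINT x|std_normal_distribution. v ^ m * x ^ (2 * m))"
    by (rule nn_integral_eq_integral)
       (use v std_normal_distribution_even_moments(2) in \<open>auto simp: power_mult\<close>)
  also have "(LINT x|std_normal_distribution. v ^ m * x ^ (2 * m)) = v ^ m * (fact (2 * m) / (2 ^ m * fact m))"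
    by (simp add: std_normal_distribution_even_moments)
  finally show ?thesis by (simp add: mult.commute)
qed

text \<open>The map x to exp(i t x) is Lipschitz with constant |t|, and a distance D is at most e +
  D^2 / e. The free parameter e stands in for a Cauchy-Schwarz estimate of the first absolute
  moment.\<close>

lemma norm_char_distr_diff_le:
  assumes [measurable]: "X \<in> borel_measurable M" "Y \<in> borel_measurable M" and "0 < e"
    and fin: "integrable M (\<lambda>\<omega>. (X \<omega> - Y \<omega>)\<^sup>2)"
  shows "norm (char (distr M borel X) t - char (distr M borel Y) t)
      \<le> \<bar>t\<bar> * (e + expectation (\<lambda>\<omega>. (X \<omega> - Y \<omega>)\<^sup>2) / e)"
proof -
  have pt: "norm (iexp (t * X \<omega>) - iexp (t * Y \<omega>)) \<le> \<bar>t\<bar> * (e + (X \<omega> - Y \<omega>)\<^sup>2 / e)" for \<omega>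
  proof -
    have "norm (iexp (t * X \<omega>) - iexp (t * Y \<omega>)) = norm (iexp (t * Y \<omega>) * (iexp (t * (X \<omega> - Y \<omega>)) - 1))"
      by (simp add: algebra_simps exp_add[symmetric])
    also have "\<dots> \<le> \<bar>t * (X \<omega> - Y \<omega>)\<bar>"
      using iexp_approx1[of "t * (X \<omega> - Y \<omega>)" 0] by (simp add: norm_mult)
    also have "\<dots> = \<bar>t\<bar> * \<bar>X \<omega> - Y \<omega>\<bar>" by (simp add: abs_mult)
    also have "\<bar>X \<omega> - Y \<omega>\<bar> \<le> e + (X \<omega> - Y \<omega>)\<^sup>2 / e"
    proof -
      have "2 * (e * \<bar>X \<omega> - Y \<omega>\<bar>) \<le> e\<^sup>2 + (X \<omega> - Y \<omega>)\<^sup>2"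
        using sum_squares_bound[of e "\<bar>X \<omega> - Y \<omega>\<bar>"] by simp
      then have "e * \<bar>X \<omega> - Y \<omega>\<bar> \<le> e\<^sup>2 + (X \<omega> - Y \<omega>)\<^sup>2"
        using mult_nonneg_nonneg[of e "\<bar>X \<omega> - Y \<omega>\<bar>"] \<open>0 < e\<close> by linarith
      then show ?thesis
        using \<open>0 < e\<close> by (simp add: field_simps power2_eq_square)
    qed
    finally show ?thesis by (simp add: mult_left_mono)
  qed
  have "char (distr M borel X) t - char (distr M borel Y) t
      = (CLINT \<omega>|M. iexp (t * X \<omega>) - iexp (t * Y \<omega>))"
    unfolding char_def by (simp add: integral_distr) 
       (intro Bochner_Integration.integral_diff[symmetric] integrable_iexp; simp)
  also have "norm \<dots> \<le> expectation (\<lambda>\<omega>. \<bar>t\<bar> * (e + (X \<omega> - Y \<omega>)\<^sup>2 / e))"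
    using fin pt by (intro order_trans[OF Bochner_Integration.integral_norm_bound] integral_mono)
      (auto intro!: integrable_norm Bochner_Integration.integrable_diff integrable_iexp)
  also have "\<dots> = \<bar>t\<bar> * (e + expectation (\<lambda>\<omega>. (X \<omega> - Y \<omega>)\<^sup>2) / e)"
    using fin by (simp add: prob_space)
  finally show ?thesis .
qed

lemma centered_gaussian_L2_limit:
  assumes lim: "L2_limit M X Y" and g: "\<And>n. centered_gaussian M (X n) (v n)" and v: "v \<longlonglongrightarrow> w"
  shows "centered_gaussian M Y w"
proof -
  have [measurable]: "\<And>n. X n \<in> borel_measurable M" "Y \<in> borel_measurable M"
    and L: "(\<lambda>n. \<integral>\<^sup>+\<omega>. ennreal ((X n \<omega> - Y \<omega>)\<^sup>2) \<partial>M) \<longlonglongrightarrow> 0"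
    using lim by (auto simp: L2_limit_def)
  have w: "0 \<le> w" using v g by (intro LIMSEQ_le_const) (auto simp: centered_gaussian_def)
  have "char (distr M borel Y) t = complex_of_real (exp (- (w * t\<^sup>2) / 2))" for t
  proof (rule LIMSEQ_unique)
    show "(\<lambda>n. char (distr M borel (X n)) t) \<longlonglongrightarrow> complex_of_real (exp (- (w * t\<^sup>2) / 2))"
      using g by (auto simp: centered_gaussian_iff_char intro!: tendsto_intros v)
    show "(\<lambda>n. char (distr M borel (X n)) t) \<longlonglongrightarrow> char (distr M borel Y) t"
    proof (rule LIMSEQ_I)
      fix r :: real assume "0 < r"
      \<comment> \<open>Once the mean square is below \<open>e\<^sup>2\<close>, both summands of the
        previous bound are at most e, and this choice gives
        \<open>\<bar>t\<bar> * (e + e) < r\<close>. The + 1 covers t = 0.\<close>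
      define e where "e = r / (2 * (\<bar>t\<bar> + 1))"
      have e: "0 < e" using \<open>0 < r\<close> by (simp add: e_def add_nonneg_pos)
      have "\<forall>\<^sub>F n in sequentially. (\<integral>\<^sup>+\<omega>. ennreal ((X n \<omega> - Y \<omega>)\<^sup>2) \<partial>M) < ennreal (e\<^sup>2)"
        using L e by (intro order_tendstoD(2)[OF L]) simp
      then obtain N where N: "\<And>n. n \<ge> N \<Longrightarrow> (\<integral>\<^sup>+\<omega>. ennreal ((X n \<omega> - Y \<omega>)\<^sup>2) \<partial>M) < ennreal (e\<^sup>2)"
        by (auto simp: eventually_sequentially)
      show "\<exists>no. \<forall>n\<ge>no. norm (char (distr M borel (X n)) t - char (distr M borel Y) t) < r"
      proof (intro exI[of _ N] allI impI)
        fix n assume "N \<le> n"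
        have int: "integrable M (\<lambda>\<omega>. (X n \<omega> - Y \<omega>)\<^sup>2)"
          using N[OF \<open>N \<le> n\<close>] by (intro integrableI_nonneg) (auto intro: order.strict_trans)
        have "ennreal (expectation (\<lambda>\<omega>. (X n \<omega> - Y \<omega>)\<^sup>2)) < ennreal (e\<^sup>2)"
          using N[OF \<open>N \<le> n\<close>] nn_integral_eq_integral[OF int] by simp
        then have E: "expectation (\<lambda>\<omega>. (X n \<omega> - Y \<omega>)\<^sup>2) < e\<^sup>2"
          by (subst (asm) ennreal_less_iff) auto
        have "norm (char (distr M borel (X n)) t - char (distr M borel Y) t)
            \<le> \<bar>t\<bar> * (e + expectation (\<lambda>\<omega>. (X n \<omega> - Y \<omega>)\<^sup>2) / e)"
          using norm_char_distr_diff_le[OF _ _ e int] by simp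
        also have "\<dots> \<le> \<bar>t\<bar> * (e + e)"
          using E e by (intro mult_left_mono add_left_mono) (auto simp: field_simps power2_eq_square)
        also have "\<dots> < r"
        proof -
          have "e * (2 * (\<bar>t\<bar> + 1)) = r"
            unfolding e_def by (subst times_divide_eq_left, rule nonzero_mult_div_cancel_right) (use abs_ge_zero[of t] in auto)
          then have "\<bar>t\<bar> * (e + e) + 2 * e = r"
            by (simp only: algebra_simps)
          then show ?thesis using e by linarith
        qed
        finally show "norm (char (distr M borel (X n)) t - char (distr M borel Y) t) < r" .
      qed
    qed
  qed
  then show ?thesis using w by (simp add: centered_gaussian_iff_char)
qed

end

section \<open>Linearity of mean-square limits and convergence of second moments\<close>

lemma L2_limit_scale:
  assumes "L2_limit M X Y"
  shows "L2_limit M (\<lambda>n \<omega>. c * X n \<omega>) (\<lambda>\<omega>. c * Y \<omega>)"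
proof -
  have [measurable]: "\<And>n. X n \<in> borel_measurable M" "Y \<in> borel_measurable M"
    and L: "(\<lambda>n. \<integral>\<^sup>+\<omega>. ennreal ((X n \<omega> - Y \<omega>)\<^sup>2) \<partial>M) \<longlonglongrightarrow> 0"
    using assms by (auto simp: L2_limit_def)
  have "(\<integral>\<^sup>+\<omega>. ennreal ((c * X n \<omega> - c * Y \<omega>)\<^sup>2) \<partial>M)
      = ennreal (c\<^sup>2) * (\<integral>\<^sup>+\<omega>. ennreal ((X n \<omega> - Y \<omega>)\<^sup>2) \<partial>M)" for n
    by (subst nn_integral_cmult[symmetric])
       (auto simp: ennreal_mult'[symmetric] power_mult_distrib[symmetric] algebra_simps intro!: nn_integral_cong)
  moreover have "(\<lambda>n. ennreal (c\<^sup>2) * (\<integral>\<^sup>+\<omega>. ennreal ((X n \<omega> - Y \<omega>)\<^sup>2) \<partial>M)) \<longlonglongrightarrow> ennreal (c\<^sup>2) * 0"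
    by (intro ennreal_tendsto_cmult L) simp
  ultimately show ?thesis by (simp add: L2_limit_def)
qed

lemma L2_limit_add:
  assumes "L2_limit M X Y" "L2_limit M X' Y'"
  shows "L2_limit M (\<lambda>n \<omega>. X n \<omega> + X' n \<omega>) (\<lambda>\<omega>. Y \<omega> + Y' \<omega>)"
proof -
  have [measurable]: "\<And>n. X n \<in> borel_measurable M" "Y \<in> borel_measurable M"
    "\<And>n. X' n \<in> borel_measurable M" "Y' \<in> borel_measurable M"
    and L: "(\<lambda>n. \<integral>\<^sup>+\<omega>. ennreal ((X n \<omega> - Y \<omega>)\<^sup>2) \<partial>M) \<longlonglongrightarrow> 0"
      "(\<lambda>n. \<integral>\<^sup>+\<omega>. ennreal ((X' n \<omega> - Y' \<omega>)\<^sup>2) \<partial>M) \<longlonglongrightarrow> 0"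
    using assms by (auto simp: L2_limit_def)
  have le: "(\<integral>\<^sup>+\<omega>. ennreal ((X n \<omega> + X' n \<omega> - (Y \<omega> + Y' \<omega>))\<^sup>2) \<partial>M)
      \<le> 2 * (\<integral>\<^sup>+\<omega>. ennreal ((X n \<omega> - Y \<omega>)\<^sup>2) \<partial>M) + 2 * (\<integral>\<^sup>+\<omega>. ennreal ((X' n \<omega> - Y' \<omega>)\<^sup>2) \<partial>M)" for n
  proof -
    have "(X n \<omega> + X' n \<omega> - (Y \<omega> + Y' \<omega>))\<^sup>2 \<le> 2 * (X n \<omega> - Y \<omega>)\<^sup>2 + 2 * (X' n \<omega> - Y' \<omega>)\<^sup>2" for \<omega>
      using sum_squares_bound[of "X n \<omega> - Y \<omega>" "X' n \<omega> - Y' \<omega>"]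
      by (simp add: power2_eq_square algebra_simps)
    then have "ennreal ((X n \<omega> + X' n \<omega> - (Y \<omega> + Y' \<omega>))\<^sup>2)
        \<le> 2 * ennreal ((X n \<omega> - Y \<omega>)\<^sup>2) + 2 * ennreal ((X' n \<omega> - Y' \<omega>)\<^sup>2)" for \<omega>
      by (subst (1 2) ennreal_numeral[symmetric], subst (1 2) ennreal_mult[symmetric])
         (auto simp: ennreal_plus[symmetric] simp del: ennreal_plus intro!: ennreal_leI)
    then have "(\<integral>\<^sup>+\<omega>. ennreal ((X n \<omega> + X' n \<omega> - (Y \<omega> + Y' \<omega>))\<^sup>2) \<partial>M)
      \<le> (\<integral>\<^sup>+\<omega>. 2 * ennreal ((X n \<omega> - Y \<omega>)\<^sup>2) + 2 * ennreal ((X' n \<omega> - Y' \<omega>)\<^sup>2) \<partial>M)"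
      by (intro nn_integral_mono)
    then show ?thesis
      by (simp add: nn_integral_add nn_integral_cmult)
  qed
  have lim: "(\<lambda>n. 2 * (\<integral>\<^sup>+\<omega>. ennreal ((X n \<omega> - Y \<omega>)\<^sup>2) \<partial>M) + 2 * (\<integral>\<^sup>+\<omega>. ennreal ((X' n \<omega> - Y' \<omega>)\<^sup>2) \<partial>M))
      \<longlonglongrightarrow> 2 * 0 + 2 * 0"
    by (intro tendsto_add ennreal_tendsto_cmult L) simp_all
  have "(\<lambda>n. \<integral>\<^sup>+\<omega>. ennreal ((X n \<omega> + X' n \<omega> - (Y \<omega> + Y' \<omega>))\<^sup>2) \<partial>M) \<longlonglongrightarrow> 0"
    (is "?f \<longlonglongrightarrow> 0")
  proof (rule tendsto_sandwich[where f="\<lambda>_. 0"])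
    show "\<forall>\<^sub>F n in sequentially. ?f n \<le> 2 * (\<integral>\<^sup>+\<omega>. ennreal ((X n \<omega> - Y \<omega>)\<^sup>2) \<partial>M)
        + 2 * (\<integral>\<^sup>+\<omega>. ennreal ((X' n \<omega> - Y' \<omega>)\<^sup>2) \<partial>M)"
      using le by simp
    show "(\<lambda>n. 2 * (\<integral>\<^sup>+\<omega>. ennreal ((X n \<omega> - Y \<omega>)\<^sup>2) \<partial>M)
        + 2 * (\<integral>\<^sup>+\<omega>. ennreal ((X' n \<omega> - Y' \<omega>)\<^sup>2) \<partial>M)) \<longlonglongrightarrow> 0"
      using lim by simp
    show "\<forall>\<^sub>F n in sequentially. 0 \<le> ?f n" by simp
    show "(\<lambda>n. 0 :: ennreal) \<longlonglongrightarrow> 0" by simp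
  qed
  then show ?thesis by (simp add: L2_limit_def)
qed

lemma L2_limit_sum:
  assumes "finite J" "\<And>j. j \<in> J \<Longrightarrow> L2_limit M (X j) (Y j)"
  shows "L2_limit M (\<lambda>n \<omega>. \<Sum>j\<in>J. X j n \<omega>) (\<lambda>\<omega>. \<Sum>j\<in>J. Y j \<omega>)"
  using assms
proof (induction J rule: finite_induct)
  case empty
  then show ?case by (simp add: L2_limit_def)
next
  case (insert j J)
  then show ?case using L2_limit_add[of M "X j" "Y j"] by simp
qed


text \<open>Applied to integrands over \<open>lborel\<close>, this carries the variances of
  elementary integrals to the limit. It rests on |F^2 - G^2| <= (1 + 1/e) (F - G)^2 + e G^2.\<close>

lemma L2_limit_square_integral:
  assumes lim: "L2_limit M F G" and G: "integrable M (\<lambda>x. (G x)\<^sup>2)"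
    and F: "\<And>n. integrable M (\<lambda>x. (F n x)\<^sup>2)"
  shows "(\<lambda>n. LINT x|M. (F n x)\<^sup>2) \<longlonglongrightarrow> (LINT x|M. (G x)\<^sup>2)"
proof (rule LIMSEQ_I)
  fix r :: real assume "0 < r"
  have [measurable]: "\<And>n. F n \<in> borel_measurable M" "G \<in> borel_measurable M"
    and L: "(\<lambda>n. \<integral>\<^sup>+x. ennreal ((F n x - G x)\<^sup>2) \<partial>M) \<longlonglongrightarrow> 0"
    using lim by (auto simp: L2_limit_def)
  define I where "I = (LINT x|M. (G x)\<^sup>2)"
  have I: "0 \<le> I" by (simp add: I_def)
  \<comment> \<open>This makes the G part smaller than r/2, also when I = 0 because of the + 1; the
    number d below then bounds the other part by r/2.\<close>
  define e where "e = r / (2 * (I + 1))"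
  have e: "0 < e" "e * I < r / 2"
    using \<open>0 < r\<close> I by (auto simp: e_def field_simps)
  define d where "d = r / 2 / (1 + 1 / e)"
  have e1: "0 < 1 + 1 / e" using e by (simp add: add_pos_pos)
  have de: "(1 + 1 / e) * d = r / 2"
    unfolding d_def by (subst times_divide_eq_right, rule nonzero_mult_div_cancel_left) (use e1 in simp)
  have d: "0 < d" using e1 \<open>0 < r\<close> unfolding d_def by (intro divide_pos_pos) auto
  have "\<forall>\<^sub>F n in sequentially. (\<integral>\<^sup>+x. ennreal ((F n x - G x)\<^sup>2) \<partial>M) < ennreal d"
    using d by (intro order_tendstoD(2)[OF L]) simp
  then obtain N where N: "\<And>n. n \<ge> N \<Longrightarrow> (\<integral>\<^sup>+x. ennreal ((F n x - G x)\<^sup>2) \<partial>M) < ennreal d"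
    by (auto simp: eventually_sequentially)
  show "\<exists>no. \<forall>n\<ge>no. norm ((LINT x|M. (F n x)\<^sup>2) - (LINT x|M. (G x)\<^sup>2)) < r"
  proof (intro exI[of _ N] allI impI)
    fix n assume "N \<le> n"
    have int: "integrable M (\<lambda>x. (F n x - G x)\<^sup>2)"
      using N[OF \<open>N \<le> n\<close>] by (intro integrableI_nonneg) (auto intro: order.strict_trans)
    have "ennreal (LINT x|M. (F n x - G x)\<^sup>2) < ennreal d"
      using N[OF \<open>N \<le> n\<close>] nn_integral_eq_integral[OF int] by simp
    then have small: "(LINT x|M. (F n x - G x)\<^sup>2) < d"
      by (subst (asm) ennreal_less_iff) auto
    have pt: "\<bar>(F n x)\<^sup>2 - (G x)\<^sup>2\<bar> \<le> (1 + 1 / e) * (F n x - G x)\<^sup>2 + e * (G x)\<^sup>2" for x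
    proof -
      let ?a = "F n x - G x" and ?b = "G x"
      have "0 \<le> (\<bar>?a\<bar> - e * \<bar>?b\<bar>)\<^sup>2" by simp
      then have "2 * e * (\<bar>?a\<bar> * \<bar>?b\<bar>) \<le> ?a\<^sup>2 + e * e * ?b\<^sup>2"
        by (simp add: power2_diff power_mult_distrib power2_eq_square[of e] mult_ac)
      then have "(2 * e * (\<bar>?a\<bar> * \<bar>?b\<bar>)) / e \<le> (?a\<^sup>2 + e * e * ?b\<^sup>2) / e"
        using e by (intro divide_right_mono) auto
      then have "2 * (\<bar>?a\<bar> * \<bar>?b\<bar>) \<le> (1 / e) * ?a\<^sup>2 + e * ?b\<^sup>2"
        using e by (simp add: add_divide_distrib)
      moreover have "(F n x)\<^sup>2 - (G x)\<^sup>2 = ?a\<^sup>2 + 2 * (?a * ?b)"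
        by (simp add: power2_eq_square algebra_simps)
      moreover have "\<bar>?a\<^sup>2 + 2 * (?a * ?b)\<bar> \<le> ?a\<^sup>2 + 2 * (\<bar>?a\<bar> * \<bar>?b\<bar>)"
        by (rule order_trans[OF abs_triangle_ineq]) (simp add: abs_mult)
      ultimately show ?thesis by (simp add: distrib_right)
    qed
    have "norm ((LINT x|M. (F n x)\<^sup>2) - (LINT x|M. (G x)\<^sup>2)) = norm (LINT x|M. (F n x)\<^sup>2 - (G x)\<^sup>2)"
      using F G by (simp add: Bochner_Integration.integral_diff)
    also have "\<dots> \<le> (LINT x|M. norm ((F n x)\<^sup>2 - (G x)\<^sup>2))"
      by (rule Bochner_Integration.integral_norm_bound)
    also have "\<dots> \<le> (LINT x|M. (1 + 1 / e) * (F n x - G x)\<^sup>2 + e * (G x)\<^sup>2)"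
      using F G int pt by (intro integral_mono) auto
    also have "\<dots> = (1 + 1 / e) * (LINT x|M. (F n x - G x)\<^sup>2) + e * I"
      using int G by (simp add: I_def)
    also have "\<dots> \<le> (1 + 1 / e) * d + e * I"
      using small e by (intro add_right_mono mult_left_mono) auto
    also have "\<dots> < r" using de e by simp
    finally show "norm ((LINT x|M. (F n x)\<^sup>2) - (LINT x|M. (G x)\<^sup>2)) < r" .
  qed
qed

section \<open>Wiener integrals with respect to independent Brownian motions\<close>

text \<open>\<open>f\<close> is the integrand of the elementary integral \<open>X\<close> with respect to \<open>W\<close>.\<close>

definition elementary :: "(real \<Rightarrow> 'w \<Rightarrow> real) \<Rightarrow> ('w \<Rightarrow> real) \<Rightarrow> (real \<Rightarrow> real) \<Rightarrow> bool" where
  "elementary W X f \<longleftrightarrow> (\<exists>S c. finite S \<and> S \<subseteq> {0..} \<and>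
     X = (\<lambda>\<omega>. \<Sum>t\<in>S. c t * W t \<omega>) \<and> f = (\<lambda>r. \<Sum>t\<in>S. c t * indicator {0<..t} r))"

lemma elementary_single: "0 \<le> t \<Longrightarrow> elementary W (W t) (indicator {0<..t})"
  unfolding elementary_def by (intro exI[of _ "{t}"] exI[of _ "\<lambda>_. 1"]) auto

lemma elementary_zero: "elementary W (\<lambda>_. 0) (\<lambda>_. 0)"
  unfolding elementary_def by (intro exI[of _ "{}"]) auto

lemma elementary_scale:
  assumes "elementary W X f"
  shows "elementary W (\<lambda>\<omega>. a * X \<omega>) (\<lambda>r. a * f r)"
proof -
  obtain S c where *: "finite S" "S \<subseteq> {0..}" "X = (\<lambda>\<omega>. \<Sum>t\<in>S. c t * W t \<omega>)"
    "f = (\<lambda>r. \<Sum>t\<in>S. c t * indicator {0<..t} r)"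
    using assms by (auto simp: elementary_def)
  then show ?thesis
    unfolding elementary_def
    by (intro exI[of _ S] exI[of _ "\<lambda>t. a * c t"]) (simp only: sum_distrib_left mult.assoc simp_thms)
qed

text \<open>Describing an elementary integral by sampling times instead of a partition makes
  addition a union of finite sets; no common refinement of partitions has to be formed.\<close>

lemma elementary_add:
  assumes "elementary W X f" "elementary W X' f'"
  shows "elementary W (\<lambda>\<omega>. X \<omega> + X' \<omega>) (\<lambda>r. f r + f' r)"
proof -
  obtain S c where *: "finite S" "S \<subseteq> {0..}" "X = (\<lambda>\<omega>. \<Sum>t\<in>S. c t * W t \<omega>)"
    "f = (\<lambda>r. \<Sum>t\<in>S. c t * indicator {0<..t} r)"
    using assms by (auto simp: elementary_def)
  obtain S' c' where **: "finite S'" "S' \<subseteq> {0..}" "X' = (\<lambda>\<omega>. \<Sum>t\<in>S'. c' t * W t \<omega>)"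
    "f' = (\<lambda>r. \<Sum>t\<in>S'. c' t * indicator {0<..t} r)"
    using assms by (auto simp: elementary_def)
  define d where "d t = (if t \<in> S then c t else 0) + (if t \<in> S' then c' t else 0)" for t
  have "(\<Sum>t\<in>S. c t * g t) + (\<Sum>t\<in>S'. c' t * g t) = (\<Sum>t\<in>S \<union> S'. d t * g t)" for g :: "real \<Rightarrow> real"
  proof -
    have "(\<Sum>t\<in>S. c t * g t) = (\<Sum>t\<in>S \<union> S'. (if t \<in> S then c t else 0) * g t)"
      using * ** by (intro sum.mono_neutral_cong_left) auto
    moreover have "(\<Sum>t\<in>S'. c' t * g t) = (\<Sum>t\<in>S \<union> S'. (if t \<in> S' then c' t else 0) * g t)"
      using * ** by (intro sum.mono_neutral_cong_left) auto
    ultimately show ?thesis by (simp add: d_def distrib_right sum.distrib)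
  qed
  then show ?thesis
    unfolding elementary_def *(3,4) **(3,4) using *(1,2) **(1,2)
    by (intro exI[of _ "S \<union> S'"] exI[of _ d]) (simp only: finite_Un Un_least simp_thms)
qed

lemma elementary_sum:
  assumes "finite I" "\<And>i. i \<in> I \<Longrightarrow> elementary W (X i) (f i)"
  shows "elementary W (\<lambda>\<omega>. \<Sum>i\<in>I. X i \<omega>) (\<lambda>r. \<Sum>i\<in>I. f i r)"
  using assms by (induction I rule: finite_induct) (auto intro: elementary_zero elementary_add)

lemma elementary_step_integral:
  assumes "0 \<le> s 0" "\<forall>i<N. s i \<le> s (Suc i)"
  shows "elementary W (step_integral W N s c) (step_fun N s c)"
proof -
  have nonneg: "0 \<le> s i" if "i \<le> N" for i
    using that by (induction i) (use assms in \<open>auto intro: order_trans\<close>)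
  have "elementary W (\<lambda>\<omega>. \<Sum>i<N. c i * (W (s (Suc i)) \<omega> + - 1 * W (s i) \<omega>))
     (\<lambda>r. \<Sum>i<N. c i * (indicator {0<..s (Suc i)} r + - 1 * indicator {0<..s i} r))"
    by (intro elementary_sum elementary_scale elementary_add elementary_single) (auto intro: nonneg)
  moreover have "indicator {0<..s (Suc i)} r + - 1 * indicator {0<..s i} r
      = (indicator {s i<..s (Suc i)} r :: real)" if "i < N" for i r
    using assms(2) nonneg[of i] that by (auto simp: indicator_def)
  ultimately show ?thesis
    by (simp add: step_integral_def[abs_def] step_fun_def[abs_def])
qed

text \<open>Converts a combination of values into a combination of increments. The leading term
  drops out when h 0 = 0, which holds for Brownian paths almost surely.\<close>

lemma abel_summation:
  fixes a h :: "nat \<Rightarrow> real"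
  shows "(\<Sum>k<n. a k * h (Suc k)) = h 0 * (\<Sum>k<n. a k) + (\<Sum>i<n. (\<Sum>k\<in>{i..<n}. a k) * (h (Suc i) - h i))"
proof (induction n)
  case (Suc n)
  have "(\<Sum>i<Suc n. (\<Sum>k\<in>{i..<Suc n}. a k) * (h (Suc i) - h i))
      = (\<Sum>i<Suc n. (\<Sum>k\<in>{i..<n}. a k) * (h (Suc i) - h i)) + (\<Sum>i<Suc n. a n * (h (Suc i) - h i))"
    by (subst sum.distrib[symmetric]) (intro sum.cong; simp add: distrib_right)
  also have "(\<Sum>i<Suc n. a n * (h (Suc i) - h i)) = a n * (h (Suc n) - h 0)"
    by (simp only: sum_distrib_left[symmetric] sum_lessThan_telescope)
  finally show ?case using Suc by (simp add: algebra_simps)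
qed simp

lemma (in prob_space) brownian_increment_gaussian:
  assumes "brownian_motion M W" "0 \<le> s" "s \<le> t"
  shows "centered_gaussian M (\<lambda>\<omega>. W t \<omega> - W s \<omega>) (t - s)"
proof (cases "s = t")
  case True
  then show ?thesis using centered_gaussian_zero by simp
next
  case False
  then have "centered_gaussian M (\<lambda>\<omega>. W t \<omega> - W s \<omega>) ((sqrt (t - s))\<^sup>2)"
    using assms by (intro distributed_normal_centered_gaussian) (auto simp: brownian_motion_def)
  then show ?thesis using assms by simp
qed

lemma sum_square_orthogonal:
  fixes x :: "'i \<Rightarrow> real"
  assumes "finite I" "\<And>i k. i \<in> I \<Longrightarrow> k \<in> I \<Longrightarrow> i \<noteq> k \<Longrightarrow> x i * x k = 0"
  shows "(\<Sum>i\<in>I. x i)\<^sup>2 = (\<Sum>i\<in>I. (x i)\<^sup>2)"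
proof -
  have "(\<Sum>i\<in>I. x i)\<^sup>2 = (\<Sum>i\<in>I. \<Sum>k\<in>I. x i * x k)"
    by (simp add: power2_eq_square sum_product)
  also have "\<dots> = (\<Sum>i\<in>I. \<Sum>k\<in>I. if k = i then (x i)\<^sup>2 else 0)"
    using assms by (intro sum.cong) (auto simp: power2_eq_square)
  finally show ?thesis using assms(1) by simp
qed

text \<open>The isometry for elementary integrands. After Abel summation X is a sum of independent
  increments and f is a step function on disjoint intervals with the same coefficients, so the sum
  of the variances is the integral of f squared.\<close>

lemma (in prob_space) elementary_gaussian:
  assumes bm: "brownian_motion M W" and el: "elementary W X f"
  shows "centered_gaussian M X (LINT r|lborel. (f r)\<^sup>2)" "integrable lborel (\<lambda>r. (f r)\<^sup>2)"
    "f \<in> borel_measurable borel"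
proof -
  obtain S c where S: "finite S" "S \<subseteq> {0..}" and X: "X = (\<lambda>\<omega>. \<Sum>t\<in>S. c t * W t \<omega>)"
    and f: "f = (\<lambda>r. \<Sum>t\<in>S. c t * indicator {0<..t} r)"
    using el by (auto simp: elementary_def)
  define n where "n = card S"
  define L where "L = sorted_list_of_set S"
  have L: "distinct L" "sorted L" "set L = S" "length L = n"
    using S by (auto simp: L_def n_def)
  \<comment> \<open>Entry 0 is time 0, where W vanishes almost surely and \<open>{0<..0}\<close> is
    empty; the sorted sampling times follow, shifted by one. Beyond n the value is a
    default.\<close>
  define t where "t i = (if i \<le> n then (0 # L) ! i else 0)" for i
  have t0: "t 0 = 0" by (simp add: t_def)
  have Ln: "L ! i \<in> S" if "i < n" for i using L that by auto
  have tmono: "t i \<le> t (Suc i)" if "i < n" for i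
    using that L S Ln by (cases i) (auto simp: t_def sorted_nth_mono)
  have tle: "t i \<le> t k" if "i \<le> k" "k \<le> n" for i k
    using that
  proof (induction k)
    case (Suc k)
    then show ?case using tmono[of k] by (cases "i = Suc k") auto
  qed simp
  have sumS: "(\<Sum>t\<in>S. c t * g t) = (\<Sum>k<n. c (t (Suc k)) * g (t (Suc k)))" for g :: "real \<Rightarrow> real"
  proof -
    have "bij_betw ((!) L) {..<n} S" using L by (metis bij_betw_nth)
    then have "(\<Sum>t\<in>S. c t * g t) = (\<Sum>k<n. c (L ! k) * g (L ! k))"
      by (rule sum.reindex_bij_betw[symmetric])
    then show ?thesis by (simp add: t_def)
  qed
  define d where "d i = (\<Sum>k\<in>{i..<n}. c (t (Suc k)))" for i
  \<comment> \<open>Stated for every g on purpose: \<open>W\<close> along a path rewrites X, the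
    indicators of \<open>{0<..t}\<close> rewrite f, and both receive the coefficients d.\<close>
  have abel: "(\<Sum>t\<in>S. c t * g t) = g 0 * (\<Sum>k<n. c (t (Suc k))) + (\<Sum>i<n. d i * (g (t (Suc i)) - g (t i)))" for g
    unfolding sumS d_def using abel_summation[of "\<lambda>k. c (t (Suc k))" "\<lambda>k. g (t k)" n]
    by (simp add: t0)
  have "indep_vars (\<lambda>_. borel) (\<lambda>i \<omega>. W (t (Suc i)) \<omega> - W (t i) \<omega>) {..<n}"
    using bm tmono t0 by (simp add: brownian_motion_def)
  then have "indep_vars (\<lambda>_. borel) (\<lambda>i \<omega>. d i * (W (t (Suc i)) \<omega> - W (t i) \<omega>)) {..<n}"
    by (rule indep_vars_compose2) simp
  then have "centered_gaussian M (\<lambda>\<omega>. \<Sum>i<n. d i * (W (t (Suc i)) \<omega> - W (t i) \<omega>))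
      (\<Sum>i<n. (d i)\<^sup>2 * (t (Suc i) - t i))"
    using tle[of 0] t0 tmono
    by (intro centered_gaussian_sum centered_gaussian_scale brownian_increment_gaussian[OF bm]) auto
  moreover have "AE \<omega> in M. (\<Sum>i<n. d i * (W (t (Suc i)) \<omega> - W (t i) \<omega>)) = X \<omega>"
  proof -
    have "AE \<omega> in M. W 0 \<omega> = 0" using bm by (simp add: brownian_motion_def)
    then show ?thesis
    proof eventually_elim
      case (elim \<omega>)
      then show ?case using abel[of "\<lambda>t. W t \<omega>"] by (simp add: X)
    qed
  qed
  moreover have "X \<in> borel_measurable M"
    using bm S unfolding X brownian_motion_def by (intro borel_measurable_sum borel_measurable_times) auto
  ultimately have g: "centered_gaussian M X (\<Sum>i<n. (d i)\<^sup>2 * (t (Suc i) - t i))"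
    by (rule centered_gaussian_AE_cong)
  have ind: "indicator {0<..t (Suc i)} r - indicator {0<..t i} r
      = (indicator {t i<..t (Suc i)} r :: real)" if "i < n" for i r
    using tmono[OF that] tle[of 0 i] that t0 by (auto simp: indicator_def)
  have f2: "(f r)\<^sup>2 = (\<Sum>i<n. (d i)\<^sup>2 * indicator {t i<..t (Suc i)} r)" for r
  proof -
    have "f r = (\<Sum>i<n. d i * indicator {t i<..t (Suc i)} r)"
      using abel[of "\<lambda>t. indicator {0<..t} r"] by (simp add: f ind)
    moreover have "(d i * indicator {t i<..t (Suc i)} r) * (d k * indicator {t k<..t (Suc k)} r) = 0"
      if "i < k" "k < n" for i k
      using tle[of "Suc i" k] that by (auto simp: indicator_def)
    then have "(\<Sum>i<n. d i * indicator {t i<..t (Suc i)} r)\<^sup>2 = (\<Sum>i<n. (d i * indicator {t i<..t (Suc i)} r)\<^sup>2)"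
      by (intro sum_square_orthogonal) (auto simp: neq_iff mult.commute)
    moreover have "(indicator A r :: real)\<^sup>2 = indicator A r" for A
      by (simp add: indicator_def)
    ultimately show ?thesis by (simp add: power_mult_distrib)
  qed
  have "integrable lborel (\<lambda>r. (d i)\<^sup>2 * indicator {t i<..t (Suc i)} r)" if "i < n" for i
    using tmono[OF that] by (intro integrable_mult_right integrable_real_indicator) auto
  then show "integrable lborel (\<lambda>r. (f r)\<^sup>2)"
    unfolding f2 by (intro Bochner_Integration.integrable_sum) auto
  have "(LINT r|lborel. (f r)\<^sup>2) = (\<Sum>i<n. (d i)\<^sup>2 * (t (Suc i) - t i))"
    unfolding f2 using tmono
    by (subst Bochner_Integration.integral_sum) (auto intro!: sum.cong integrable_real_indicator)
  then show "centered_gaussian M X (LINT r|lborel. (f r)\<^sup>2)" using g by simp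
  show "f \<in> borel_measurable borel" unfolding f by measurable
qed


text \<open>Independence is assumed for whole paths. Each X j is a measurable functional of the path
  of B j, so independence passes to the X j and their variances add up.\<close>

lemma (in prob_space) sum_elementary_gaussian:
  assumes ibm: "independent_brownian_motions M B" and J: "finite J" "J \<subseteq> {1..}"
    and el: "\<And>j. j \<in> J \<Longrightarrow> elementary (B j) (X j) (f j)"
  shows "centered_gaussian M (\<lambda>\<omega>. \<Sum>j\<in>J. X j \<omega>) (\<Sum>j\<in>J. LINT r|lborel. (f j r)\<^sup>2)"
proof -
  have bm: "brownian_motion M (B j)" if "j \<in> J" for j
    using ibm J that by (auto simp: independent_brownian_motions_def)
  have "\<forall>j\<in>J. \<exists>Sc. finite (fst Sc) \<and> fst Sc \<subseteq> {0..} \<and> X j = (\<lambda>\<omega>. \<Sum>t\<in>fst Sc. snd Sc t * B j t \<omega>)"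
  proof
    fix j assume "j \<in> J"
    from el[OF this] show "\<exists>Sc. finite (fst Sc) \<and> fst Sc \<subseteq> {0..} \<and> X j = (\<lambda>\<omega>. \<Sum>t\<in>fst Sc. snd Sc t * B j t \<omega>)"
      unfolding elementary_def split_paired_Ex by auto
  qed
  from bchoice[OF this] obtain Sc where Sc: "\<forall>j\<in>J. finite (fst (Sc j)) \<and> fst (Sc j) \<subseteq> {0..} \<and>
      X j = (\<lambda>\<omega>. \<Sum>t\<in>fst (Sc j). snd (Sc j) t * B j t \<omega>)" by blast
  define S where "S j = fst (Sc j)" for j
  define c where "c j = snd (Sc j)" for j
  have S: "\<And>j. j \<in> J \<Longrightarrow> S j \<subseteq> {0..}"
    and X: "\<And>j. j \<in> J \<Longrightarrow> X j = (\<lambda>\<omega>. \<Sum>t\<in>S j. c j t * B j t \<omega>)"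
    using Sc by (auto simp: S_def c_def)
  \<comment> \<open>The functional reads the path at the finitely many times in S j only, hence it
    is measurable for the product sigma-algebra.\<close>
  define G where "G j path = (\<Sum>t\<in>S j. c j t * path t)" for j and path :: "real \<Rightarrow> real"
  have "indep_vars (\<lambda>_. Pi\<^sub>M {0..} (\<lambda>_. borel)) (\<lambda>j \<omega>. \<lambda>t\<in>{0..}. B j t \<omega>) J"
    using ibm J(2) unfolding independent_brownian_motions_def by (blast intro: indep_vars_subset)
  then have "indep_vars (\<lambda>_. borel) (\<lambda>j \<omega>. G j (\<lambda>t\<in>{0..}. B j t \<omega>)) J"
  proof (rule indep_vars_compose2)
    fix j assume "j \<in> J"
    then show "G j \<in> borel_measurable (Pi\<^sub>M {0..} (\<lambda>_. borel))"
      using S unfolding G_def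
      by (intro borel_measurable_sum borel_measurable_times measurable_component_singleton) auto
  qed
  moreover have "G j (\<lambda>t\<in>{0..}. B j t \<omega>) = X j \<omega>" if "j \<in> J" for j \<omega>
    using S[OF that] unfolding X[OF that] G_def by (intro sum.cong) auto
  ultimately have "indep_vars (\<lambda>_. borel) X J"
    by (subst (asm) indep_vars_cong[OF refl _ refl, of _ _ X]) auto
  then show ?thesis
    using elementary_gaussian(1)[OF bm el] J(1) by (intro centered_gaussian_sum) auto
qed

text \<open>The partitions lie in [0,t], so the step functions vanish outside and the approximation
  on [0,t] is one on the whole line. There, integrands that belong to different times t can be
  combined.\<close>

lemma (in prob_space) wiener_integral_L2_limit:
  assumes bm: "brownian_motion M W" and w: "wiener_integral M W t h Y" and t: "0 \<le> t"
    and h[measurable]: "h \<in> borel_measurable borel"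
  obtains X f where "\<And>n. elementary W (X n) (f n)" "L2_limit M X Y"
    "L2_limit lborel f (\<lambda>r. h r * indicator {0..t} r)"
proof -
  obtain N s c where s: "\<And>n. 0 \<le> s n 0" "\<And>n. \<forall>i<N n. s n i \<le> s n (Suc i)" "\<And>n. s n (N n) \<le> t"
    and lim: "(\<lambda>n. \<integral>\<^sup>+r\<in>{0..t}. ennreal ((step_fun (N n) (s n) (c n) r - h r)\<^sup>2) \<partial>lborel) \<longlonglongrightarrow> 0"
    and L: "L2_limit M (\<lambda>n. step_integral W (N n) (s n) (c n)) Y"
    using w unfolding wiener_integral_def by blast
  define f where "f n = step_fun (N n) (s n) (c n)" for n
  have el: "elementary W (step_integral W (N n) (s n) (c n)) (f n)" for n
    unfolding f_def using s by (intro elementary_step_integral)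
  have fm[measurable]: "f n \<in> borel_measurable borel" for n
    using elementary_gaussian(3)[OF bm el] .
  have supp: "f n r = 0" if "r \<notin> {0..t}" for n r
  proof -
    have mono: "s n i \<le> s n k" if "i \<le> k" "k \<le> N n" for i k
      using that
    proof (induction k)
      case (Suc k)
      then show ?case using s(2)[of n] by (cases "i = Suc k") (auto intro: order_trans)
    qed simp
    have "r \<notin> {s n i<..s n (Suc i)}" if "i < N n" for i
      using mono[of 0 i] mono[of "Suc i" "N n"] s(1)[of n] s(3)[of n] \<open>r \<notin> {0..t}\<close> that by auto
    then show ?thesis
      unfolding f_def step_fun_def by (intro sum.neutral) (auto simp: indicator_def)
  qed
  have "L2_limit lborel f (\<lambda>r. h r * indicator {0..t} r)"
  proof -
    have "(\<integral>\<^sup>+r. ennreal ((f n r - h r * indicator {0..t} r)\<^sup>2) \<partial>lborel)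
        = (\<integral>\<^sup>+r\<in>{0..t}. ennreal ((step_fun (N n) (s n) (c n) r - h r)\<^sup>2) \<partial>lborel)" for n
      using supp by (intro nn_integral_cong) (auto simp: f_def indicator_def)
    then show ?thesis using lim by (simp add: L2_limit_def)
  qed
  then show ?thesis using that[OF el L] by blast
qed

lemma (in prob_space) wiener_integrals_L2_limit:
  assumes bm: "\<And>j. j \<in> J \<Longrightarrow> brownian_motion M (B j)"
    and w: "\<And>j. j \<in> J \<Longrightarrow> wiener_integral M (B j) t (h j) (Y j)" and t: "0 \<le> t"
    and h: "\<And>j. j \<in> J \<Longrightarrow> h j \<in> borel_measurable borel"
  shows "\<exists>X f. \<forall>j\<in>J. (\<forall>n. elementary (B j) (X j n) (f j n)) \<and> L2_limit M (X j) (Y j) \<and>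
    L2_limit lborel (f j) (\<lambda>r. h j r * indicator {0..t} r)"
proof -
  have "\<forall>j\<in>J. \<exists>Xf. (\<forall>n. elementary (B j) (fst Xf n) (snd Xf n)) \<and> L2_limit M (fst Xf) (Y j) \<and>
      L2_limit lborel (snd Xf) (\<lambda>r. h j r * indicator {0..t} r)"
  proof
    fix j assume j: "j \<in> J"
    obtain X f where "\<And>n. elementary (B j) (X n) (f n)" "L2_limit M X (Y j)"
      "L2_limit lborel f (\<lambda>r. h j r * indicator {0..t} r)"
      by (rule wiener_integral_L2_limit[OF bm[OF j] w[OF j] t h[OF j]]) blast
    then show "\<exists>Xf. (\<forall>n. elementary (B j) (fst Xf n) (snd Xf n)) \<and> L2_limit M (fst Xf) (Y j) \<and>
      L2_limit lborel (snd Xf) (\<lambda>r. h j r * indicator {0..t} r)"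
      by (intro exI[of _ "(X, f)"]) simp
  qed
  from bchoice[OF this] obtain Xf where Xf: "\<forall>j\<in>J. (\<forall>n. elementary (B j) (fst (Xf j) n) (snd (Xf j) n))
      \<and> L2_limit M (fst (Xf j)) (Y j) \<and> L2_limit lborel (snd (Xf j)) (\<lambda>r. h j r * indicator {0..t} r)"
    by blast
  then show ?thesis
    by (intro exI[of _ "\<lambda>j. fst (Xf j)"] exI[of _ "\<lambda>j. snd (Xf j)"])
qed

text \<open>A time increment of the solution pairs integrals up to t and up to s with respect to the
  same Brownian motion. They are dependent, so the variance has to be that of the combined integrand
  k j, not a sum of two variances.\<close>

lemma (in prob_space) sum_wiener_integrals_gaussian:
  assumes ibm: "independent_brownian_motions M B" and J: "finite J" "J \<subseteq> {1..}"
    and t: "0 \<le> t" "0 \<le> s"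
    and w: "\<And>j. j \<in> J \<Longrightarrow> wiener_integral M (B j) t (h j) (Y j)"
    and w': "\<And>j. j \<in> J \<Longrightarrow> wiener_integral M (B j) s (h' j) (Y' j)"
    and h: "\<And>j. j \<in> J \<Longrightarrow> h j \<in> borel_measurable borel" "\<And>j. j \<in> J \<Longrightarrow> h' j \<in> borel_measurable borel"
    and k: "\<And>j r. j \<in> J \<Longrightarrow> k j r = a j * (h j r * indicator {0..t} r) + b j * (h' j r * indicator {0..s} r)"
    and int: "\<And>j. j \<in> J \<Longrightarrow> integrable lborel (\<lambda>r. (k j r)\<^sup>2)"
  shows "centered_gaussian M (\<lambda>\<omega>. \<Sum>j\<in>J. a j * Y j \<omega> + b j * Y' j \<omega>)
    (\<Sum>j\<in>J. LINT r|lborel. (k j r)\<^sup>2)"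
proof -
  have bm: "brownian_motion M (B j)" if "j \<in> J" for j
    using ibm J that by (auto simp: independent_brownian_motions_def)
  have "\<exists>X f. \<forall>j\<in>J. (\<forall>n. elementary (B j) (X j n) (f j n)) \<and> L2_limit M (X j) (Y j) \<and>
      L2_limit lborel (f j) (\<lambda>r. h j r * indicator {0..t} r)"
    by (rule wiener_integrals_L2_limit) (use bm w t h in auto)
  then obtain X f where Xf: "\<forall>j\<in>J. (\<forall>n. elementary (B j) (X j n) (f j n)) \<and> L2_limit M (X j) (Y j) \<and>
      L2_limit lborel (f j) (\<lambda>r. h j r * indicator {0..t} r)" by (elim exE)
  have X: "\<And>j n. j \<in> J \<Longrightarrow> elementary (B j) (X j n) (f j n)"
    "\<And>j. j \<in> J \<Longrightarrow> L2_limit M (X j) (Y j)"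
    "\<And>j. j \<in> J \<Longrightarrow> L2_limit lborel (f j) (\<lambda>r. h j r * indicator {0..t} r)"
    using Xf by auto
  have "\<exists>X f. \<forall>j\<in>J. (\<forall>n. elementary (B j) (X j n) (f j n)) \<and> L2_limit M (X j) (Y' j) \<and>
      L2_limit lborel (f j) (\<lambda>r. h' j r * indicator {0..s} r)"
    by (rule wiener_integrals_L2_limit) (use bm w' t h in auto)
  then obtain X' f' where Xf': "\<forall>j\<in>J. (\<forall>n. elementary (B j) (X' j n) (f' j n)) \<and> L2_limit M (X' j) (Y' j) \<and>
      L2_limit lborel (f' j) (\<lambda>r. h' j r * indicator {0..s} r)" by (elim exE)
  have X': "\<And>j n. j \<in> J \<Longrightarrow> elementary (B j) (X' j n) (f' j n)"
    "\<And>j. j \<in> J \<Longrightarrow> L2_limit M (X' j) (Y' j)"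
    "\<And>j. j \<in> J \<Longrightarrow> L2_limit lborel (f' j) (\<lambda>r. h' j r * indicator {0..s} r)"
    using Xf' by auto
  have el: "elementary (B j) (\<lambda>\<omega>. a j * X j n \<omega> + b j * X' j n \<omega>) (\<lambda>r. a j * f j n r + b j * f' j n r)"
    if "j \<in> J" for j n
    using X X' that by (intro elementary_add elementary_scale) auto
  show ?thesis
  proof (rule centered_gaussian_L2_limit)
    show "L2_limit M (\<lambda>n \<omega>. \<Sum>j\<in>J. a j * X j n \<omega> + b j * X' j n \<omega>)
        (\<lambda>\<omega>. \<Sum>j\<in>J. a j * Y j \<omega> + b j * Y' j \<omega>)"
      using X X' J by (intro L2_limit_sum L2_limit_add L2_limit_scale) auto
    show "centered_gaussian M (\<lambda>\<omega>. \<Sum>j\<in>J. a j * X j n \<omega> + b j * X' j n \<omega>)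
        (\<Sum>j\<in>J. LINT r|lborel. (a j * f j n r + b j * f' j n r)\<^sup>2)" for n
      by (rule sum_elementary_gaussian[OF ibm J el])
    show "(\<lambda>n. \<Sum>j\<in>J. LINT r|lborel. (a j * f j n r + b j * f' j n r)\<^sup>2)
        \<longlonglongrightarrow> (\<Sum>j\<in>J. LINT r|lborel. (k j r)\<^sup>2)"
    proof (rule tendsto_sum)
      fix j assume j: "j \<in> J"
      have "L2_limit lborel (\<lambda>n r. a j * f j n r + b j * f' j n r)
          (\<lambda>r. a j * (h j r * indicator {0..t} r) + b j * (h' j r * indicator {0..s} r))"
        using X X' j by (intro L2_limit_add L2_limit_scale) auto
      moreover have "k j = (\<lambda>r. a j * (h j r * indicator {0..t} r) + b j * (h' j r * indicator {0..s} r))"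
        by (rule ext) (rule k[OF j])
      ultimately have "L2_limit lborel (\<lambda>n r. a j * f j n r + b j * f' j n r) (k j)"
        by (simp only:)
      then show "(\<lambda>n. LINT r|lborel. (a j * f j n r + b j * f' j n r)\<^sup>2)
          \<longlonglongrightarrow> (LINT r|lborel. (k j r)\<^sup>2)"
        by (rule L2_limit_square_integral[OF _ int[OF j] elementary_gaussian(2)[OF bm[OF j] el[OF j]]])
    qed
  qed
qed


section \<open>The Dirichlet eigenbasis\<close>

lemma bessel_inequality:
  fixes e :: "'i \<Rightarrow> 'a \<Rightarrow> real"
  assumes J: "finite J"
    and ee: "\<And>i j. i \<in> J \<Longrightarrow> j \<in> J \<Longrightarrow> integrable M (\<lambda>x. e i x * e j x)"
    and ortho: "\<And>i j. i \<in> J \<Longrightarrow> j \<in> J \<Longrightarrow> (LINT x|M. e i x * e j x) = (if i = j then 1 else 0)"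
    and f2: "integrable M (\<lambda>x. (f x)\<^sup>2)" and fe: "\<And>j. j \<in> J \<Longrightarrow> integrable M (\<lambda>x. f x * e j x)"
  shows "(\<Sum>j\<in>J. (LINT x|M. f x * e j x)\<^sup>2) \<le> (LINT x|M. (f x)\<^sup>2)"
proof -
  define c where "c j = (LINT x|M. f x * e j x)" for j
  have expand: "(f x - (\<Sum>j\<in>J. c j * e j x))\<^sup>2
      = (f x)\<^sup>2 - 2 * (\<Sum>j\<in>J. c j * (f x * e j x)) + (\<Sum>i\<in>J. \<Sum>j\<in>J. c i * c j * (e i x * e j x))" for x
    by (simp add: power2_diff power2_eq_square[of "\<Sum>j\<in>J. c j * e j x"] sum_product sum_distrib_left mult_ac)
  have "0 \<le> (LINT x|M. (f x - (\<Sum>j\<in>J. c j * e j x))\<^sup>2)"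
    by (rule Bochner_Integration.integral_nonneg) simp
  also have "\<dots> = (LINT x|M. (f x)\<^sup>2) - 2 * (\<Sum>j\<in>J. c j * c j)
      + (\<Sum>i\<in>J. \<Sum>j\<in>J. c i * c j * (if i = j then 1 else 0))"
    unfolding expand using f2 fe ee ortho by (simp add: c_def)
  also have "(\<Sum>j\<in>J. c i * c j * (if i = j then 1 else 0)) = c i * c i" if "i \<in> J" for i
  proof -
    have "(\<Sum>j\<in>J. c i * c j * (if i = j then 1 else 0)) = (\<Sum>j\<in>J. if j = i then c i * c i else 0)"
      by (rule sum.cong) auto
    then show ?thesis using J that by simp
  qed
  ultimately show ?thesis by (simp add: c_def power2_eq_square)
qed

text \<open>This is nonnegativity of the integral of (g - c)^2, where c is the mean of g.\<close>

lemma cauchy_schwarz_interval: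
  fixes g :: "real \<Rightarrow> real"
  assumes g: "continuous_on {l..l + h} g" and h: "0 < h"
  shows "(integral {l..l + h} g)\<^sup>2 \<le> h * integral {l..l + h} (\<lambda>y. (g y)\<^sup>2)"
proof -
  define c where "c = integral {l..l + h} g / h"
  have int: "g integrable_on {l..l + h}" "(\<lambda>y. (g y)\<^sup>2) integrable_on {l..l + h}"
    using g by (auto intro!: integrable_continuous_real continuous_intros)
  have "0 \<le> integral {l..l + h} (\<lambda>y. (g y - c)\<^sup>2)"
    by (rule Henstock_Kurzweil_Integration.integral_nonneg) (use g in \<open>auto intro!: integrable_continuous_real continuous_intros\<close>)
  also have "(\<lambda>y. (g y - c)\<^sup>2) = (\<lambda>y. (g y)\<^sup>2 - (2 * c) * g y + c\<^sup>2)"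
    by (auto simp: power2_eq_square algebra_simps)
  also have "integral {l..l + h} \<dots> = integral {l..l + h} (\<lambda>y. (g y)\<^sup>2) - 2 * c * integral {l..l + h} g
      + measure lborel {l..l + h} *\<^sub>R c\<^sup>2"
    by (intro integral_unique has_integral_add has_integral_diff has_integral_mult_right integrable_integral int
        has_integral_const_real)
  also have "\<dots> = integral {l..l + h} (\<lambda>y. (g y)\<^sup>2) - (integral {l..l + h} g)\<^sup>2 / h"
    using h by (simp add: c_def field_simps power2_eq_square)
  finally show ?thesis using h by (simp add: field_simps)
qed

lemma continuous_interval_lebesgue_integral:
  fixes g :: "real \<Rightarrow> real"
  assumes "continuous_on {a..b} g"
  shows "integrable lborel (\<lambda>x. indicator {a..b} x * g x)"
    "(LINT x|lborel. indicator {a..b} x * g x) = integral {a..b} g"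
  using borel_integrable_atLeastAtMost'[OF assms] set_borel_integral_eq_integral(2)[OF borel_integrable_atLeastAtMost'[OF assms]]
  by (simp_all add: set_integrable_def set_lebesgue_integral_def)

lemma square_integrable_imp_set_integrable:
  assumes "square_integrable w"
  shows "set_integrable lborel {-pi..pi} w"
proof -
  have m: "(\<lambda>x. indicator {-pi..pi} x *\<^sub>R w x) \<in> borel_measurable lborel"
    and i: "integrable lborel (\<lambda>x. indicator {-pi..pi} x *\<^sub>R (w x)\<^sup>2)"
    using assms by (auto simp: square_integrable_def set_borel_measurable_def set_integrable_def)
  have "integrable lborel (\<lambda>x. indicator {-pi..pi} x + indicator {-pi..pi} x *\<^sub>R (w x)\<^sup>2)"
    by (intro Bochner_Integration.integrable_add i integrable_real_indicator) auto
  then show ?thesis unfolding set_integrable_def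
  proof (rule Bochner_Integration.integrable_bound[OF _ m])
    have "\<bar>w x\<bar> \<le> 1 + (w x)\<^sup>2" for x
      using sum_squares_bound[of 1 "\<bar>w x\<bar>"] by (simp add: power2_eq_square)
    then show "AE x in lborel. norm (indicator {-pi..pi} x *\<^sub>R w x)
        \<le> norm (indicator {-pi..pi} x + indicator {-pi..pi} x *\<^sub>R (w x)\<^sup>2)"
      by (auto simp: indicator_def)
  qed
qed

lemma set_integrable_indefinite_integral:
  assumes w: "set_integrable lborel {a..b} w" and v: "\<And>x. x \<in> {a..b} \<Longrightarrow> v x = c + (LINT y:{a..x}|lborel. w y)"
  shows "continuous_on {a..b} v"
    "continuous_on {a..b} w \<Longrightarrow> x \<in> {a..b} \<Longrightarrow> (v has_real_derivative w x) (at x within {a..b})"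
proof -
  have v': "v x = c + integral {a..x} w" if "x \<in> {a..b}" for x
  proof -
    have "set_integrable lborel {a..x} w"
      using that by (intro set_integrable_subset[OF w]) auto
    then show ?thesis using v[OF that] by (simp add: set_borel_integral_eq_integral(2))
  qed
  have "w integrable_on {a..b}" using w by (rule set_borel_integral_eq_integral(1))
  then have "continuous_on {a..b} (\<lambda>x. c + integral {a..x} w)"
    by (intro continuous_intros indefinite_integral_continuous_1)
  then show "continuous_on {a..b} v"
    using v' by (subst continuous_on_cong[OF refl, of _ _ "\<lambda>x. c + integral {a..x} w"]) auto
  assume "continuous_on {a..b} w" "x \<in> {a..b}"
  then have "((\<lambda>x. integral {a..x} w) has_real_derivative w x) (at x within {a..b})"
    by (rule integral_has_real_derivative)
  from DERIV_add[OF DERIV_const[of c] this]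
  have D: "((\<lambda>x. c + integral {a..x} w) has_real_derivative w x) (at x within {a..b})" by simp
  show "(v has_real_derivative w x) (at x within {a..b})"
    by (rule has_field_derivative_transform_within[OF D zero_less_one \<open>x \<in> {a..b}\<close>]) (simp add: v')
qed

text \<open>Regularity is bootstrapped: the weak second derivative is square integrable, hence
  integrable on a bounded interval, so v is continuous and \<open>\<phi> j\<close> is continuous
  with derivative v; then the second derivative, a multiple of \<open>\<phi> j\<close>, is
  continuous and v is differentiable.\<close>

lemma dirichlet_eigenfunction_derivatives:
  assumes "dirichlet_eigenbasis lam \<phi>" "1 \<le> j"
  obtains v where
    "\<And>x. x \<in> {-pi..pi} \<Longrightarrow> (\<phi> j has_real_derivative v x) (at x within {-pi..pi})"
    "\<And>x. x \<in> {-pi..pi} \<Longrightarrow> (v has_real_derivative - lam j * \<phi> j x) (at x within {-pi..pi})"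
proof -
  let ?w = "\<lambda>x. - lam j * \<phi> j x"
  have "H2_laplacian (\<phi> j) ?w" using assms by (auto simp: dirichlet_eigenbasis_def)
  then obtain v where sq: "square_integrable ?w"
    and v: "\<And>x. x \<in> {-pi..pi} \<Longrightarrow> v x = v (-pi) + (LINT y:{-pi..x}|lborel. ?w y)"
    and \<phi>: "\<And>x. x \<in> {-pi..pi} \<Longrightarrow> \<phi> j x = \<phi> j (-pi) + (LINT y:{-pi..x}|lborel. v y)"
    unfolding H2_laplacian_def by blast
  have w: "set_integrable lborel {-pi..pi} ?w"
    by (rule square_integrable_imp_set_integrable[OF sq])
  have cv: "continuous_on {-pi..pi} v"
    by (rule set_integrable_indefinite_integral(1)[OF w v])
  have iv: "set_integrable lborel {-pi..pi} v"
    by (rule borel_integrable_atLeastAtMost'[OF cv])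
  have c\<phi>: "continuous_on {-pi..pi} (\<phi> j)"
    by (rule set_integrable_indefinite_integral(1)[OF iv \<phi>])
  have "continuous_on {-pi..pi} ?w" using c\<phi> by (intro continuous_intros)
  then show ?thesis
    using that set_integrable_indefinite_integral(2)[OF w v] set_integrable_indefinite_integral(2)[OF iv \<phi> cv]
    by blast
qed

section \<open>Eigenfunctions, their derivatives and Bessel estimates\<close>

locale dirichlet_basis =
  fixes lam :: "nat \<Rightarrow> real" and \<phi> :: "nat \<Rightarrow> real \<Rightarrow> real"
  assumes basis: "dirichlet_eigenbasis lam \<phi>"
begin

text \<open>The classical derivative of \<open>\<phi> j\<close>, one-sided at the end points so that
  integration by parts reaches the boundary.\<close>

definition dphi :: "nat \<Rightarrow> real \<Rightarrow> real" where
  "dphi j = (SOME v. (\<forall>x\<in>{-pi..pi}. (\<phi> j has_real_derivative v x) (at x within {-pi..pi})) \<and>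
     (\<forall>x\<in>{-pi..pi}. (v has_real_derivative - lam j * \<phi> j x) (at x within {-pi..pi})))"

lemma dphi:
  assumes "1 \<le> j" "x \<in> {-pi..pi}"
  shows "(\<phi> j has_real_derivative dphi j x) (at x within {-pi..pi})"
    "(dphi j has_real_derivative - lam j * \<phi> j x) (at x within {-pi..pi})"
proof -
  obtain v where
    "\<And>x. x \<in> {-pi..pi} \<Longrightarrow> (\<phi> j has_real_derivative v x) (at x within {-pi..pi})"
    "\<And>x. x \<in> {-pi..pi} \<Longrightarrow> (v has_real_derivative - lam j * \<phi> j x) (at x within {-pi..pi})"
    by (rule dirichlet_eigenfunction_derivatives[OF basis assms(1)]) blast
  then have "\<exists>v. (\<forall>x\<in>{-pi..pi}. (\<phi> j has_real_derivative v x) (at x within {-pi..pi})) \<and>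
     (\<forall>x\<in>{-pi..pi}. (v has_real_derivative - lam j * \<phi> j x) (at x within {-pi..pi}))" by blast
  from someI_ex[OF this] show "(\<phi> j has_real_derivative dphi j x) (at x within {-pi..pi})"
    "(dphi j has_real_derivative - lam j * \<phi> j x) (at x within {-pi..pi})"
    using assms(2) by (auto simp: dphi_def)
qed

lemma phi_boundary: "1 \<le> j \<Longrightarrow> \<phi> j (-pi) = 0" "1 \<le> j \<Longrightarrow> \<phi> j pi = 0"
  using basis by (auto simp: dirichlet_eigenbasis_def)

lemma continuous_phi: "1 \<le> j \<Longrightarrow> A \<subseteq> {-pi..pi} \<Longrightarrow> continuous_on A (\<phi> j)"
  using continuous_on_subset DERIV_continuous_on[OF dphi(1)] by blast

lemma continuous_dphi: "1 \<le> j \<Longrightarrow> A \<subseteq> {-pi..pi} \<Longrightarrow> continuous_on A (dphi j)"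
  using continuous_on_subset DERIV_continuous_on[OF dphi(2)] by blast

lemma phi_orthonormal:
  assumes "1 \<le> i" "1 \<le> j"
  shows "integral {-pi..pi} (\<lambda>x. \<phi> i x * \<phi> j x) = (if i = j then 1 else 0)"
proof -
  have "continuous_on {-pi..pi} (\<lambda>x. \<phi> i x * \<phi> j x)"
    using assms by (intro continuous_intros continuous_phi) auto
  from set_borel_integral_eq_integral(2)[OF borel_integrable_atLeastAtMost'[OF this]]
  show ?thesis using basis assms by (auto simp: dirichlet_eigenbasis_def)
qed

text \<open>Integrate the derivative of \<open>\<phi> i * dphi j\<close>: the boundary terms vanish
  by the Dirichlet condition, and the second derivative returns \<open>lam j\<close> times the
  scalar product of the eigenfunctions.\<close>

lemma dphi_orthogonal:
  assumes "1 \<le> i" "1 \<le> j"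
  shows "integral {-pi..pi} (\<lambda>x. dphi i x * dphi j x) = (if i = j then lam j else 0)"
proof -
  have "((\<lambda>x. dphi i x * dphi j x + (- lam j * \<phi> j x) * \<phi> i x) has_integral
      \<phi> i pi * dphi j pi - \<phi> i (-pi) * dphi j (-pi)) {-pi..pi}"
    using assms by (intro fundamental_theorem_of_calculus)
      (auto simp: has_real_derivative_iff_has_vector_derivative[symmetric] intro!: derivative_eq_intros dphi)
  then have 1: "((\<lambda>x. dphi i x * dphi j x + (- lam j * \<phi> j x) * \<phi> i x) has_integral 0) {-pi..pi}"
    using assms by (simp add: phi_boundary)
  have "continuous_on {-pi..pi} (\<lambda>x. \<phi> i x * \<phi> j x)"
    using assms by (intro continuous_intros continuous_phi) auto
  then have 2: "((\<lambda>x. \<phi> i x * \<phi> j x) has_integral (if i = j then 1 else 0)) {-pi..pi}"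
    using integrable_integral[OF integrable_continuous_real[OF \<open>continuous_on _ _\<close>]] phi_orthonormal[OF assms] by simp
  have "((\<lambda>x. dphi i x * dphi j x) has_integral (lam j * (if i = j then 1 else 0))) {-pi..pi}"
    using has_integral_add[OF 1 has_integral_mult_right[OF 2, of "lam j"]] by (simp add: algebra_simps)
  then show ?thesis by (simp add: integral_unique)
qed

text \<open>The eigenvalue is the integral of the squared derivative. If it were 0, the
  eigenfunction would be constant, hence 0 by its boundary value, contradicting norm 1.\<close>

lemma lam_pos:
  assumes "1 \<le> j"
  shows "0 < lam j"
proof -
  have eq: "integral {-pi..pi} (\<lambda>x. (dphi j x)\<^sup>2) = lam j"
    using dphi_orthogonal[OF assms assms] by (simp add: power2_eq_square)
  have c: "continuous_on {-pi..pi} (\<lambda>x. (dphi j x)\<^sup>2)"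
    using assms by (intro continuous_intros continuous_dphi) auto
  have ge: "0 \<le> lam j" unfolding eq[symmetric] by (rule integral_nonneg) (use c in \<open>auto intro: integrable_continuous_real\<close>)
  have "lam j \<noteq> 0"
  proof
    assume "lam j = 0"
    then have "((\<lambda>x. (dphi j x)\<^sup>2) has_integral 0) {-pi..pi}"
      using eq c by (metis integrable_continuous_real integrable_integral)
    then have z: "dphi j x = 0" if "x \<in> {-pi..pi}" for x
      using has_integral_0_cbox_imp_0[of "-pi" pi "\<lambda>x. (dphi j x)\<^sup>2" x] c that pi_gt_zero by auto
    have "\<phi> j x = 0" if "x \<in> {-pi..pi}" for x
    proof -
      have "((\<lambda>x. dphi j x) has_integral (\<phi> j x - \<phi> j (-pi))) {-pi..x}"
        using assms that by (intro fundamental_theorem_of_calculus)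
          (auto simp: has_real_derivative_iff_has_vector_derivative[symmetric] intro!: DERIV_subset[OF dphi(1)])
      moreover have "((\<lambda>x. dphi j x) has_integral 0) {-pi..x}"
        using z that by (intro has_integral_is_0) auto
      ultimately have "\<phi> j x - \<phi> j (-pi) = 0" by (rule has_integral_unique)
      then show ?thesis using phi_boundary[OF assms] by simp
    qed
    then have "integral {-pi..pi} (\<lambda>x. \<phi> j x * \<phi> j x) = integral {-pi..pi} (\<lambda>x. 0)"
      by (intro Henstock_Kurzweil_Integration.integral_cong) auto
    then show False using phi_orthonormal[OF assms assms] by simp
  qed
  then show ?thesis using ge by simp
qed

text \<open>Bessel's inequality for the indicator of [x,y], whose squared norm is y - x and whose
  coefficients are the integrals on the left.\<close>

lemma bessel_interval:
  assumes J: "finite J" and xy: "{x..y} \<subseteq> {-pi..pi}" "x \<le> y"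
    and e: "\<And>j. j \<in> J \<Longrightarrow> continuous_on {-pi..pi} (e j)"
    and ortho: "\<And>i j. i \<in> J \<Longrightarrow> j \<in> J \<Longrightarrow>
      integral {-pi..pi} (\<lambda>z. e i z * e j z) = (if i = j then 1 else 0)"
  shows "(\<Sum>j\<in>J. (integral {x..y} (e j))\<^sup>2) \<le> y - x"
proof -
  let ?e = "\<lambda>j z. indicator {-pi..pi} z * e j z"
  have ee: "?e i z * ?e j z = indicator {-pi..pi} z * (e i z * e j z)" for i j z
    by (auto simp: indicator_def)
  have fe: "indicator {x..y} z * ?e j z = indicator {x..y} z * e j z" for j z
    using xy by (auto simp: indicator_def)
  have c: "continuous_on {-pi..pi} (\<lambda>z. e i z * e j z)" if "i \<in> J" "j \<in> J" for i j
    using e that by (intro continuous_intros)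
  note i = continuous_interval_lebesgue_integral[OF continuous_on_subset[OF e xy(1)]]
  have sq: "(indicator {x..y} z :: real)\<^sup>2 = indicator {x..y} z" for z by (simp add: indicator_def)
  have "(\<Sum>j\<in>J. (LINT z|lborel. indicator {x..y} z * ?e j z)\<^sup>2) \<le> (LINT z|lborel. (indicator {x..y} z)\<^sup>2)"
  proof (rule bessel_inequality[OF J])
    fix i j assume ij: "i \<in> J" "j \<in> J"
    show "integrable lborel (\<lambda>z. ?e i z * ?e j z)"
      unfolding ee by (rule continuous_interval_lebesgue_integral(1)[OF c[OF ij]])
    show "(LINT z|lborel. ?e i z * ?e j z) = (if i = j then 1 else 0)"
      unfolding ee using continuous_interval_lebesgue_integral(2)[OF c[OF ij]] ortho[OF ij] by simp
  next
    show "integrable lborel (\<lambda>z. (indicator {x..y} z :: real)\<^sup>2)"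
      using xy by (simp add: sq)
  next
    fix j assume "j \<in> J"
    from i(1)[OF this] show "integrable lborel (\<lambda>z. indicator {x..y} z * ?e j z)" by (simp only: fe)
  qed
  also have "(LINT z|lborel. (indicator {x..y} z :: real)\<^sup>2) = y - x" using xy by (simp add: sq)
  also have "(\<Sum>j\<in>J. (LINT z|lborel. indicator {x..y} z * ?e j z)\<^sup>2) = (\<Sum>j\<in>J. (integral {x..y} (e j))\<^sup>2)"
    by (intro sum.cong refl) (simp only: fe i(2))
  finally show ?thesis .
qed

text \<open>Bessel's inequality for the orthonormal functions \<open>\<phi> j' / sqrt (lam j)\<close>.\<close>

lemma phi_diff_sum_le:
  assumes J: "finite J" "J \<subseteq> {1..}" and x: "x \<in> {-pi..pi}" "y \<in> {-pi..pi}"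
  shows "(\<Sum>j\<in>J. (\<phi> j x - \<phi> j y)\<^sup>2 / lam j) \<le> \<bar>x - y\<bar>"
proof -
  have *: "(\<Sum>j\<in>J. (\<phi> j y - \<phi> j x)\<^sup>2 / lam j) \<le> y - x" if "x \<le> y" "-pi \<le> x" "y \<le> pi" for x y
  proof -
    have lp: "0 < lam j" "1 \<le> j" if "j \<in> J" for j using that J lam_pos by auto
    have "(\<Sum>j\<in>J. (integral {x..y} (\<lambda>z. dphi j z / sqrt (lam j)))\<^sup>2) \<le> y - x"
    proof (rule bessel_interval[OF J(1)])
      fix i j assume ij: "i \<in> J" "j \<in> J"
      have "integral {-pi..pi} (\<lambda>z. dphi i z * dphi j z / (sqrt (lam i) * sqrt (lam j)))
          = (if i = j then lam j else 0) / (sqrt (lam i) * sqrt (lam j))"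
        using dphi_orthogonal[of i j] lp ij by (simp add: Henstock_Kurzweil_Integration.integral_divide)
      then show "integral {-pi..pi} (\<lambda>z. dphi i z / sqrt (lam i) * (dphi j z / sqrt (lam j))) = (if i = j then 1 else 0)"
        using lp[OF ij(2)] by auto
    next
      fix j assume j: "j \<in> J"
      show "continuous_on {-pi..pi} (\<lambda>z. dphi j z / sqrt (lam j))"
        using lp[OF j] by (intro continuous_intros continuous_dphi) auto
    qed (use that in auto)
    moreover have "(integral {x..y} (\<lambda>z. dphi j z / sqrt (lam j)))\<^sup>2 = (\<phi> j y - \<phi> j x)\<^sup>2 / lam j" if "j \<in> J" for j
    proof -
      have "(dphi j has_integral (\<phi> j y - \<phi> j x)) {x..y}"
        using lp[OF that] \<open>x \<le> y\<close> \<open>-pi \<le> x\<close> \<open>y \<le> pi\<close> by (intro fundamental_theorem_of_calculus)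
          (auto simp: has_real_derivative_iff_has_vector_derivative[symmetric] intro!: DERIV_subset[OF dphi(1)])
      then have "integral {x..y} (\<lambda>z. dphi j z / sqrt (lam j)) = (\<phi> j y - \<phi> j x) / sqrt (lam j)"
        by (simp add: Henstock_Kurzweil_Integration.integral_divide integral_unique)
      then show ?thesis using lp[OF that] by (simp add: power_divide)
    qed
    ultimately show ?thesis by simp
  qed
  show ?thesis
  proof (cases "x \<le> y")
    case True
    then show ?thesis using *[of x y] x by (simp add: power2_commute)
  next
    case False
    then show ?thesis using *[of y x] x by simp
  qed
qed

text \<open>\<open>\<phi> j x\<close> is split into its mean \<open>m j\<close> over an interval of length \<open>sqrt d\<close> containing \<open>x\<close>, to
  which Bessel's inequality applies, and the deviation from the mean.\<close>

lemma phi_min_sum_le: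
  assumes J: "finite J" "J \<subseteq> {1..}" and x: "x \<in> {-pi..pi}" and d: "0 \<le> d"
  shows "(\<Sum>j\<in>J. min d (1 / lam j) * (\<phi> j x)\<^sup>2) \<le> 4 * sqrt d"
proof -
  have lp: "0 < lam j" "1 \<le> j" if "j \<in> J" for j using that J lam_pos by auto
  consider "d = 0" | "pi < sqrt d" | "0 < d" "sqrt d \<le> pi" using d by linarith
  then show ?thesis
  proof cases
    case 1
    then show ?thesis using lp by (simp add: less_imp_le min_absorb1)
  next
    case 2
    \<comment> \<open>No interval argument is required for large d: since
      \<open>\<phi> j (-pi) = 0\<close>, the value at x is itself a difference, and |x + pi| <= 2 pi
      is below the claimed bound.\<close>
    have "(\<Sum>j\<in>J. min d (1 / lam j) * (\<phi> j x)\<^sup>2) \<le> (\<Sum>j\<in>J. (\<phi> j x - \<phi> j (-pi))\<^sup>2 / lam j)"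
      using lp phi_boundary by (intro sum_mono order_trans[OF mult_right_mono[OF min.cobounded2]]) auto
    also have "\<dots> \<le> \<bar>x - (-pi)\<bar>" using x by (intro phi_diff_sum_le J) auto
    also have "\<dots> \<le> 4 * sqrt d" using x 2 by auto
    finally show ?thesis .
  next
    case 3
    \<comment> \<open>This length balances the two contributions: the means give d/h and the
      deviations give h, and both equal \<open>sqrt d\<close>.\<close>
    define h where "h = sqrt d"
    have h: "0 < h" "h \<le> pi" and d_h: "d = h * h" using 3 by (auto simp: h_def)
    \<comment> \<open>The interval extends from x towards the far end of [-pi,pi]; as h <= pi it
      stays inside.\<close>
    define l where "l = (if x \<le> 0 then x else x - h)"
    have I: "{l..l + h} \<subseteq> {-pi..pi}" "x \<in> {l..l + h}"
      using x h by (auto simp: l_def)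
    have dist: "\<bar>x - y\<bar> \<le> h" if "y \<in> {l..l + h}" for y
      using that h by (auto simp: l_def split: if_splits)
    define m where "m j = integral {l..l + h} (\<phi> j) / h" for j
    have c\<phi>: "continuous_on {l..l + h} (\<phi> j)" if "j \<in> J" for j
      using lp[OF that] I by (intro continuous_phi)
    have mean: "(\<Sum>j\<in>J. (m j)\<^sup>2) \<le> 1 / h"
    proof -
      have "(\<Sum>j\<in>J. (integral {l..l + h} (\<phi> j))\<^sup>2) \<le> l + h - l"
        using J(1) I h lp by (intro bessel_interval continuous_phi phi_orthonormal) auto
      moreover have "(integral {l..l + h} (\<phi> j))\<^sup>2 = h\<^sup>2 * (m j)\<^sup>2" for j
        using h by (simp add: m_def power_divide)
      ultimately have "h\<^sup>2 * (\<Sum>j\<in>J. (m j)\<^sup>2) \<le> h" by (simp add: sum_distrib_left)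
      then show ?thesis using h by (simp add: field_simps power2_eq_square)
    qed
    have osc: "(\<Sum>j\<in>J. (\<phi> j x - m j)\<^sup>2 / lam j) \<le> h"
    proof -
      have cd: "continuous_on {l..l + h} (\<lambda>y. (\<phi> j x - \<phi> j y)\<^sup>2 / lam j)" if "j \<in> J" for j
        using lp[OF that] by (intro continuous_intros c\<phi> that) auto
      have "(\<phi> j x - m j)\<^sup>2 / lam j \<le> integral {l..l + h} (\<lambda>y. (\<phi> j x - \<phi> j y)\<^sup>2 / lam j) / h" if "j \<in> J" for j
      proof -
        \<comment> \<open>The deviation from the mean is the mean of the deviations. Cauchy-Schwarz
          moves the square under the integral, so that the estimate for differences applies for each
          y separately.\<close>
        have "integral {l..l + h} (\<lambda>y. \<phi> j x - \<phi> j y) = h * (\<phi> j x - m j)"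
          using h integrable_continuous_real[OF c\<phi>[OF that]]
          by (subst Henstock_Kurzweil_Integration.integral_diff) (auto simp: m_def right_diff_distrib)
        then have "(h * (\<phi> j x - m j))\<^sup>2 \<le> h * integral {l..l + h} (\<lambda>y. (\<phi> j x - \<phi> j y)\<^sup>2)"
          using cauchy_schwarz_interval[of l h "\<lambda>y. \<phi> j x - \<phi> j y"] h c\<phi>[OF that]
          by (simp add: continuous_on_diff)
        then have "(\<phi> j x - m j)\<^sup>2 \<le> integral {l..l + h} (\<lambda>y. (\<phi> j x - \<phi> j y)\<^sup>2) / h"
          using h by (simp only: power_mult_distrib power2_eq_square[of h] mult.assoc mult_le_cancel_left_pos pos_le_divide_eq mult.commute)
        then have "(\<phi> j x - m j)\<^sup>2 / lam j \<le> integral {l..l + h} (\<lambda>y. (\<phi> j x - \<phi> j y)\<^sup>2) / h / lam j"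
          using lp[OF that] by (intro divide_right_mono) auto
        then show ?thesis by (simp add: Henstock_Kurzweil_Integration.integral_divide mult.commute)
      qed
      then have "(\<Sum>j\<in>J. (\<phi> j x - m j)\<^sup>2 / lam j)
          \<le> (\<Sum>j\<in>J. integral {l..l + h} (\<lambda>y. (\<phi> j x - \<phi> j y)\<^sup>2 / lam j) / h)"
        by (rule sum_mono)
      also have "\<dots> = integral {l..l + h} (\<lambda>y. \<Sum>j\<in>J. (\<phi> j x - \<phi> j y)\<^sup>2 / lam j) / h"
        using J cd by (simp add: Henstock_Kurzweil_Integration.integral_sum integrable_continuous_real sum_divide_distrib)
      also have "\<dots> \<le> integral {l..l + h} (\<lambda>y. h) / h"
      proof (intro divide_right_mono integral_le)
        show "(\<lambda>y. \<Sum>j\<in>J. (\<phi> j x - \<phi> j y)\<^sup>2 / lam j) integrable_on {l..l + h}"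
          using cd by (intro integrable_continuous_real continuous_on_sum)
        fix y assume "y \<in> {l..l + h}"
        then show "(\<Sum>j\<in>J. (\<phi> j x - \<phi> j y)\<^sup>2 / lam j) \<le> h"
          using I x by (intro order_trans[OF phi_diff_sum_le[OF J] dist]) auto
      qed (use h in auto)
      also have "\<dots> = h" using h by simp
      finally show ?thesis .
    qed
    have "(\<Sum>j\<in>J. min d (1 / lam j) * (\<phi> j x)\<^sup>2)
        \<le> (\<Sum>j\<in>J. 2 * (d * (m j)\<^sup>2) + 2 * ((\<phi> j x - m j)\<^sup>2 / lam j))"
    proof (rule sum_mono)
      fix j assume "j \<in> J"
      have "(\<phi> j x)\<^sup>2 \<le> 2 * (m j)\<^sup>2 + 2 * (\<phi> j x - m j)\<^sup>2"
        using sum_squares_bound[of "m j" "\<phi> j x - m j"] by (simp add: power2_eq_square algebra_simps)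
      then have "min d (1 / lam j) * (\<phi> j x)\<^sup>2 \<le> min d (1 / lam j) * (2 * (m j)\<^sup>2 + 2 * (\<phi> j x - m j)\<^sup>2)"
        using lp[OF \<open>j \<in> J\<close>] d by (intro mult_left_mono) auto
      also have "\<dots> = min d (1 / lam j) * (2 * (m j)\<^sup>2) + min d (1 / lam j) * (2 * (\<phi> j x - m j)\<^sup>2)"
        by (rule distrib_left)
      also have "\<dots> \<le> d * (2 * (m j)\<^sup>2) + 1 / lam j * (2 * (\<phi> j x - m j)\<^sup>2)"
        by (intro add_mono mult_right_mono) auto
      finally show "min d (1 / lam j) * (\<phi> j x)\<^sup>2 \<le> 2 * (d * (m j)\<^sup>2) + 2 * ((\<phi> j x - m j)\<^sup>2 / lam j)"
        by simp
    qed
    also have "\<dots> = 2 * (d * (\<Sum>j\<in>J. (m j)\<^sup>2)) + 2 * (\<Sum>j\<in>J. (\<phi> j x - m j)\<^sup>2 / lam j)"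
      by (simp add: sum.distrib sum_distrib_left)
    also have "\<dots> \<le> 2 * (d * (1 / h)) + 2 * h"
      using mean osc d by (intro add_mono mult_left_mono) auto
    also have "\<dots> = 4 * sqrt d" using h by (simp add: d_h h_def[symmetric])
    finally show ?thesis .
  qed
qed

end


section \<open>Increments of the solution\<close>

lemma exp_square_integral:
  fixes lam :: real
  assumes "0 < lam" "a \<le> b"
  shows "has_bochner_integral lborel (\<lambda>r. (exp (- lam * (t - r)))\<^sup>2 * indicator {a..b} r)
    ((exp (- 2 * lam * (t - b)) - exp (- 2 * lam * (t - a))) / (2 * lam))"
proof -
  have sq: "(exp (- lam * (t - r)))\<^sup>2 = exp (- 2 * lam * (t - r))" for r
    by (simp add: exp_double[symmetric] mult.assoc)
  have "has_bochner_integral lborel (\<lambda>r. exp (- 2 * lam * (t - r)) * indicator {a..b} r)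
    (exp (- 2 * lam * (t - b)) / (2 * lam) - exp (- 2 * lam * (t - a)) / (2 * lam))"
    using assms by (intro has_bochner_integral_FTC_Icc_real)
      (auto intro!: derivative_eq_intros continuous_intros simp: field_simps)
  then show ?thesis unfolding sq by (simp add: diff_divide_distrib)
qed

definition heat_kernel :: "real \<Rightarrow> real \<Rightarrow> real \<Rightarrow> real" where
  "heat_kernel lam t r = exp (- lam * (t - r)) * indicator {0..t} r"

lemma heat_kernel_square_integral:
  assumes "0 < lam" "0 \<le> t"
  shows "integrable lborel (\<lambda>r. (heat_kernel lam t r)\<^sup>2)"
    "(LINT r|lborel. (heat_kernel lam t r)\<^sup>2) \<le> 1 / lam"
proof -
  have sq: "(heat_kernel lam t r)\<^sup>2 = (exp (- lam * (t - r)))\<^sup>2 * indicator {0..t} r" for r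
    by (simp add: heat_kernel_def indicator_def)
  note * = exp_square_integral[OF assms(1), of 0 t t, OF assms(2)]
  show "integrable lborel (\<lambda>r. (heat_kernel lam t r)\<^sup>2)"
    unfolding sq using * by (rule integrable.intros)
  have "(LINT r|lborel. (heat_kernel lam t r)\<^sup>2) = (1 - exp (- 2 * lam * t)) / (2 * lam)"
    unfolding sq using has_bochner_integral_integral_eq[OF *] by simp
  also have "\<dots> \<le> 1 / (1 * lam)"
    using assms(1) by (intro frac_le) auto
  finally show "(LINT r|lborel. (heat_kernel lam t r)\<^sup>2) \<le> 1 / lam" by simp
qed

text \<open>With E = exp(-lam (t - s)) the two time ranges contribute at most (1 - E)^2 / (2 lam)
  and (1 - E^2) / (2 lam), whose sum is (1 - E) / lam. This is bounded by 1/lam as E > 0 and by t -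
  s as 1 - E <= lam (t - s).\<close>

lemma heat_kernel_diff_square_integral:
  assumes "0 < lam" "0 \<le> s" "s \<le> t"
  shows "integrable lborel (\<lambda>r. (heat_kernel lam t r - heat_kernel lam s r)\<^sup>2)"
    "(LINT r|lborel. (heat_kernel lam t r - heat_kernel lam s r)\<^sup>2) \<le> 2 * min (t - s) (1 / lam)"
proof -
  define E where "E = exp (- lam * (t - s))"
  have E: "0 < E" "E \<le> 1" "1 - E \<le> lam * (t - s)"
    using assms exp_ge_add_one_self[of "- lam * (t - s)"] by (auto simp: E_def)
  have E2: "exp (- 2 * lam * (t - s)) = E\<^sup>2"
    by (simp add: E_def exp_double[symmetric] mult.assoc)
  \<comment> \<open>Up to s the later kernel is E times the earlier one; from s to t only the later
    one is present. The closed intervals overlap at s, hence an inequality below instead of an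
    equality.\<close>
  let ?g = "\<lambda>r. (1 - E)\<^sup>2 * ((exp (- lam * (s - r)))\<^sup>2 * indicator {0..s} r)
      + (exp (- lam * (t - r)))\<^sup>2 * indicator {s..t} r"
  have g: "has_bochner_integral lborel ?g
      ((1 - E)\<^sup>2 * ((exp (- 2 * lam * (s - s)) - exp (- 2 * lam * (s - 0))) / (2 * lam))
       + (exp (- 2 * lam * (t - t)) - exp (- 2 * lam * (t - s))) / (2 * lam))"
    using assms by (intro has_bochner_integral_add has_bochner_integral_mult_right exp_square_integral) auto
  have le: "(heat_kernel lam t r - heat_kernel lam s r)\<^sup>2 \<le> ?g r" for r
  proof -
    consider "r < 0 \<or> t < r" | "0 \<le> r" "r \<le> s" | "s < r" "r \<le> t" by linarith
    then show ?thesis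
    proof cases
      case 2
      have "exp (- lam * (t - r)) = exp (- lam * (s - r)) * E"
        by (simp add: E_def exp_add[symmetric] algebra_simps)
      then have "(heat_kernel lam t r - heat_kernel lam s r)\<^sup>2 = (1 - E)\<^sup>2 * (exp (- lam * (s - r)))\<^sup>2"
        using 2 assms by (simp add: heat_kernel_def power2_eq_square algebra_simps)
      then show ?thesis using 2 by (simp add: indicator_def)
    qed (use assms in \<open>auto simp: heat_kernel_def indicator_def\<close>)
  qed
  show int: "integrable lborel (\<lambda>r. (heat_kernel lam t r - heat_kernel lam s r)\<^sup>2)"
  proof (rule Bochner_Integration.integrable_bound[OF integrable.intros[OF g]])
    show "(\<lambda>r. (heat_kernel lam t r - heat_kernel lam s r)\<^sup>2) \<in> borel_measurable lborel"
      unfolding heat_kernel_def by measurable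
    show "AE r in lborel. norm ((heat_kernel lam t r - heat_kernel lam s r)\<^sup>2) \<le> norm (?g r)"
    proof (rule AE_I2)
      fix r show "norm ((heat_kernel lam t r - heat_kernel lam s r)\<^sup>2) \<le> norm (?g r)"
        using le[of r] by simp
    qed
  qed
  have "(LINT r|lborel. (heat_kernel lam t r - heat_kernel lam s r)\<^sup>2) \<le> (LINT r|lborel. ?g r)"
    by (rule integral_mono[OF int integrable.intros[OF g] le])
  also have "\<dots> = (1 - E)\<^sup>2 * ((1 - exp (- 2 * lam * s)) / (2 * lam)) + (1 - E\<^sup>2) / (2 * lam)"
    using has_bochner_integral_integral_eq[OF g] by (simp only: E2) simp
  also have "\<dots> \<le> (1 - E)\<^sup>2 * (1 / (2 * lam)) + (1 - E\<^sup>2) / (2 * lam)"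
    using assms by (intro add_mono mult_left_mono divide_right_mono) auto
  also have "\<dots> = (1 - E) / lam"
    using assms(1) by (simp add: field_simps power2_eq_square)
  also have "\<dots> \<le> 2 * min (t - s) (1 / lam)"
    using E assms by (auto simp: min_def field_simps)
  finally show "(LINT r|lborel. (heat_kernel lam t r - heat_kernel lam s r)\<^sup>2) \<le> 2 * min (t - s) (1 / lam)" .
qed

text \<open>The variances of the partial sums increase and stay below V, so they converge; the
  limiting variance need not be identified, only bounded.\<close>

lemma (in prob_space) gaussian_series:
  assumes lim: "L2_limit M (\<lambda>n \<omega>. \<Sum>j=1..n. X j \<omega>) D"
    and g: "\<And>n. centered_gaussian M (\<lambda>\<omega>. \<Sum>j=1..n. X j \<omega>) (\<Sum>j=1..n. v j)"
    and v: "\<And>j. 1 \<le> j \<Longrightarrow> 0 \<le> v j" "\<And>n. (\<Sum>j=1..n. v j) \<le> V"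
  shows "\<exists>w\<le>V. centered_gaussian M D w"
proof -
  have "incseq (\<lambda>n. \<Sum>j=1..n. v j)"
    using v(1) by (intro incseq_SucI) auto
  then obtain w where "(\<lambda>n. \<Sum>j=1..n. v j) \<longlonglongrightarrow> w" "\<forall>n. (\<Sum>j=1..n. v j) \<le> w"
    using v(2) by (blast intro: incseq_convergent)
  moreover then have "w \<le> V" using v(2) by (intro LIMSEQ_le_const2) auto
  ultimately show ?thesis using centered_gaussian_L2_limit[OF lim g] by blast
qed

locale heat_solution = prob_space M + dirichlet_basis lam \<phi>
  for M :: "'w measure" and lam :: "nat \<Rightarrow> real" and \<phi> :: "nat \<Rightarrow> real \<Rightarrow> real" +
  fixes B :: "nat \<Rightarrow> real \<Rightarrow> 'w \<Rightarrow> real" and u :: "real \<Rightarrow> real \<Rightarrow> 'w \<Rightarrow> real"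
  assumes ibm: "independent_brownian_motions M B"
    and solution: "stochastic_heat_solution M B lam \<phi> u"
begin

text \<open>The stochastic convolutions are only asserted to exist in the notion of solution; one
  family is fixed here.\<close>

definition mode :: "nat \<Rightarrow> real \<Rightarrow> 'w \<Rightarrow> real" where
  "mode = (SOME Z. (\<forall>j\<ge>1. \<forall>t\<ge>0. wiener_integral M (B j) t (\<lambda>s. exp (- lam j * (t - s))) (Z j t)) \<and>
     (\<forall>t\<ge>0. \<forall>x\<in>{-pi..pi}. L2_limit M (\<lambda>n \<omega>. \<Sum>j=1..n. Z j t \<omega> * \<phi> j x) (u t x)))"

lemma mode:
  "1 \<le> j \<Longrightarrow> 0 \<le> t \<Longrightarrow> wiener_integral M (B j) t (\<lambda>s. exp (- lam j * (t - s))) (mode j t)"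
  "0 \<le> t \<Longrightarrow> x \<in> {-pi..pi} \<Longrightarrow> L2_limit M (\<lambda>n \<omega>. \<Sum>j=1..n. mode j t \<omega> * \<phi> j x) (u t x)"
proof -
  have "\<exists>Z. (\<forall>j\<ge>1. \<forall>t\<ge>0. wiener_integral M (B j) t (\<lambda>s. exp (- lam j * (t - s))) (Z j t)) \<and>
     (\<forall>t\<ge>0. \<forall>x\<in>{-pi..pi}. L2_limit M (\<lambda>n \<omega>. \<Sum>j=1..n. Z j t \<omega> * \<phi> j x) (u t x))"
    using solution by (auto simp: stochastic_heat_solution_def)
  from someI_ex[OF this]
  show "1 \<le> j \<Longrightarrow> 0 \<le> t \<Longrightarrow> wiener_integral M (B j) t (\<lambda>s. exp (- lam j * (t - s))) (mode j t)"
    "0 \<le> t \<Longrightarrow> x \<in> {-pi..pi} \<Longrightarrow> L2_limit M (\<lambda>n \<omega>. \<Sum>j=1..n. mode j t \<omega> * \<phi> j x) (u t x)"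
    by (auto simp: mode_def)
qed

lemma solution_measurable: "0 \<le> t \<Longrightarrow> x \<in> {-pi..pi} \<Longrightarrow> u t x \<in> borel_measurable M"
  using mode(2) by (auto simp: L2_limit_def)

text \<open>Time and space increments are both of this form, with x = y or t = s. Each mode
  contributes the squared norm of its combined integrand.\<close>

lemma solution_combination_gaussian:
  assumes t: "0 \<le> t" "0 \<le> s" and x: "x \<in> {-pi..pi}" "y \<in> {-pi..pi}"
    and int: "\<And>j. 1 \<le> j \<Longrightarrow> integrable lborel
      (\<lambda>r. (\<phi> j x * heat_kernel (lam j) t r - \<phi> j y * heat_kernel (lam j) s r)\<^sup>2)"
    and V: "\<And>n. (\<Sum>j=1..n. LINT r|lborel. (\<phi> j x * heat_kernel (lam j) t r - \<phi> j y * heat_kernel (lam j) s r)\<^sup>2) \<le> V"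
  shows "\<exists>w\<le>V. centered_gaussian M (\<lambda>\<omega>. u t x \<omega> - u s y \<omega>) w"
proof (rule gaussian_series)
  have "L2_limit M (\<lambda>n \<omega>. (\<Sum>j=1..n. mode j t \<omega> * \<phi> j x) + - 1 * (\<Sum>j=1..n. mode j s \<omega> * \<phi> j y))
     (\<lambda>\<omega>. u t x \<omega> + - 1 * u s y \<omega>)"
    using t x by (intro L2_limit_add L2_limit_scale mode)
  moreover have "(\<Sum>j=1..n. mode j t \<omega> * \<phi> j x) + - 1 * (\<Sum>j=1..n. mode j s \<omega> * \<phi> j y)
      = (\<Sum>j=1..n. \<phi> j x * mode j t \<omega> + - \<phi> j y * mode j s \<omega>)" for n \<omega>
    by (simp add: sum_subtractf mult.commute)
  ultimately show "L2_limit M (\<lambda>n \<omega>. \<Sum>j=1..n. \<phi> j x * mode j t \<omega> + - \<phi> j y * mode j s \<omega>)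
      (\<lambda>\<omega>. u t x \<omega> - u s y \<omega>)" by simp
next
  fix n
  show "centered_gaussian M (\<lambda>\<omega>. \<Sum>j=1..n. \<phi> j x * mode j t \<omega> + - \<phi> j y * mode j s \<omega>)
     (\<Sum>j=1..n. LINT r|lborel. (\<phi> j x * heat_kernel (lam j) t r - \<phi> j y * heat_kernel (lam j) s r)\<^sup>2)"
    using t int
    by (intro sum_wiener_integrals_gaussian[OF ibm, where t=t and s=s
          and h="\<lambda>j s. exp (- lam j * (t - s))" and h'="\<lambda>j r. exp (- lam j * (s - r))"])
       (use mode(1)[OF _ t(1)] mode(1)[OF _ t(2)] in \<open>auto simp: heat_kernel_def\<close>)
qed (use V in auto)

lemma solution_time_increment:
  assumes t: "0 \<le> t" "0 \<le> s" and x: "x \<in> {-pi..pi}"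
  shows "\<exists>w \<le> 8 * sqrt \<bar>t - s\<bar>. centered_gaussian M (\<lambda>\<omega>. u t x \<omega> - u s x \<omega>) w"
proof (rule solution_combination_gaussian[OF t x x])
  let ?D = "\<lambda>j r. heat_kernel (lam j) t r - heat_kernel (lam j) s r"
  have sq: "(\<phi> j x * heat_kernel (lam j) t r - \<phi> j x * heat_kernel (lam j) s r)\<^sup>2 = (\<phi> j x)\<^sup>2 * (?D j r)\<^sup>2" for j r
    by (simp add: power_mult_distrib[symmetric] right_diff_distrib)
  have D: "integrable lborel (\<lambda>r. (?D j r)\<^sup>2) \<and> (LINT r|lborel. (?D j r)\<^sup>2) \<le> 2 * min \<bar>t - s\<bar> (1 / lam j)"
    if "1 \<le> j" for j
  proof (cases "s \<le> t")
    case True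
    then show ?thesis using heat_kernel_diff_square_integral[OF lam_pos[OF that] t(2)] by simp
  next
    case False
    then show ?thesis using heat_kernel_diff_square_integral[OF lam_pos[OF that] t(1), of s]
      by (simp add: power2_commute)
  qed
  show "integrable lborel (\<lambda>r. (\<phi> j x * heat_kernel (lam j) t r - \<phi> j x * heat_kernel (lam j) s r)\<^sup>2)" if "1 \<le> j" for j
    unfolding sq using D[OF that] by simp
  fix n
  have "(\<Sum>j=1..n. LINT r|lborel. (\<phi> j x * heat_kernel (lam j) t r - \<phi> j x * heat_kernel (lam j) s r)\<^sup>2)
      \<le> (\<Sum>j=1..n. (\<phi> j x)\<^sup>2 * (2 * min \<bar>t - s\<bar> (1 / lam j)))"
    unfolding sq using D by (intro sum_mono) (auto intro!: mult_left_mono)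
  also have "\<dots> = 2 * (\<Sum>j=1..n. min \<bar>t - s\<bar> (1 / lam j) * (\<phi> j x)\<^sup>2)"
    by (simp add: sum_distrib_left mult_ac)
  also have "\<dots> \<le> 2 * (4 * sqrt \<bar>t - s\<bar>)"
    using x by (intro mult_left_mono phi_min_sum_le) auto
  finally show "(\<Sum>j=1..n. LINT r|lborel. (\<phi> j x * heat_kernel (lam j) t r - \<phi> j x * heat_kernel (lam j) s r)\<^sup>2)
      \<le> 8 * sqrt \<bar>t - s\<bar>" by simp
qed

lemma solution_space_increment:
  assumes t: "0 \<le> t" and x: "x \<in> {-pi..pi}" "y \<in> {-pi..pi}"
  shows "\<exists>w \<le> \<bar>x - y\<bar>. centered_gaussian M (\<lambda>\<omega>. u t x \<omega> - u t y \<omega>) w"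
proof (rule solution_combination_gaussian[OF t t x])
  have sq: "(\<phi> j x * heat_kernel (lam j) t r - \<phi> j y * heat_kernel (lam j) t r)\<^sup>2
      = (\<phi> j x - \<phi> j y)\<^sup>2 * (heat_kernel (lam j) t r)\<^sup>2" for j r
    by (simp add: power_mult_distrib[symmetric] left_diff_distrib)
  show "integrable lborel (\<lambda>r. (\<phi> j x * heat_kernel (lam j) t r - \<phi> j y * heat_kernel (lam j) t r)\<^sup>2)" if "1 \<le> j" for j
    unfolding sq using heat_kernel_square_integral(1)[OF lam_pos[OF that] t] by simp
  fix n
  have "(\<Sum>j=1..n. LINT r|lborel. (\<phi> j x * heat_kernel (lam j) t r - \<phi> j y * heat_kernel (lam j) t r)\<^sup>2)
      \<le> (\<Sum>j=1..n. (\<phi> j x - \<phi> j y)\<^sup>2 * (1 / lam j))"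
    unfolding sq using heat_kernel_square_integral(2)[OF lam_pos t]
    by (intro sum_mono) (auto intro!: mult_left_mono simp del: times_divide_eq_right)
  also have "\<dots> \<le> \<bar>x - y\<bar>"
    using phi_diff_sum_le[of "{1..n}" x y] x by simp
  finally show "(\<Sum>j=1..n. LINT r|lborel. (\<phi> j x * heat_kernel (lam j) t r - \<phi> j y * heat_kernel (lam j) t r)\<^sup>2)
      \<le> \<bar>x - y\<bar>" .
qed

end


section \<open>Kernels of the dyadic blocks\<close>

text \<open>The inverse Fourier transform in one dimension; for a dyadic symbol it is the
  convolution kernel of the corresponding frequency localisation.\<close>

definition kern :: "(real \<Rightarrow> real) \<Rightarrow> real \<Rightarrow> complex" where
  "kern f y = (LINT x|lborel. cis (y * x) * of_real (f x)) / (2 * of_real pi)"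

lemma integrable_compact_support:
  fixes f :: "real \<Rightarrow> 'a :: euclidean_space"
  assumes "continuous_on UNIV f" "\<And>x. r < \<bar>x\<bar> \<Longrightarrow> f x = 0"
  shows "integrable lborel f"
proof -
  have "set_integrable lborel {-r..r} f"
    using assms(1) by (intro borel_integrable_atLeastAtMost') (auto intro: continuous_on_subset)
  moreover have "(\<lambda>x. indicator {-r..r} x *\<^sub>R f x) = f"
    using assms(2) by (fastforce simp: indicator_def)
  ultimately show ?thesis by (simp add: set_integrable_def)
qed

lemma continuous_cis_mult: "continuous_on A (\<lambda>x. cis (y * x))"
  unfolding cis_conv_exp by (intro continuous_intros)

lemma has_vector_derivative_cis_mult:
  "((\<lambda>x. cis (y * x)) has_vector_derivative \<i> * of_real y * cis (y * x)) (at x within A)"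
proof -
  have "((\<lambda>z. exp (\<i> * of_real y * z)) has_field_derivative \<i> * of_real y * exp (\<i> * of_real y * of_real x)) (at (of_real x))"
    by (auto intro!: derivative_eq_intros)
  from has_vector_derivative_real_field[OF this] show ?thesis
    by (simp add: cis_conv_exp mult_ac)
qed

lemma cis_borel_measurable [measurable]: "cis \<in> borel_measurable borel"
  unfolding cis_conv_exp[abs_def] by (intro borel_measurable_continuous_onI continuous_intros)

lemma kern_measurable [measurable]:
  assumes [measurable]: "f \<in> borel_measurable borel"
  shows "kern f \<in> borel_measurable borel"
  unfolding kern_def by measurable

lemma norm_kern_le: "norm (kern f y) \<le> (LINT x|lborel. \<bar>f x\<bar>)"
proof -
  have "norm (kern f y) = norm (LINT x|lborel. cis (y * x) * of_real (f x)) / (2 * pi)"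
    by (simp add: kern_def norm_divide norm_mult)
  also have "\<dots> \<le> (LINT x|lborel. \<bar>f x\<bar>) / (2 * pi)"
    using Bochner_Integration.integral_norm_bound[of lborel "\<lambda>x. cis (y * x) * of_real (f x)"]
    by (intro divide_right_mono) (simp_all add: norm_mult)
  also have "\<dots> \<le> (LINT x|lborel. \<bar>f x\<bar>) / 1"
    using pi_gt3 by (intro divide_left_mono) auto
  finally show ?thesis by simp
qed

text \<open>The derivatives are parameters because the locale is used for three functions: f, its
  second derivative, and f(x)/x.\<close>

locale compactly_supported_C2 =
  fixes f f1 f2 :: "real \<Rightarrow> real" and r :: real
  assumes f1: "\<And>x. (f has_real_derivative f1 x) (at x)"
    and f2: "\<And>x. (f1 has_real_derivative f2 x) (at x)"
    and f2_cont: "continuous_on UNIV f2"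
    and supp: "\<And>x. r < \<bar>x\<bar> \<Longrightarrow> f x = 0" and r: "0 \<le> r"
begin

lemma f_cont: "continuous_on UNIV f" and f1_cont: "continuous_on UNIV f1"
  by (rule DERIV_continuous_on[OF has_field_derivative_at_within[OF f1]]
      DERIV_continuous_on[OF has_field_derivative_at_within[OF f2]])+

lemma deriv_supp: "r < \<bar>x\<bar> \<Longrightarrow> f1 x = 0" "r < \<bar>x\<bar> \<Longrightarrow> f2 x = 0"
proof -
  have op: "open {x. r < \<bar>x\<bar>}" by (intro open_Collect_less continuous_intros)
  have vanish: "g' x = 0" if "r < \<bar>x\<bar>" "\<And>x. r < \<bar>x\<bar> \<Longrightarrow> g x = 0" "(g has_real_derivative g' x) (at x)"
    for g g' :: "real \<Rightarrow> real" and x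
  proof -
    have "(g has_real_derivative 0) (at x)"
      by (rule has_field_derivative_transform_within_open[OF DERIV_const op]) (use that in auto)
    then show ?thesis using that(3) by (rule DERIV_unique[symmetric])
  qed
  show 1: "r < \<bar>x\<bar> \<Longrightarrow> f1 x = 0" for x using vanish[of x f f1] supp f1 by blast
  show "r < \<bar>x\<bar> \<Longrightarrow> f2 x = 0" using vanish[of x f1 f2] 1 f2 by blast
qed

lemma integrable_cis_f:
  "integrable lborel (\<lambda>x. cis (y * x) * of_real (f x))" "integrable lborel (\<lambda>x. cis (y * x) * of_real (f2 x))"
  using f_cont f2_cont supp deriv_supp
  by (auto intro!: integrable_compact_support[of _ r] continuous_intros continuous_cis_mult)

text \<open>Two integrations by parts in a single step: the integrand for \<open>f2\<close> plus y^2
  times the one for f is the derivative of the compactly supported function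
  \<open>?H\<close>.\<close>

lemma kern_second_derivative: "kern f2 y = - of_real (y\<^sup>2) * kern f y"
proof -
  \<comment> \<open>The support condition is strict, so f may be nonzero at r itself; one unit
    further out all boundary terms vanish.\<close>
  define R where "R = r + 1"
  have R: "-R \<le> R" "f R = 0" "f (-R) = 0" "f1 R = 0" "f1 (-R) = 0"
    using r supp deriv_supp by (auto simp: R_def)
  let ?h = "\<lambda>x. cis (y * x) * of_real (f2 x) + of_real (y\<^sup>2) * (cis (y * x) * of_real (f x))"
  let ?H = "\<lambda>x. cis (y * x) * (of_real (f1 x) - \<i> * of_real y * of_real (f x))"
  have "(?H has_vector_derivative ?h x) (at x within {-R..R})" for x
  proof -
    have "((\<lambda>x. of_real (f x) :: complex) has_vector_derivative of_real (f1 x)) (at x within {-R..R})"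
      "((\<lambda>x. of_real (f1 x) :: complex) has_vector_derivative of_real (f2 x)) (at x within {-R..R})"
      using f1 f2 by (auto intro!: has_vector_derivative_of_real
          simp: has_real_derivative_iff_has_vector_derivative[symmetric] has_field_derivative_at_within)
    then have "(?H has_vector_derivative
        (cis (y * x) * (of_real (f2 x) - \<i> * of_real y * of_real (f1 x)) +
         \<i> * of_real y * cis (y * x) * (of_real (f1 x) - \<i> * of_real y * of_real (f x)))) (at x within {-R..R})"
      by (intro has_vector_derivative_mult has_vector_derivative_diff has_vector_derivative_cis_mult
          has_vector_derivative_mult_right)
    then show ?thesis by (simp add: algebra_simps power2_eq_square)
  qed
  then have "(?h has_integral (?H R - ?H (-R))) {-R..R}"
    using R by (intro fundamental_theorem_of_calculus)
  then have 0: "integral {-R..R} ?h = 0" using R by (simp add: integral_unique)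
  have "set_integrable lborel {-R..R} ?h"
    using f_cont f2_cont by (intro borel_integrable_atLeastAtMost' continuous_intros continuous_cis_mult)
      (auto intro: continuous_on_subset)
  then have "(LINT x:{-R..R}|lborel. ?h x) = 0"
    using 0 by (simp add: set_borel_integral_eq_integral(2))
  moreover have "(LINT x:{-R..R}|lborel. ?h x) = (LINT x|lborel. ?h x)"
    unfolding set_lebesgue_integral_def
    by (intro Bochner_Integration.integral_cong) (use supp deriv_supp in \<open>auto simp: indicator_def R_def\<close>)
  ultimately have "(LINT x|lborel. cis (y * x) * of_real (f2 x)) + of_real (y\<^sup>2) * (LINT x|lborel. cis (y * x) * of_real (f x)) = 0"
    using integrable_cis_f[of y] by simp
  then have *: "(LINT x|lborel. cis (y * x) * of_real (f2 x)) = - (of_real (y\<^sup>2) * (LINT x|lborel. cis (y * x) * of_real (f x)))"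
    by (simp add: add_eq_0_iff2)
  show ?thesis unfolding kern_def * by simp
qed

lemma kern_decay: "\<exists>C. \<forall>y. (1 + y\<^sup>2) * norm (kern f y) \<le> C"
proof (intro exI allI)
  fix y
  have "(1 + y\<^sup>2) * norm (kern f y) = norm (kern f y) + norm (kern f2 y)"
    by (simp add: kern_second_derivative norm_mult norm_power distrib_right)
  also have "\<dots> \<le> (LINT x|lborel. \<bar>f x\<bar>) + (LINT x|lborel. \<bar>f2 x\<bar>)"
    by (intro add_mono norm_kern_le)
  finally show "(1 + y\<^sup>2) * norm (kern f y) \<le> (LINT x|lborel. \<bar>f x\<bar>) + (LINT x|lborel. \<bar>f2 x\<bar>)" .
qed

end

lemma smooth_real_compactly_supported_C2:
  assumes "smooth_real f" "\<And>x. r < \<bar>x\<bar> \<Longrightarrow> f x = 0" "0 \<le> r"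
  shows "compactly_supported_C2 f (deriv f) (deriv (deriv f)) r"
    "compactly_supported_C2 (deriv (deriv f)) ((deriv ^^ 3) f) ((deriv ^^ 4) f) r"
proof -
  have D: "((deriv ^^ n) f has_real_derivative (deriv ^^ Suc n) f x) (at x)" for n x
    using assms(1) by (auto simp: smooth_real_def field_differentiable_derivI)
  have c: "continuous_on UNIV ((deriv ^^ n) f)" for n
    by (rule DERIV_continuous_on[OF has_field_derivative_at_within[OF D]])
  show *: "compactly_supported_C2 f (deriv f) (deriv (deriv f)) r"
    using D[of 0] D[of 1] c[of 2] assms by unfold_locales (auto simp: numeral_2_eq_2)
  interpret compactly_supported_C2 f "deriv f" "deriv (deriv f)" r by (rule *)
  show "compactly_supported_C2 (deriv (deriv f)) ((deriv ^^ 3) f) ((deriv ^^ 4) f) r"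
    using D[of 2] D[of 3] c[of 4] assms(3) deriv_supp(2) by unfold_locales (auto simp: eval_nat_numeral)
qed

text \<open>Two derivatives give one factor 1 + y^2, so the argument is run for f and for its second
  derivative. Decay of order four leaves an integrable function after multiplication by a weight
  that is at most 1 + y^2.\<close>

lemma kern_smooth_decay:
  assumes "smooth_real f" "\<And>x. r < \<bar>x\<bar> \<Longrightarrow> f x = 0" "0 \<le> r"
  shows "\<exists>C. \<forall>y. norm (kern f y) \<le> C / (1 + y\<^sup>2)\<^sup>2"
proof -
  interpret f: compactly_supported_C2 f "deriv f" "deriv (deriv f)" r
    using smooth_real_compactly_supported_C2[OF assms] by simp
  interpret f2: compactly_supported_C2 "deriv (deriv f)" "(deriv ^^ 3) f" "(deriv ^^ 4) f" r
    using smooth_real_compactly_supported_C2[OF assms] by simp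
  obtain C1 C2 where C: "\<And>y. (1 + y\<^sup>2) * norm (kern f y) \<le> C1"
    "\<And>y. (1 + y\<^sup>2) * norm (kern (deriv (deriv f)) y) \<le> C2"
    using f.kern_decay f2.kern_decay by blast
  have "norm (kern f y) \<le> (C1 + C2) / (1 + y\<^sup>2)\<^sup>2" for y
  proof -
    have "(1 + y\<^sup>2)\<^sup>2 * norm (kern f y) = (1 + y\<^sup>2) * norm (kern f y) + (1 + y\<^sup>2) * norm (kern (deriv (deriv f)) y)"
      by (simp add: f.kern_second_derivative norm_mult power2_eq_square algebra_simps)
    also have "\<dots> \<le> C1 + C2" by (intro add_mono C)
    moreover have "0 < 1 + y\<^sup>2" by (simp add: add_pos_nonneg)
    ultimately show ?thesis
      by (subst pos_le_divide_eq) (simp_all add: mult.commute)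
  qed
  then show ?thesis by blast
qed

lemma integrable_inverse_one_plus_square: "integrable lborel (\<lambda>x::real. 1 / (1 + x\<^sup>2))"
  using integrable_inverse_1_plus_square by (simp add: set_integrable_def inverse_eq_divide)

lemma integrable_kern:
  assumes "smooth_real f" "\<And>x. r < \<bar>x\<bar> \<Longrightarrow> f x = 0" "0 \<le> r" "0 \<le> b" "b \<le> 1"
  shows "integrable lborel (\<lambda>y. norm (kern f y) * \<bar>y\<bar> powr b)" "integrable lborel (kern f)"
proof -
  interpret f: compactly_supported_C2 f "deriv f" "deriv (deriv f)" r
    using smooth_real_compactly_supported_C2[OF assms(1-3)] by simp
  have fm[measurable]: "f \<in> borel_measurable borel"
    using f.f_cont by (rule borel_measurable_continuous_onI)
  obtain C where C: "\<And>y. norm (kern f y) \<le> C / (1 + y\<^sup>2)\<^sup>2"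
    using kern_smooth_decay[OF assms(1-3)] by blast
  have C0: "0 \<le> C" using order_trans[OF norm_ge_zero C[of 0]] by simp
  have i: "integrable lborel (\<lambda>y::real. C * (1 / (1 + y\<^sup>2)))"
    by (intro integrable_mult_right integrable_inverse_one_plus_square)
  have pw: "\<bar>y\<bar> powr b \<le> 1 + y\<^sup>2" for y :: real
  proof (cases "\<bar>y\<bar> \<le> 1")
    case True
    then have "\<bar>y\<bar> powr b \<le> 1" using assms(4) by (simp add: powr_le1)
    then show ?thesis by (rule order_trans) simp
  next
    case False
    then have "\<bar>y\<bar> powr b \<le> \<bar>y\<bar> powr 2" using assms by (intro powr_mono) auto
    then show ?thesis using False by simp
  qed
  have le: "norm (kern f y) * c \<le> C * (1 / (1 + y\<^sup>2))" if "0 \<le> c" "c \<le> 1 + y\<^sup>2" for c y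
  proof -
    have "norm (kern f y) * c \<le> C / (1 + y\<^sup>2)\<^sup>2 * (1 + y\<^sup>2)"
      using that C C0 by (intro mult_mono) auto
    also have "\<dots> = C * (1 / (1 + y\<^sup>2))"
      by (simp add: power2_eq_square[of "1 + y\<^sup>2"])
    finally show ?thesis .
  qed
  show "integrable lborel (\<lambda>y. norm (kern f y) * \<bar>y\<bar> powr b)"
  proof (rule Bochner_Integration.integrable_bound[OF i])
    show "AE y in lborel. norm (norm (kern f y) * \<bar>y\<bar> powr b) \<le> norm (C * (1 / (1 + y\<^sup>2)))"
    proof (rule AE_I2)
      fix y show "norm (norm (kern f y) * \<bar>y\<bar> powr b) \<le> norm (C * (1 / (1 + y\<^sup>2)))"
        using le[OF _ pw] order_trans[OF le[OF _ pw] abs_ge_self] by (simp add: abs_mult)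
    qed
  qed measurable
  show "integrable lborel (kern f)"
  proof (rule Bochner_Integration.integrable_bound[OF i])
    show "AE y in lborel. norm (kern f y) \<le> norm (C * (1 / (1 + y\<^sup>2)))"
    proof (rule AE_I2)
      fix y show "norm (kern f y) \<le> norm (C * (1 / (1 + y\<^sup>2)))"
        using order_trans[OF le[of 1 y] abs_ge_self] by simp
    qed
  qed measurable
qed

text \<open>Near 0 the quotient is identically 0, and the formula for the derivative evaluates to 0
  at x = 0 because division by 0 yields 0.\<close>

lemma divide_by_argument_has_derivative:
  fixes g :: "real \<Rightarrow> real"
  assumes g: "\<And>x. (g has_real_derivative g' x) (at x)" and z: "\<And>x. \<bar>x\<bar> < e \<Longrightarrow> g x = 0" and e: "0 < e"
  shows "((\<lambda>x. g x / x) has_real_derivative (g' x - g x / x) / x) (at x)"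
proof (cases "x = 0")
  case True
  have "((\<lambda>x. g x / x) has_real_derivative 0) (at 0)"
    by (rule has_field_derivative_transform_within_open[OF DERIV_const[of 0], of "{-e<..<e}"])
       (use z e in \<open>auto simp: abs_less_iff\<close>)
  then show ?thesis using True by simp
next
  case False
  then show ?thesis by (auto intro!: derivative_eq_intros g simp: field_simps)
qed

text \<open>With \<open>g x = f x / x\<close>, Fubini gives that the integral of \<^term>\<open>kern f\<close> over \<open>[-R, R]\<close> is
  \<open>(kern g R - kern g (-R)) / \<i>\<close>.\<close>

lemma integral_kern_eq_0:
  assumes f: "smooth_real f" "\<And>x. r < \<bar>x\<bar> \<Longrightarrow> f x = 0" "0 \<le> r" and e: "0 < e" "\<And>x. \<bar>x\<bar> < e \<Longrightarrow> f x = 0"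
  shows "(LINT y|lborel. kern f y) = 0"
proof -
  interpret f: compactly_supported_C2 f "deriv f" "deriv (deriv f)" r
    using smooth_real_compactly_supported_C2[OF f] by simp
  \<comment> \<open>As f vanishes near 0, division by x keeps the regularity; \<open>g1\<close> and
    \<open>g2\<close> are the first two derivatives of the quotient, written so that the quotient
    lemma applies twice.\<close>
  define g where "g x = f x / x" for x
  define g1 where "g1 x = (deriv f x - g x) / x" for x
  define g2 where "g2 x = (deriv (deriv f) x - 2 * g1 x) / x" for x
  have d0: "deriv f x = 0" "deriv (deriv f) x = 0" if "\<bar>x\<bar> < e" for x
  proof -
    have van: "h' x = 0" if "\<And>x. \<bar>x\<bar> < e \<Longrightarrow> h x = 0" "(h has_real_derivative h' x) (at x)" "\<bar>x\<bar> < e"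
      for h h' :: "real \<Rightarrow> real" and x
    proof -
      have "(h has_real_derivative 0) (at x)"
        by (rule has_field_derivative_transform_within_open[OF DERIV_const[of 0], of "{-e<..<e}"])
           (use that in \<open>auto simp: abs_less_iff\<close>)
      then show ?thesis using that(2) by (rule DERIV_unique[symmetric])
    qed
    have 1: "deriv f x = 0" if "\<bar>x\<bar> < e" for x using van[of f "deriv f" x] e(2) f.f1 that by blast
    show "deriv f x = 0" using 1 that .
    show "deriv (deriv f) x = 0" using van[of "deriv f" "deriv (deriv f)" x] 1 f.f2 that by blast
  qed
  have G1: "(g has_real_derivative g1 x) (at x)" for x
    unfolding g1_def g_def by (rule divide_by_argument_has_derivative[OF f.f1 e(2) e(1)])
  have g0: "g x = 0" "g1 x = 0" if "\<bar>x\<bar> < e" for x using d0[OF that] e(2)[OF that] by (auto simp: g_def g1_def)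
  have "((\<lambda>x. (deriv f x - g x) / x) has_real_derivative ((deriv (deriv f) x - g1 x) - (deriv f x - g x) / x) / x) (at x)" for x
    by (rule divide_by_argument_has_derivative[OF _ _ e(1)]) (use d0 g0 in \<open>auto intro!: derivative_eq_intros f.f2 G1\<close>)
  moreover have "((deriv (deriv f) x - g1 x) - (deriv f x - g x) / x) / x = g2 x" for x
    by (simp only: g1_def[symmetric] g2_def) simp
  moreover have "(\<lambda>x. (deriv f x - g x) / x) = g1" by (rule ext) (simp only: g1_def)
  ultimately have G2: "(g1 has_real_derivative g2 x) (at x)" for x
    by (simp only:)
  have G2c: "continuous_on UNIV g2"
  proof -
    have "isCont g2 x" for x
    proof (cases "x = 0")
      case True
      have "\<forall>\<^sub>F y in nhds 0. g2 y = 0"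
      proof (rule eventually_mono)
        show "\<forall>\<^sub>F y in nhds 0. y \<in> {-e<..<e}" using e(1) by (intro eventually_nhds_in_open) auto
      qed (use d0 g0 in \<open>auto simp: g2_def abs_less_iff\<close>)
      then have "isCont g2 0 = isCont (\<lambda>_. 0 :: real) (0::real)" by (rule isCont_cong)
      then show ?thesis using True by simp
    next
      case False
      have "isCont (deriv (deriv f)) x" using f.f2_cont by (simp add: continuous_on_eq_continuous_at)
      moreover have "isCont g1 x" using G2 by (rule DERIV_isCont)
      ultimately show ?thesis unfolding g2_def using False by (intro continuous_intros) auto
    qed
    then show ?thesis by (simp add: continuous_at_imp_continuous_on)
  qed
  interpret g: compactly_supported_C2 g g1 g2 r
    using G1 G2 G2c f by unfold_locales (auto simp: g_def)
  have fm[measurable]: "f \<in> borel_measurable borel" "g \<in> borel_measurable borel"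
    using f.f_cont g.f_cont by (auto intro: borel_measurable_continuous_onI)
  have trunc: "(LINT y:{-R..R}|lborel. kern f y) = (kern g R - kern g (-R)) / \<i>" if R: "0 \<le> R" for R
  proof -
    let ?F = "\<lambda>y x. indicator {-R..R} y *\<^sub>R (cis (y * x) * of_real (f x))"
    have "integrable (lborel \<Otimes>\<^sub>M lborel) (\<lambda>(y, x). ?F y x)"
    proof (rule lborel_pair.Fubini_integrable)
      show "integrable lborel (\<lambda>y. LINT x|lborel. norm (case (y, x) of (y, x) \<Rightarrow> ?F y x))"
        using R by (simp add: norm_mult)
    next
      show "AE y in lborel. integrable lborel (\<lambda>x. case (y, x) of (y, x) \<Rightarrow> ?F y x)"
        using f.integrable_cis_f by (intro AE_I2) auto
    qed measurable
    then have "(LINT y|lborel. LINT x|lborel. ?F y x) = (LINT x|lborel. LINT y|lborel. ?F y x)"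
      by (rule lborel_pair.Fubini_integral[symmetric])
    moreover have "(LINT y|lborel. ?F y x) = (cis (R * x) * of_real (g x) - cis (- R * x) * of_real (g x)) / \<i>" for x
    proof (cases "x = 0")
      case True
      then show ?thesis using e by (simp add: g_def)
    next
      case False
      define q where "q = of_real (f x) / (\<i> * of_real x)"
      have q: "q = of_real (g x) / \<i>" by (simp only: q_def g_def of_real_divide divide_divide_eq_left mult.commute)
      have D: "((\<lambda>y. cis (y * x) * q) has_vector_derivative cis (y * x) * of_real (f x)) (at y within {-R..R})" for y
      proof -
        have "((\<lambda>y. cis (y * x) * (of_real (f x) / (\<i> * of_real x))) has_vector_derivative
            (\<i> * of_real x * cis (x * y)) * (of_real (f x) / (\<i> * of_real x))) (at y within {-R..R})"
          using has_vector_derivative_cis_mult[of x y "{-R..R}"]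
          by (intro has_vector_derivative_mult_left) (simp add: mult.commute)
        then show ?thesis unfolding q_def using False by (simp add: mult.commute)
      qed
      have hi: "((\<lambda>y. cis (y * x) * of_real (f x)) has_integral
          (cis (R * x) * q - cis (- R * x) * q)) {-R..R}"
        using R D by (intro fundamental_theorem_of_calculus) auto
      have si: "set_integrable lborel {-R..R} (\<lambda>y. cis (y * x) * of_real (f x))"
        using continuous_cis_mult[of _ x] by (intro borel_integrable_atLeastAtMost' continuous_intros)
      have "(LINT y|lborel. ?F y x) = (LINT y:{-R..R}|lborel. cis (y * x) * of_real (f x))"
        by (simp only: set_lebesgue_integral_def)
      also have "\<dots> = cis (R * x) * q - cis (- R * x) * q"
        by (simp only: set_borel_integral_eq_integral(2)[OF si] integral_unique[OF hi])
      also have "\<dots> = (cis (R * x) * of_real (g x) - cis (- R * x) * of_real (g x)) / \<i>"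
        by (simp only: q diff_divide_distrib times_divide_eq_right)
      finally show ?thesis .
    qed
    ultimately have "(LINT y|lborel. LINT x|lborel. ?F y x)
        = (LINT x|lborel. (cis (R * x) * of_real (g x) - cis (- R * x) * of_real (g x)) / \<i>)"
      by (simp only:)
    also have "(LINT x|lborel. (cis (R * x) * of_real (g x) - cis (- R * x) * of_real (g x)) / \<i>)
        = (2 * of_real pi) * ((kern g R - kern g (-R)) / \<i>)"
      using g.integrable_cis_f(1)[of R] g.integrable_cis_f(1)[of "-R"]
      by (simp add: kern_def diff_divide_distrib[symmetric])
    finally have eq: "(LINT y|lborel. LINT x|lborel. ?F y x) = (2 * of_real pi) * ((kern g R - kern g (-R)) / \<i>)" .
    have "(LINT y:{-R..R}|lborel. kern f y) = (LINT y|lborel. (LINT x|lborel. ?F y x) / (2 * of_real pi))"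
      unfolding set_lebesgue_integral_def kern_def by (simp add: scaleR_conv_of_real)
    also have "\<dots> = (LINT y|lborel. LINT x|lborel. ?F y x) / (2 * of_real pi)" by simp
    finally show ?thesis unfolding eq by simp
  qed
  obtain C where C: "\<And>y. (1 + y\<^sup>2) * norm (kern g y) \<le> C" using g.kern_decay by blast
  \<comment> \<open>The truncated integrals tend to 0 by the decay of \<open>kern g\<close>, and to
    the full integral by dominated convergence with \<open>kern f\<close>; comparing the limits
    proves the claim.\<close>
  have lim1: "(\<lambda>n. LINT y:{- real n..real n}|lborel. kern f y) \<longlonglongrightarrow> 0"
  proof (rule Lim_null_comparison)
    have gb: "norm (kern g y) \<le> C * (1 / (1 + y\<^sup>2))" for y
      using C[of y] by (simp add: field_simps add_pos_nonneg)
    show "\<forall>\<^sub>F n in sequentially. norm (LINT y:{- real n..real n}|lborel. kern f y) \<le> 2 * (C * (1 / (1 + (real n)\<^sup>2)))"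
    proof (intro always_eventually allI)
      fix n
      have "norm (LINT y:{- real n..real n}|lborel. kern f y) \<le> norm (kern g (real n)) + norm (kern g (- real n))"
        unfolding trunc[OF of_nat_0_le_iff] norm_divide norm_ii div_by_1 by (rule norm_triangle_ineq4)
      also have "\<dots> \<le> C * (1 / (1 + (real n)\<^sup>2)) + C * (1 / (1 + (- real n)\<^sup>2))"
        by (intro add_mono gb)
      finally show "norm (LINT y:{- real n..real n}|lborel. kern f y) \<le> 2 * (C * (1 / (1 + (real n)\<^sup>2)))" by simp
    qed
    have "(\<lambda>n. 2 * (C * inverse (1 + (real n)\<^sup>2))) \<longlonglongrightarrow> 2 * (C * 0)"
      by (intro tendsto_mult tendsto_const tendsto_inverse_0_at_top
          filterlim_tendsto_add_at_top[OF tendsto_const] filterlim_pow_at_top filterlim_real_sequentially) simp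
    then show "(\<lambda>n. 2 * (C * (1 / (1 + (real n)\<^sup>2)))) \<longlonglongrightarrow> 0"
      by (simp add: inverse_eq_divide)
  qed
  have lim2: "(\<lambda>n. LINT y:{- real n..real n}|lborel. kern f y) \<longlonglongrightarrow> (LINT y|lborel. kern f y)"
    unfolding set_lebesgue_integral_def
  proof (rule integral_dominated_convergence[where w="\<lambda>y. norm (kern f y)"])
    show "integrable lborel (\<lambda>y. norm (kern f y))"
      using integrable_kern(2)[OF f, of 0] by simp
    show "AE y in lborel. (\<lambda>n. indicator {- real n..real n} y *\<^sub>R kern f y) \<longlonglongrightarrow> kern f y"
    proof (intro AE_I2 tendsto_eventually)
      fix y :: real
      obtain N :: nat where "\<bar>y\<bar> \<le> real N" using real_arch_simple by blast
      then show "\<forall>\<^sub>F n in sequentially. indicator {- real n..real n} y *\<^sub>R kern f y = kern f y"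
        by (intro eventually_sequentiallyI[of N]) (auto simp: indicator_def)
    qed
    show "AE y in lborel. norm (indicator {- real n..real n} y *\<^sub>R kern f y) \<le> norm (kern f y)" for n
      by (auto simp: indicator_def)
  qed measurable
  show ?thesis using LIMSEQ_unique[OF lim2 lim1] .
qed

lemma kern_scale:
  assumes c: "0 < c"
  shows "kern (\<lambda>x. f (c * x)) y = kern f (y / c) / of_real c"
proof -
  have "(LINT x|lborel. cis (y / c * x) * of_real (f x))
      = \<bar>c\<bar> *\<^sub>R (LINT x|lborel. cis (y / c * (0 + c * x)) * of_real (f (0 + c * x)))"
    using c by (intro lborel_integral_real_affine) auto
  then show ?thesis using c by (simp add: kern_def scaleR_conv_of_real)
qed

section \<open>Block kernels at all dyadic scales\<close>

locale dyadic_decomposition =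
  fixes \<theta> \<rho> :: "real \<Rightarrow> real"
  assumes partition: "dyadic_partition \<theta> \<rho>"
begin

abbreviation K :: "int \<Rightarrow> real \<Rightarrow> complex" where
  "K j \<equiv> kern (dyadic \<theta> \<rho> j)"

lemma smooth: "smooth_real \<theta>" "smooth_real \<rho>"
  using partition by (auto simp: dyadic_partition_def)

lemma support:
  "4 / 3 < \<bar>x\<bar> \<Longrightarrow> \<theta> x = 0" "8 / 3 < \<bar>x\<bar> \<Longrightarrow> \<rho> x = 0" "\<bar>x\<bar> < 3 / 4 \<Longrightarrow> \<rho> x = 0"
  using partition closure_subset[of "{z. \<theta> z \<noteq> 0}"] closure_subset[of "{z. \<rho> z \<noteq> 0}"]
  by (force simp: dyadic_partition_def)+

lemma dyadic_minus_one: "dyadic \<theta> \<rho> (-1) = \<theta>"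
  by (auto simp: dyadic_def)

lemma dyadic_nonneg: "0 \<le> j \<Longrightarrow> dyadic \<theta> \<rho> j = (\<lambda>x. \<rho> (2 powr (- of_int j) * x))"
  by (auto simp: dyadic_def)

lemma K_nonneg: "0 \<le> j \<Longrightarrow> K j y = kern \<rho> (y / 2 powr (- of_int j)) / of_real (2 powr (- of_int j))"
  by (simp add: dyadic_nonneg kern_scale)

lemma theta_rho_continuous: "continuous_on UNIV \<theta>" "continuous_on UNIV \<rho>"
proof -
  show "continuous_on UNIV \<theta>"
    by (rule compactly_supported_C2.f_cont[OF smooth_real_compactly_supported_C2(1)[where r="4 / 3"]])
       (use smooth support in auto)
  show "continuous_on UNIV \<rho>"
    by (rule compactly_supported_C2.f_cont[OF smooth_real_compactly_supported_C2(1)[where r="8 / 3"]])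
       (use smooth support in auto)
qed

lemma dyadic_continuous: "-1 \<le> j \<Longrightarrow> continuous_on UNIV (dyadic \<theta> \<rho> j)"
  using theta_rho_continuous
  by (cases "j = -1") (auto simp: dyadic_minus_one dyadic_nonneg intro!: continuous_on_compose2[of UNIV \<rho>] continuous_intros)

lemma dyadic_measurable [measurable]: "-1 \<le> j \<Longrightarrow> dyadic \<theta> \<rho> j \<in> borel_measurable borel"
  by (intro borel_measurable_continuous_onI dyadic_continuous)

lemma dyadic_integrable:
  assumes "-1 \<le> j"
  shows "integrable lborel (dyadic \<theta> \<rho> j)"
proof (cases "j = -1")
  case True
  then show ?thesis using support(1) theta_rho_continuous
    by (auto simp: dyadic_minus_one intro!: integrable_compact_support[of _ "4 / 3"])
next
  case False
  have "dyadic \<theta> \<rho> j x = 0" if "8 / 3 * 2 powr of_int j < \<bar>x\<bar>" for x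
  proof -
    have "8 / 3 < \<bar>2 powr (- of_int j) * x\<bar>"
      using that by (simp add: abs_mult powr_minus field_simps)
    then show ?thesis using assms False support(2) by (simp add: dyadic_nonneg)
  qed
  then show ?thesis
    by (rule integrable_compact_support[OF dyadic_continuous[OF assms]])
qed

lemma K_measurable [measurable]: "-1 \<le> j \<Longrightarrow> K j \<in> borel_measurable borel"
  by (intro kern_measurable dyadic_measurable)

lemma K_integrable:
  assumes "-1 \<le> j"
  shows "integrable lborel (K j)"
proof (cases "j = -1")
  case True
  have "integrable lborel (kern \<theta>)"
    by (rule integrable_kern(2)[where r="4 / 3" and b=0]) (use smooth support in auto)
  then show ?thesis using True by (simp add: dyadic_minus_one)
next
  case False
  define c where "c = 2 powr (- real_of_int j)"
  have c: "0 < c" by (simp add: c_def)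
  have "integrable lborel (\<lambda>y. kern \<rho> (0 + 1 / c * y))"
    using c by (intro lborel_integrable_real_affine integrable_kern(2)[where r="8 / 3" and b=0])
      (use smooth support in auto)
  then have "integrable lborel (\<lambda>y. kern \<rho> (y / c) / of_real c)" by simp
  moreover have "K j = (\<lambda>y. kern \<rho> (y / c) / of_real c)"
    using K_nonneg[of j] False assms by (intro ext) (simp add: c_def)
  ultimately show ?thesis by (simp only:)
qed

text \<open>The integral of a kernel is the value of its symbol at frequency 0, and
  \<open>\<rho>\<close> vanishes near the origin. Rescaling transfers this from
  \<open>\<rho>\<close> to every j >= 0.\<close>

lemma K_integral_eq_0:
  assumes "0 \<le> j"
  shows "(LINT y|lborel. K j y) = 0"
proof -
  define c where "c = 2 powr (- real_of_int j)"
  have c: "0 < c" by (simp add: c_def)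
  have "(LINT y|lborel. kern \<rho> y) = 0"
    by (rule integral_kern_eq_0[where r="8 / 3" and e="3 / 4"]) (use smooth support in auto)
  then have "(LINT y|lborel. kern \<rho> (0 + 1 / c * y)) = 0"
    using lborel_integral_real_affine[of "1 / c" "kern \<rho>" 0] c by simp
  then show ?thesis using K_nonneg[OF assms] by (simp add: c_def)
qed

text \<open>The low-frequency block \<open>j = -1\<close> has no cancellation, hence no gain in scale.\<close>

definition exponent :: "real \<Rightarrow> int \<Rightarrow> real" where
  "exponent b j = (if j = -1 then 0 else b)"

text \<open>For j >= 0 the kernel is 2^j times \<open>kern \<rho>\<close> at 2^j y, so each power of
  |y| in the weight gains a factor 2^(-j). One constant A has to serve all scales, including j =
  -1.\<close>

lemma K_weighted_integral:
  assumes "0 \<le> b" "b \<le> 1"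
  shows "\<exists>A>0. \<forall>j\<ge>-1. (\<integral>\<^sup>+y. ennreal (norm (K j y) * \<bar>y\<bar> powr exponent b j) \<partial>lborel)
    \<le> ennreal (A * 2 powr (- of_int j * exponent b j))"
proof -
  define A1 where "A1 = (LINT y|lborel. norm (kern \<theta> y) * \<bar>y\<bar> powr 0)"
  define A2 where "A2 = (LINT y|lborel. norm (kern \<rho> y) * \<bar>y\<bar> powr b)"
  have i1: "integrable lborel (\<lambda>y. norm (kern \<theta> y) * \<bar>y\<bar> powr 0)"
    by (rule integrable_kern(1)[where r="4 / 3"]) (use smooth support in auto)
  have i2: "integrable lborel (\<lambda>y. norm (kern \<rho> y) * \<bar>y\<bar> powr b)"
    by (rule integrable_kern(1)[where r="8 / 3"]) (use smooth support assms in auto)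
  have [measurable]: "\<rho> \<in> borel_measurable borel"
    using theta_rho_continuous by (auto intro: borel_measurable_continuous_onI)
  have A: "0 \<le> A1" "0 \<le> A2" by (auto simp: A1_def A2_def intro!: Bochner_Integration.integral_nonneg)
  show ?thesis
  proof (intro exI[of _ "A1 + A2 + 1"] conjI allI impI)
    fix j :: int assume j: "-1 \<le> j"
    show "(\<integral>\<^sup>+y. ennreal (norm (K j y) * \<bar>y\<bar> powr exponent b j) \<partial>lborel)
      \<le> ennreal ((A1 + A2 + 1) * 2 powr (- of_int j * exponent b j))"
    proof (cases "j = -1")
      case True
      have "(\<integral>\<^sup>+y. ennreal (norm (kern \<theta> y) * \<bar>y\<bar> powr 0) \<partial>lborel) = ennreal A1"
        unfolding A1_def by (rule nn_integral_eq_integral[OF i1]) auto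
      then show ?thesis using True A by (simp add: dyadic_minus_one exponent_def ennreal_leI)
    next
      case False
      define c where "c = 2 powr (- real_of_int j)"
      have c: "0 < c" by (simp add: c_def)
      have "(\<integral>\<^sup>+y. ennreal (norm (K j y) * \<bar>y\<bar> powr b) \<partial>lborel)
          = c * (\<integral>\<^sup>+y. ennreal (norm (K j (0 + c * y)) * \<bar>0 + c * y\<bar> powr b) \<partial>lborel)"
        using c j nn_integral_real_affine[of "\<lambda>y. ennreal (norm (K j y) * \<bar>y\<bar> powr b)" c 0] by simp
      also have "\<dots> = c * (\<integral>\<^sup>+y. ennreal (c powr b / c) * ennreal (norm (kern \<rho> y) * \<bar>y\<bar> powr b) \<partial>lborel)"
        using c j False K_nonneg[of j]
        by (intro arg_cong2[where f="(*)"] nn_integral_cong refl)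
           (simp add: c_def[symmetric] ennreal_mult'[symmetric] norm_divide abs_mult powr_mult)
      also have "\<dots> = c * (ennreal (c powr b / c) * (\<integral>\<^sup>+y. ennreal (norm (kern \<rho> y) * \<bar>y\<bar> powr b) \<partial>lborel))"
        by (subst nn_integral_cmult) auto
      also have "(\<integral>\<^sup>+y. ennreal (norm (kern \<rho> y) * \<bar>y\<bar> powr b) \<partial>lborel) = ennreal A2"
        unfolding A2_def by (rule nn_integral_eq_integral[OF i2]) auto
      also have "c * (ennreal (c powr b / c) * ennreal A2) = ennreal (A2 * c powr b)"
        using c A by (simp add: ennreal_mult'[symmetric])
      also have "\<dots> \<le> ennreal ((A1 + A2 + 1) * 2 powr (- of_int j * exponent b j))"
        using A False by (intro ennreal_leI mult_mono) (auto simp: c_def exponent_def powr_powr)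
      finally show ?thesis using False by (simp add: exponent_def)
    qed
  qed (use A in auto)
qed

end



section \<open>Functions on the strip as tempered distributions\<close>

lemma fst_snd_borel_measurable [measurable]:
  "fst \<in> borel_measurable (borel :: (real \<times> real) measure)"
  "snd \<in> borel_measurable (borel :: (real \<times> real) measure)"
  by (auto intro!: borel_measurable_continuous_onI continuous_intros)

lemma Pair_borel_measurable [measurable (raw)]:
  assumes "f \<in> borel_measurable M" "g \<in> borel_measurable M"
  shows "(\<lambda>x. (f x, g x) :: real \<times> real) \<in> borel_measurable M"
  using assms by (rule borel_measurable_Pair)

lemma lborel_distr_reflect: "distr lborel borel (\<lambda>z. w - z) = (lborel :: 'a::euclidean_space measure)"
  using lborel_affine[of "-1" w] by (simp add: density_1)

lemma lborel_integral_reflect: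
  fixes f :: "'a::euclidean_space \<Rightarrow> 'b::{banach, second_countable_topology}"
  assumes [measurable]: "f \<in> borel_measurable borel"
  shows "(LINT z|lborel. f (w - z)) = (LINT z|lborel. f z)"
    "integrable lborel (\<lambda>z. f (w - z)) \<longleftrightarrow> integrable lborel f"
proof -
  have "(LINT z|lborel. f (w - z)) = (LINT z|distr lborel borel (\<lambda>z. w - z). f z)"
    by (subst integral_distr) auto
  then show "(LINT z|lborel. f (w - z)) = (LINT z|lborel. f z)" by (simp only: lborel_distr_reflect)
  have "integrable (distr lborel borel (\<lambda>z. w - z)) f \<longleftrightarrow> integrable lborel (\<lambda>z. f (w - z))"
    by (subst integrable_distr_eq) auto
  then show "integrable lborel (\<lambda>z. f (w - z)) \<longleftrightarrow> integrable lborel f" by (simp only: lborel_distr_reflect)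
qed

lemma integrable_prod_mult:
  fixes f h :: "'a::euclidean_space \<Rightarrow> complex"
  assumes f: "integrable lborel f" and h: "integrable lborel h"
  shows "integrable (lborel \<Otimes>\<^sub>M lborel) (\<lambda>(x, y). f x * h y)"
proof -
  have [measurable]: "f \<in> borel_measurable borel" "h \<in> borel_measurable borel"
    using f h borel_measurable_integrable by fastforce+
  show ?thesis
  proof (rule lborel_pair.Fubini_integrable)
    show "integrable lborel (\<lambda>x. LINT y|lborel. norm (case (x, y) of (x, y) \<Rightarrow> f x * h y))"
      using f by (simp add: norm_mult)
    show "AE x in lborel. integrable lborel (\<lambda>y. case (x, y) of (x, y) \<Rightarrow> f x * h y)"
      using h by (intro AE_I2) simp
  qed measurable
qed

lemma integral_lborel_prod_mult:
  fixes f h :: "real \<Rightarrow> complex"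
  assumes f: "integrable lborel f" and h: "integrable lborel h"
  shows "integrable lborel (\<lambda>z. f (fst z) * h (snd z))"
    "(LINT z|lborel. f (fst z) * h (snd z)) = (LINT x|lborel. f x) * (LINT y|lborel. h y)"
proof -
  note i = integrable_prod_mult[OF f h]
  show "integrable lborel (\<lambda>z. f (fst z) * h (snd z))"
    using i by (simp add: lborel_prod case_prod_unfold)
  have "(LINT z|lborel. f (fst z) * h (snd z)) = (LINT z|(lborel \<Otimes>\<^sub>M lborel). (case z of (x, y) \<Rightarrow> f x * h y))"
    by (simp add: lborel_prod case_prod_unfold)
  also have "\<dots> = (LINT x|lborel. LINT y|lborel. f x * h y)"
    using lborel_pair.integral_fst'[OF i] by simp
  finally show "(LINT z|lborel. f (fst z) * h (snd z)) = (LINT x|lborel. f x) * (LINT y|lborel. h y)"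
    by simp
qed

lemma pd_0_0 [simp]: "pd 0 0 f = f"
  by (simp add: pd_def)

lemma schwartzD:
  assumes "\<psi> \<in> schwartz"
  shows "((\<lambda>s. pd m n \<psi> (s, y)) has_vector_derivative pd (Suc m) n \<psi> (x, y)) (at x)"
    "((\<lambda>s. pd m n \<psi> (x, s)) has_vector_derivative pd m (Suc n) \<psi> (x, y)) (at y)"
    "bdd_above (range (\<lambda>z. (1 + norm z) ^ k * norm (pd m n \<psi> z)))"
  using assms unfolding schwartz_def mem_Collect_eq by (blast, blast, simp)

lemma bounded_vector_derivative_lipschitz:
  fixes f :: "real \<Rightarrow> complex"
  assumes "\<And>x. (f has_vector_derivative f' x) (at x)" "\<And>x. norm (f' x) \<le> B"
  shows "norm (f x - f y) \<le> B * norm (x - y)"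
proof (rule differentiable_bound[OF convex_UNIV])
  show "(f has_derivative (\<lambda>h. h *\<^sub>R f' x)) (at x within UNIV)" for x
    using assms(1) by (simp add: has_vector_derivative_def)
  show "onorm (\<lambda>h. h *\<^sub>R f' x) \<le> B" for x
    using assms(2)[of x] by (intro onorm_le) (metis mult.commute mult_right_mono norm_ge_zero norm_scaleR real_norm_def)
qed auto

text \<open>Provides measurability of test functions. The coordinates are changed one at a time,
  each change being controlled by a bounded partial derivative.\<close>

lemma schwartz_continuous:
  assumes "\<psi> \<in> schwartz"
  shows "continuous_on UNIV \<psi>"
proof -
  have d1: "((\<lambda>s. \<psi> (s, y)) has_vector_derivative pd 1 0 \<psi> (x, y)) (at x)"
    and d2: "((\<lambda>s. \<psi> (x, s)) has_vector_derivative pd 0 1 \<psi> (x, y)) (at y)" for x y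
    using schwartzD(1)[OF assms, of 0 0] schwartzD(2)[OF assms, of 0 0] by auto
  have "\<exists>B. \<forall>z. norm (pd m n \<psi> z) \<le> B" for m n
  proof -
    show ?thesis using schwartzD(3)[OF assms, of 0 m n] by (auto simp: bdd_above_def)
  qed
  then obtain B1 B2 where B: "\<And>z. norm (pd 1 0 \<psi> z) \<le> B1" "\<And>z. norm (pd 0 1 \<psi> z) \<le> B2" by metis
  have B0: "0 \<le> B1" "0 \<le> B2" using B order_trans[OF norm_ge_zero] by blast+
  have "(B1 + B2)-lipschitz_on UNIV \<psi>"
  proof (rule lipschitz_onI)
    fix z w :: "real \<times> real"
    obtain x y x' y' where zw: "z = (x, y)" "w = (x', y')" by (metis surj_pair)
    have "norm (\<psi> (x, y) - \<psi> (x', y)) \<le> B1 * norm (x - x')"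
      by (rule bounded_vector_derivative_lipschitz[OF d1 B(1)])
    moreover have "norm (\<psi> (x', y) - \<psi> (x', y')) \<le> B2 * norm (y - y')"
      by (rule bounded_vector_derivative_lipschitz[OF d2 B(2)])
    moreover have "norm (x - x') \<le> dist z w" "norm (y - y') \<le> dist z w"
      using dist_fst_le[of z w] dist_snd_le[of z w] by (auto simp: zw dist_norm)
    moreover have "dist (\<psi> z) (\<psi> w) \<le> norm (\<psi> (x, y) - \<psi> (x', y)) + norm (\<psi> (x', y) - \<psi> (x', y'))"
      using dist_triangle[of "\<psi> z" "\<psi> w" "\<psi> (x', y)"] by (simp add: zw dist_norm)
    moreover have "B1 * norm (x - x') \<le> B1 * dist z w" "B2 * norm (y - y') \<le> B2 * dist z w"
      using calculation B0 by (auto intro: mult_left_mono)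
    ultimately show "dist (\<psi> z) (\<psi> w) \<le> (B1 + B2) * dist z w"
      by (simp only: distrib_right)
  qed (use B0 in simp)
  then show ?thesis by (rule lipschitz_on_continuous_on)
qed

definition decay_weight :: "real \<times> real \<Rightarrow> real" where
  "decay_weight z = (1 / (1 + (fst z)\<^sup>2)) * (1 / (1 + (snd z)\<^sup>2))"

lemma decay_weight_nonneg: "0 \<le> decay_weight z"
  by (simp add: decay_weight_def)

lemma integrable_decay_weight: "integrable lborel decay_weight"
proof -
  have "integrable lborel (\<lambda>x::real. complex_of_real (1 / (1 + x\<^sup>2)))"
    by (intro integrable_of_real integrable_inverse_one_plus_square)
  from integral_lborel_prod_mult(1)[OF this this]
  have "integrable lborel (\<lambda>z. complex_of_real (decay_weight z))"
    by (simp add: decay_weight_def[abs_def])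
  then show ?thesis using complex_of_real_integrable_eq by blast
qed

text \<open>The order 4 comes from (1 + x^2)(1 + y^2) <= (1 + |z|)^4; the product form of the weight
  makes it integrable over the plane by Fubini.\<close>

lemma schwartz_le_decay_weight:
  assumes "\<psi> \<in> schwartz"
  shows "norm (\<psi> z) \<le> schwartz_norm 4 \<psi> * decay_weight z" "0 \<le> schwartz_norm 4 \<psi>"
proof -
  have bdd: "bdd_above (range (\<lambda>z. (1 + norm z) ^ 4 * norm (pd m n \<psi> z)))" for m n
    by (rule schwartzD(3)[OF assms])
  have nonneg: "0 \<le> (SUP z. (1 + norm z) ^ 4 * norm (pd m n \<psi> z))" for m n
    by (rule cSUP_upper2[OF bdd UNIV_I[of 0]]) simp
  have "(SUP z. (1 + norm z) ^ 4 * norm (pd 0 0 \<psi> z)) \<le> (\<Sum>n\<le>4. SUP z. (1 + norm z) ^ 4 * norm (pd 0 n \<psi> z))"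
    by (rule member_le_sum) (use nonneg in auto)
  also have "\<dots> \<le> schwartz_norm 4 \<psi>"
    unfolding schwartz_norm_def by (rule member_le_sum) (use nonneg in \<open>auto intro: sum_nonneg\<close>)
  finally have S: "(SUP z. (1 + norm z) ^ 4 * norm (pd 0 0 \<psi> z)) \<le> schwartz_norm 4 \<psi>" .
  then show S0: "0 \<le> schwartz_norm 4 \<psi>" using nonneg[of 0 0] by simp
  have "(1 + norm z) ^ 4 * norm (pd 0 0 \<psi> z) \<le> (SUP z. (1 + norm z) ^ 4 * norm (pd 0 0 \<psi> z))"
    by (rule cSUP_upper[OF UNIV_I bdd])
  then have *: "(1 + norm z) ^ 4 * norm (\<psi> z) \<le> schwartz_norm 4 \<psi>" using S by simp
  have sq: "1 + (fst z)\<^sup>2 \<le> (1 + norm z)\<^sup>2" "1 + (snd z)\<^sup>2 \<le> (1 + norm z)\<^sup>2"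
  proof -
    have "(fst z)\<^sup>2 \<le> (norm z)\<^sup>2" "(snd z)\<^sup>2 \<le> (norm z)\<^sup>2"
      using norm_fst_le[of "fst z" "snd z"] norm_snd_le[of "snd z" "fst z"] by (auto simp: abs_le_square_iff[symmetric])
    then show "1 + (fst z)\<^sup>2 \<le> (1 + norm z)\<^sup>2" "1 + (snd z)\<^sup>2 \<le> (1 + norm z)\<^sup>2"
      by (auto simp: power2_sum add_increasing2)
  qed
  have "(1 + (fst z)\<^sup>2) * (1 + (snd z)\<^sup>2) \<le> (1 + norm z)\<^sup>2 * (1 + norm z)\<^sup>2"
    by (intro mult_mono sq) auto
  also have "\<dots> = (1 + norm z) ^ 4" by (simp add: power_add[symmetric])
  finally have "(1 + (fst z)\<^sup>2) * (1 + (snd z)\<^sup>2) * norm (\<psi> z) \<le> schwartz_norm 4 \<psi>"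
    using * by (meson mult_right_mono norm_ge_zero order_trans)
  moreover have "0 < (1 + (fst z)\<^sup>2) * (1 + (snd z)\<^sup>2)"
    by (intro mult_pos_pos) (auto simp: add_pos_nonneg)
  ultimately show "norm (\<psi> z) \<le> schwartz_norm 4 \<psi> * decay_weight z"
    by (simp add: decay_weight_def pos_le_divide_eq mult.commute)
qed

lemma schwartz_measurable: "\<psi> \<in> schwartz \<Longrightarrow> \<psi> \<in> borel_measurable borel"
  by (intro borel_measurable_continuous_onI schwartz_continuous)

lemma schwartz_integrable:
  assumes "\<psi> \<in> schwartz"
  shows "integrable lborel \<psi>"
proof (rule Bochner_Integration.integrable_bound)
  show "integrable lborel (\<lambda>z. schwartz_norm 4 \<psi> * decay_weight z)"
    by (intro integrable_mult_right integrable_decay_weight)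
  show "AE z in lborel. norm (\<psi> z) \<le> norm (schwartz_norm 4 \<psi> * decay_weight z)"
    using schwartz_le_decay_weight[OF assms] by (intro AE_I2) (simp add: abs_mult decay_weight_nonneg)
qed (use schwartz_measurable[OF assms] in simp)

definition dist_of :: "(real \<times> real \<Rightarrow> complex) \<Rightarrow> dist2" where
  "dist_of g = (\<lambda>\<psi>. LINT z|lborel. g z * \<psi> z)"

lemma integrable_bounded_mult:
  fixes g \<psi> :: "'a::euclidean_space \<Rightarrow> complex"
  assumes "g \<in> borel_measurable borel" "\<And>z. norm (g z) \<le> C" "integrable lborel \<psi>"
  shows "integrable lborel (\<lambda>z. g z * \<psi> z)"
proof (rule Bochner_Integration.integrable_bound)
  show "integrable lborel (\<lambda>z. C * norm (\<psi> z))" using assms(3) by simp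
  have "0 \<le> C" using assms(2) norm_ge_zero order_trans by blast
  then show "AE z in lborel. norm (g z * \<psi> z) \<le> norm (C * norm (\<psi> z))"
    using assms(2) by (intro AE_I2) (auto simp: norm_mult intro!: mult_right_mono)
qed (use assms borel_measurable_integrable[OF assms(3)] in simp)

lemma represents_dist_of:
  assumes "g \<in> borel_measurable borel" "\<And>z. norm (g z) \<le> C"
  shows "represents g (dist_of g)"
  using integrable_bounded_mult[OF assms schwartz_integrable] by (simp add: represents_def dist_of_def)

lemma dist_of_tempered:
  assumes g: "g \<in> borel_measurable borel" "\<And>z. norm (g z) \<le> C"
  shows "dist_of g \<in> tempered"
  unfolding tempered_def
proof (intro CollectI conjI ballI allI exI)
  fix \<phi> \<psi> :: "real \<times> real \<Rightarrow> complex" and c assume "\<phi> \<in> schwartz" "\<psi> \<in> schwartz"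
  then have i: "integrable lborel (\<lambda>z. g z * \<phi> z)" "integrable lborel (\<lambda>z. g z * \<psi> z)"
    using integrable_bounded_mult[OF g schwartz_integrable] by auto
  have "dist_of g (\<lambda>z. c * \<phi> z + \<psi> z) = (LINT z|lborel. c * (g z * \<phi> z) + g z * \<psi> z)"
    unfolding dist_of_def by (intro Bochner_Integration.integral_cong) (auto simp: algebra_simps)
  then show "dist_of g (\<lambda>z. c * \<phi> z + \<psi> z) = c * dist_of g \<phi> + dist_of g \<psi>"
    using i by (simp add: dist_of_def)
next
  fix \<psi> assume \<psi>: "\<psi> \<in> schwartz"
  have C: "0 \<le> C" using g(2) norm_ge_zero order_trans by blast
  have "norm (dist_of g \<psi>) \<le> (LINT z|lborel. norm (g z * \<psi> z))"
    unfolding dist_of_def by (rule Bochner_Integration.integral_norm_bound)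
  also have "\<dots> \<le> (LINT z|lborel. C * (schwartz_norm 4 \<psi> * decay_weight z))"
  proof (rule integral_mono)
    show "integrable lborel (\<lambda>z. norm (g z * \<psi> z))"
      by (intro integrable_norm integrable_bounded_mult[OF g schwartz_integrable[OF \<psi>]])
    show "norm (g z * \<psi> z) \<le> C * (schwartz_norm 4 \<psi> * decay_weight z)" for z
      unfolding norm_mult using g(2) C schwartz_le_decay_weight(1)[OF \<psi>] by (intro mult_mono) auto
  qed (use integrable_decay_weight in simp)
  finally show "norm (dist_of g \<psi>) \<le> (C * (LINT z|lborel. decay_weight z)) * schwartz_norm 4 \<psi>"
    by (simp add: mult_ac)
qed

lemma dist_of_periodic2:
  assumes [measurable]: "g \<in> borel_measurable borel" and per: "\<And>x y. g (x, y + 2 * pi) = g (x, y)"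
  shows "periodic2 (dist_of g)"
  unfolding periodic2_def
proof
  fix \<psi> assume "\<psi> \<in> schwartz"
  then have [measurable]: "\<psi> \<in> borel_measurable borel" by (rule schwartz_measurable)
  have "dist_of g \<psi> = (LINT z|distr lborel borel ((+) (0, 2 * pi)). g z * \<psi> z)"
    by (simp add: dist_of_def lborel_distr_plus)
  also have "\<dots> = (LINT z|lborel. g ((0, 2 * pi) + z) * \<psi> ((0, 2 * pi) + z))"
    by (subst integral_distr) auto
  also have "\<dots> = dist_of g (\<lambda>(x, y). \<psi> (x, y + 2 * pi))"
    unfolding dist_of_def
  proof (intro Bochner_Integration.integral_cong refl)
    fix z :: "real \<times> real"
    show "g ((0, 2 * pi) + z) * \<psi> ((0, 2 * pi) + z) = g z * (case z of (x, y) \<Rightarrow> \<psi> (x, y + 2 * pi))"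
      using per[of "fst z" "snd z"] by (cases z) (simp add: add.commute)
  qed
  finally show "dist_of g (\<lambda>(x, y). \<psi> (x, y + 2 * pi)) = dist_of g \<psi>" ..
qed

lemma dist_support_dist_of:
  assumes "\<And>z. fst z \<notin> {0..T} \<Longrightarrow> g z = 0"
  shows "dist_support (dist_of g) \<subseteq> {0..T} \<times> UNIV"
proof -
  define U where "U = - ({0..T} \<times> (UNIV :: real set))"
  have "open U" unfolding U_def by (intro open_Compl closed_Times) auto
  moreover have "dist_of g \<psi> = 0" if "closure {z. \<psi> z \<noteq> 0} \<subseteq> U" for \<psi>
  proof -
    have "g z * \<psi> z = 0" for z
      using assms[of z] that closure_subset[of "{z. \<psi> z \<noteq> 0}"] by (auto simp: U_def)
    then have "(\<lambda>z. g z * \<psi> z) = (\<lambda>_. 0)" by (intro ext)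
    then show ?thesis by (simp only: dist_of_def Bochner_Integration.integral_zero)
  qed
  ultimately have "U \<subseteq> - dist_support (dist_of g)"
    unfolding dist_support_def by blast
  then show ?thesis by (auto simp: U_def)
qed

section \<open>Blocks of bounded functions as convolutions\<close>

context dyadic_decomposition
begin

text \<open>The convolution is written with the shift on g, so that g can be replaced by its
  increments under the integral.\<close>

definition block_fun :: "int \<Rightarrow> int \<Rightarrow> (real \<times> real \<Rightarrow> complex) \<Rightarrow> real \<times> real \<Rightarrow> complex" where
  "block_fun j k g w = (LINT z|lborel. K j (fst z) * K k (snd z) * g (w - z))"

lemma inv_fourier_block_symbol:
  assumes "-1 \<le> j" "-1 \<le> k"
  shows "(LINT \<xi>|lborel. cis (\<xi> \<bullet> v) * of_real (dyadic \<theta> \<rho> j (fst \<xi>) * dyadic \<theta> \<rho> k (snd \<xi>)))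
    = (2 * of_real pi)\<^sup>2 * (K j (fst v) * K k (snd v))"
proof -
  have i: "integrable lborel (\<lambda>x. cis (y * x) * of_real (dyadic \<theta> \<rho> j x))" if "-1 \<le> j" for j y
    using that by (intro integrable_bounded_mult[of _ 1] integrable_of_real dyadic_integrable) auto
  have "(LINT \<xi>|lborel. cis (\<xi> \<bullet> v) * of_real (dyadic \<theta> \<rho> j (fst \<xi>) * dyadic \<theta> \<rho> k (snd \<xi>)))
     = (LINT \<xi>|lborel. (cis (fst v * fst \<xi>) * of_real (dyadic \<theta> \<rho> j (fst \<xi>))) * (cis (snd v * snd \<xi>) * of_real (dyadic \<theta> \<rho> k (snd \<xi>))))"
    by (intro Bochner_Integration.integral_cong) (auto simp: inner_prod_def cis_mult[symmetric] mult_ac)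
  also have "\<dots> = (LINT x|lborel. cis (fst v * x) * of_real (dyadic \<theta> \<rho> j x)) * (LINT x|lborel. cis (snd v * x) * of_real (dyadic \<theta> \<rho> k x))"
    by (rule integral_lborel_prod_mult(2)[OF i i]) (use assms in auto)
  finally show ?thesis by (simp add: kern_def power2_eq_square)
qed

lemma K_prod_integrable:
  assumes "-1 \<le> j" "-1 \<le> k"
  shows "integrable lborel (\<lambda>z. K j (fst z) * K k (snd z))"
  using assms by (intro integral_lborel_prod_mult K_integrable)

text \<open>The block operator in its action on a test function. The symbol m is integrable, so the
  double integral over \<xi> and w converges absolutely; carrying out the frequency integral first
  leaves the product kernel at w - z.\<close>

lemma fourier_block:
  assumes jk: "-1 \<le> j" "-1 \<le> k" and \<psi>: "integrable lborel \<psi>"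
  shows "fourier (\<lambda>\<xi>. of_real (case \<xi> of (\<xi>1, \<xi>2) \<Rightarrow> dyadic \<theta> \<rho> j \<xi>1 * dyadic \<theta> \<rho> k \<xi>2) * inv_fourier \<psi> \<xi>) z
    = (LINT w|lborel. \<psi> w * (K j (fst (w - z)) * K k (snd (w - z))))"
proof -
  define m where "m \<xi> = complex_of_real (dyadic \<theta> \<rho> j (fst \<xi>) * dyadic \<theta> \<rho> k (snd \<xi>))" for \<xi> :: "real \<times> real"
  have [measurable]: "dyadic \<theta> \<rho> j \<in> borel_measurable borel" "dyadic \<theta> \<rho> k \<in> borel_measurable borel"
    using jk dyadic_measurable by auto
  have mm[measurable]: "m \<in> borel_measurable borel" unfolding m_def by measurable
  have mi: "integrable lborel m"
    using jk integral_lborel_prod_mult(1)[of "\<lambda>x. of_real (dyadic \<theta> \<rho> j x)" "\<lambda>x. of_real (dyadic \<theta> \<rho> k x)"]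
    by (simp add: m_def[abs_def] dyadic_integrable)
  have [measurable]: "\<psi> \<in> borel_measurable borel" using borel_measurable_integrable[OF \<psi>] by simp
  let ?G = "\<lambda>\<xi> w. cis (\<xi> \<bullet> (w - z)) * m \<xi> * \<psi> w"
  have "integrable (lborel \<Otimes>\<^sub>M lborel) (\<lambda>(\<xi>, w). ?G \<xi> w)"
    by (rule Bochner_Integration.integrable_bound[OF integrable_norm[OF integrable_prod_mult[OF mi \<psi>]]])
       (auto simp: norm_mult)
  then have swap: "(LINT \<xi>|lborel. LINT w|lborel. ?G \<xi> w) = (LINT w|lborel. LINT \<xi>|lborel. ?G \<xi> w)"
    by (rule lborel_pair.Fubini_integral[symmetric])
  have "fourier (\<lambda>\<xi>. of_real (case \<xi> of (\<xi>1, \<xi>2) \<Rightarrow> dyadic \<theta> \<rho> j \<xi>1 * dyadic \<theta> \<rho> k \<xi>2) * inv_fourier \<psi> \<xi>) z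
      = (LINT \<xi>|lborel. (LINT w|lborel. ?G \<xi> w) / (2 * of_real pi)\<^sup>2)"
    unfolding fourier_def
  proof (intro Bochner_Integration.integral_cong refl)
    fix \<xi> :: "real \<times> real"
    have "(LINT w|lborel. ?G \<xi> w) = (LINT w|lborel. (cis (- (\<xi> \<bullet> z)) * m \<xi>) * (cis (\<xi> \<bullet> w) * \<psi> w))"
      by (intro Bochner_Integration.integral_cong)
         (auto simp: inner_diff_right cis_mult[symmetric] cis_divide[symmetric] divide_inverse mult_ac)
    also have "\<dots> = (cis (- (\<xi> \<bullet> z)) * m \<xi>) * (LINT w|lborel. cis (\<xi> \<bullet> w) * \<psi> w)"
      by simp
    finally show "cis (- (\<xi> \<bullet> z)) * (of_real (case \<xi> of (\<xi>1, \<xi>2) \<Rightarrow> dyadic \<theta> \<rho> j \<xi>1 * dyadic \<theta> \<rho> k \<xi>2) * inv_fourier \<psi> \<xi>)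
        = (LINT w|lborel. ?G \<xi> w) / (2 * of_real pi)\<^sup>2"
      by (simp add: inv_fourier_def m_def case_prod_unfold)
  qed
  also have "\<dots> = (LINT w|lborel. LINT \<xi>|lborel. ?G \<xi> w) / (2 * of_real pi)\<^sup>2"
    by (simp add: swap)
  also have "(LINT w|lborel. LINT \<xi>|lborel. ?G \<xi> w)
      = (LINT w|lborel. (2 * of_real pi)\<^sup>2 * (\<psi> w * (K j (fst (w - z)) * K k (snd (w - z)))))"
  proof (intro Bochner_Integration.integral_cong refl)
    fix w
    have "(LINT \<xi>|lborel. ?G \<xi> w) = (LINT \<xi>|lborel. cis (\<xi> \<bullet> (w - z)) * m \<xi>) * \<psi> w" by simp
    then show "(LINT \<xi>|lborel. ?G \<xi> w) = (2 * of_real pi)\<^sup>2 * (\<psi> w * (K j (fst (w - z)) * K k (snd (w - z))))"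
      using inv_fourier_block_symbol[OF jk, of "w - z"] by (simp add: m_def)
  qed
  finally show ?thesis by simp
qed

lemma block_fun_measurable [measurable]:
  assumes "-1 \<le> j" "-1 \<le> k" "g \<in> borel_measurable borel"
  shows "block_fun j k g \<in> borel_measurable borel"
proof -
  have [measurable]: "K j \<in> borel_measurable borel" "K k \<in> borel_measurable borel" "g \<in> borel_measurable borel"
    using assms by auto
  show ?thesis unfolding block_fun_def by measurable
qed

text \<open>By definition the block acts on test functions. Boundedness of g and integrability of
  the kernel and of \<psi> justify Fubini, which moves the convolution from \<psi> to g.\<close>

lemma block_represented:
  assumes jk: "-1 \<le> j" "-1 \<le> k" and g[measurable]: "g \<in> borel_measurable borel" and C: "\<And>z. norm (g z) \<le> C"
  shows "represents (block_fun j k g) (block \<theta> \<rho> j k (dist_of g))"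
  unfolding represents_def
proof (intro ballI conjI)
  fix \<psi> assume "\<psi> \<in> schwartz"
  then have \<psi>: "integrable lborel \<psi>" and [measurable]: "\<psi> \<in> borel_measurable borel"
    using schwartz_integrable schwartz_measurable by auto
  define k2 where "k2 z = K j (fst z) * K k (snd z)" for z :: "real \<times> real"
  have ki: "integrable lborel k2" unfolding k2_def using jk by (rule K_prod_integrable)
  have km[measurable]: "k2 \<in> borel_measurable borel" using borel_measurable_integrable[OF ki] by simp
  \<comment> \<open>Reflection puts the shift on the kernel, the form in which Fubini produces the
    convolution.\<close>
  have bf: "block_fun j k g w = (LINT z|lborel. k2 (w - z) * g z)" for w
  proof -
    have "(\<lambda>z. k2 (w - z) * g z) \<in> borel_measurable borel" by measurable
    from lborel_integral_reflect(1)[OF this, of w] show ?thesis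
      unfolding block_fun_def k2_def[symmetric] by simp
  qed
  have kw: "integrable lborel (\<lambda>z. k2 (w - z))" for w
    using lborel_integral_reflect(2)[OF km] ki by simp
  have bd: "norm (block_fun j k g w) \<le> C * (LINT z|lborel. norm (k2 z))" for w
  proof -
    have "norm (block_fun j k g w) \<le> (LINT z|lborel. norm (k2 z * g (w - z)))"
      unfolding block_fun_def k2_def[symmetric] by (rule Bochner_Integration.integral_norm_bound)
    also have "\<dots> \<le> (LINT z|lborel. C * norm (k2 z))"
    proof (rule integral_mono)
      have "integrable lborel (\<lambda>z. g (w - z) * k2 z)"
        using C ki by (intro integrable_bounded_mult[of _ C]) auto
      then show "integrable lborel (\<lambda>z. norm (k2 z * g (w - z)))"
        by (simp add: mult.commute)
      show "norm (k2 z * g (w - z)) \<le> C * norm (k2 z)" for z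
        using mult_left_mono[OF C[of "w - z"], of "norm (k2 z)"] by (simp add: norm_mult mult.commute)
    qed (use ki in simp)
    finally show ?thesis by simp
  qed
  show "integrable lborel (\<lambda>z. block_fun j k g z * \<psi> z)"
    using jk bd \<psi> by (intro integrable_bounded_mult[OF _ bd]) auto
  have "block \<theta> \<rho> j k (dist_of g) \<psi> = (LINT z|lborel. g z * (LINT w|lborel. \<psi> w * k2 (w - z)))"
    unfolding block_def dist_inv_fourier_def dist_mult_def dist_fourier_def dist_of_def k2_def
    using fourier_block[OF jk \<psi>] by simp
  also have "\<dots> = (LINT z|lborel. LINT w|lborel. g z * (\<psi> w * k2 (w - z)))" by simp
  also have "\<dots> = (LINT w|lborel. LINT z|lborel. g z * (\<psi> w * k2 (w - z)))"
  proof (rule lborel_pair.Fubini_integral)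
    show "integrable (lborel \<Otimes>\<^sub>M lborel) (\<lambda>(w, z). g z * (\<psi> w * k2 (w - z)))"
    proof (rule lborel_pair.Fubini_integrable)
      have "integrable lborel (\<lambda>w. LINT z|lborel. norm (g z * (\<psi> w * k2 (w - z))))"
      proof (rule Bochner_Integration.integrable_bound)
        show "integrable lborel (\<lambda>w. C * (LINT z|lborel. norm (k2 z)) * norm (\<psi> w))" using \<psi> by simp
        show "AE w in lborel. norm (LINT z|lborel. norm (g z * (\<psi> w * k2 (w - z))))
            \<le> norm (C * (LINT z|lborel. norm (k2 z)) * norm (\<psi> w))"
        proof (rule AE_I2)
          fix w
          have "(LINT z|lborel. norm (g z * (\<psi> w * k2 (w - z)))) \<le> (LINT z|lborel. (C * norm (\<psi> w)) * norm (k2 (w - z)))"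
          proof (rule integral_mono)
            have "integrable lborel (\<lambda>z. g z * k2 (w - z))" by (intro integrable_bounded_mult[OF g C] kw)
            then have "integrable lborel (\<lambda>z. \<psi> w * (g z * k2 (w - z)))" by simp
            then show "integrable lborel (\<lambda>z. norm (g z * (\<psi> w * k2 (w - z))))"
              by (intro integrable_norm) (simp add: mult_ac)
            show "norm (g z * (\<psi> w * k2 (w - z))) \<le> (C * norm (\<psi> w)) * norm (k2 (w - z))" for z
              using mult_right_mono[OF C[of z], of "norm (\<psi> w) * norm (k2 (w - z))"] by (simp add: norm_mult mult.assoc)
          qed (use kw in simp)
          also have "\<dots> = (C * norm (\<psi> w)) * (LINT z|lborel. norm (k2 z))"
            using lborel_integral_reflect(1)[of "\<lambda>z. norm (k2 z)" w] by simp
          finally show "norm (LINT z|lborel. norm (g z * (\<psi> w * k2 (w - z))))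
              \<le> norm (C * (LINT z|lborel. norm (k2 z)) * norm (\<psi> w))"
            by (simp add: mult_ac)
        qed
      qed measurable
      then show "integrable lborel (\<lambda>w. LINT z|lborel. norm (case (w, z) of (w, z) \<Rightarrow> g z * (\<psi> w * k2 (w - z))))"
        by simp
      show "AE w in lborel. integrable lborel (\<lambda>z. case (w, z) of (w, z) \<Rightarrow> g z * (\<psi> w * k2 (w - z)))"
      proof (rule AE_I2)
        fix w
        have "integrable lborel (\<lambda>z. g z * k2 (w - z))" by (intro integrable_bounded_mult[OF g C] kw)
        then have "integrable lborel (\<lambda>z. \<psi> w * (g z * k2 (w - z)))" by simp
        then show "integrable lborel (\<lambda>z. case (w, z) of (w, z) \<Rightarrow> g z * (\<psi> w * k2 (w - z)))"
          by (simp add: mult_ac)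
      qed
    qed measurable
  qed
  also have "\<dots> = (LINT w|lborel. block_fun j k g w * \<psi> w)"
  proof (intro Bochner_Integration.integral_cong refl)
    fix w
    have "(LINT z|lborel. g z * (\<psi> w * k2 (w - z))) = (LINT z|lborel. (k2 (w - z) * g z) * \<psi> w)"
      by (intro Bochner_Integration.integral_cong) auto
    then show "(LINT z|lborel. g z * (\<psi> w * k2 (w - z))) = block_fun j k g w * \<psi> w"
      by (simp add: bf)
  qed
  finally show "block \<theta> \<rho> j k (dist_of g) \<psi> = (LINT z|lborel. block_fun j k g z * \<psi> z)" .
qed

text \<open>A switch: 1 where the kernel has mean zero and an increment may be taken in that
  variable, 0 for the low-frequency kernel.\<close>

definition detail :: "int \<Rightarrow> complex" where
  "detail j = (if j = -1 then 0 else 1)"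

text \<open>With both switches on this is a rectangular increment, with one on an increment in one
  variable, and with both off the value of g at w - z.\<close>

definition increment :: "complex \<Rightarrow> complex \<Rightarrow> (real \<times> real \<Rightarrow> complex) \<Rightarrow> real \<times> real \<Rightarrow> real \<times> real \<Rightarrow> complex" where
  "increment c1 c2 g w z = (g (w - z) - c1 * g (fst w, snd w - snd z))
     - c2 * (g (fst w - fst z, snd w) - c1 * g w)"

lemma detail_K_integral:
  assumes "-1 \<le> j"
  shows "detail j * (LINT x|lborel. K j x) = 0"
  using assms K_integral_eq_0[of j] by (simp add: detail_def)

text \<open>The kernels of the blocks with positive index have mean zero, so the values of \<open>g\<close> may be
  replaced by increments.\<close>

lemma block_fun_increment:
  assumes jk: "-1 \<le> j" "-1 \<le> k" and g[measurable]: "g \<in> borel_measurable borel" and C: "\<And>z. norm (g z) \<le> C"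
  shows "block_fun j k g w = (LINT z|lborel. K j (fst z) * K k (snd z) * increment (detail j) (detail k) g w z)"
proof -
  have Ki: "integrable lborel (K j)" "integrable lborel (K k)" using jk by (auto intro: K_integrable)
  have [measurable]: "K j \<in> borel_measurable borel" "K k \<in> borel_measurable borel" using jk by auto
  have i1: "integrable lborel (\<lambda>s. K j s * g (fst w - s, snd w))"
    using integrable_bounded_mult[of "\<lambda>s. g (fst w - s, snd w)" C, OF _ C Ki(1)] by (simp add: mult.commute)
  have i2: "integrable lborel (\<lambda>y. K k y * g (fst w, snd w - y))"
    using integrable_bounded_mult[of "\<lambda>y. g (fst w, snd w - y)" C, OF _ C Ki(2)] by (simp add: mult.commute)
  have i: "integrable lborel (\<lambda>z. K j (fst z) * K k (snd z) * g (w - z))"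
    using integrable_bounded_mult[of "\<lambda>z. g (w - z)" C, OF _ C K_prod_integrable[OF jk]] by (simp add: mult.commute)
  note p1 = integral_lborel_prod_mult[OF Ki(1) i2]
  note p2 = integral_lborel_prod_mult[OF i1 Ki(2)]
  note p3 = integral_lborel_prod_mult[OF Ki]
  have "(LINT z|lborel. K j (fst z) * K k (snd z) * increment (detail j) (detail k) g w z)
      = (LINT z|lborel. (K j (fst z) * K k (snd z) * g (w - z)
          - detail j * (K j (fst z) * (K k (snd z) * g (fst w, snd w - snd z))))
          - (detail k * ((K j (fst z) * g (fst w - fst z, snd w)) * K k (snd z))
             - (detail k * detail j * g w) * (K j (fst z) * K k (snd z))))"
    by (intro Bochner_Integration.integral_cong) (auto simp: increment_def algebra_simps)
  also have "\<dots> = block_fun j k g w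
      - detail j * ((LINT s|lborel. K j s) * (LINT y|lborel. K k y * g (fst w, snd w - y)))
      - (detail k * ((LINT s|lborel. K j s * g (fst w - s, snd w)) * (LINT y|lborel. K k y))
         - (detail k * detail j * g w) * ((LINT s|lborel. K j s) * (LINT y|lborel. K k y)))"
    using i p1 p2 p3 by (simp add: block_fun_def)
  also have "\<dots> = block_fun j k g w
      - (detail j * (LINT s|lborel. K j s)) * (LINT y|lborel. K k y * g (fst w, snd w - y))
      - ((LINT s|lborel. K j s * g (fst w - s, snd w)) * (detail k * (LINT y|lborel. K k y))
         - (detail j * (LINT s|lborel. K j s)) * g w * (detail k * (LINT y|lborel. K k y)))"
    by (simp add: mult_ac)
  finally show ?thesis using detail_K_integral jk by simp
qed

end


section \<open>Minkowski's inequality in weighted form\<close>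

text \<open>Jensen's inequality for the power Suc n and the finite measure with density d. It is
  derived from tangents to the power function, which also covers infinite values of the right-hand
  side.\<close>

lemma weighted_power_mean:
  fixes d :: "'a \<Rightarrow> ennreal" and h :: "'a \<Rightarrow> real"
  assumes [measurable]: "d \<in> borel_measurable V" "h \<in> borel_measurable V"
    and h: "\<And>v. 0 \<le> h v" and A: "(\<integral>\<^sup>+v. d v \<partial>V) \<noteq> \<top>"
  shows "(\<integral>\<^sup>+v. d v * ennreal (h v) \<partial>V) ^ Suc n
    \<le> (\<integral>\<^sup>+v. d v \<partial>V) ^ n * (\<integral>\<^sup>+v. d v * ennreal (h v ^ Suc n) \<partial>V)"
proof -
  define I where "I = (\<integral>\<^sup>+v. d v * ennreal (h v) \<partial>V)"
  define J where "J = (\<integral>\<^sup>+v. d v * ennreal (h v ^ Suc n) \<partial>V)"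
  obtain A where A': "(\<integral>\<^sup>+v. d v \<partial>V) = ennreal A" "0 \<le> A" using A by (cases "\<integral>\<^sup>+v. d v \<partial>V") auto
  show ?thesis
  proof (cases "A = 0 \<or> J = \<top>")
    case True
    show ?thesis
    proof (cases "A = 0")
      case True
      then have "AE v in V. d v = 0" using A' by (simp add: nn_integral_0_iff_AE)
      then have "I = (\<integral>\<^sup>+v. 0 \<partial>V)"
        unfolding I_def by (intro nn_integral_cong_AE) auto
      then show ?thesis by (simp add: I_def[symmetric])
    next
      case False
      then have "J = \<top>" "ennreal A ^ n \<noteq> 0" using \<open>A = 0 \<or> J = \<top>\<close> A' by auto
      then show ?thesis unfolding J_def[symmetric] A'(1) by (auto simp: ennreal_mult_top)
    qed
  next
    case False
    then have "0 < A" using A' by simp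
    obtain Jr where J: "J = ennreal Jr" "0 \<le> Jr" using False by (cases J) auto
    \<comment> \<open>The graph of the power Suc n lies above its tangent at c; this is Bernoulli's
      inequality for h v / c - 1, scaled by c to the power Suc n.\<close>
    have young: "real (Suc n) * c ^ n * h v \<le> h v ^ Suc n + real n * c ^ Suc n" if "0 < c" for c v
    proof -
      have "1 + real (Suc n) * (h v / c - 1) \<le> (1 + (h v / c - 1)) ^ Suc n"
        using h[of v] that by (intro Bernoulli_inequality) auto
      then have "c ^ Suc n * (1 + real (Suc n) * (h v / c - 1)) \<le> c ^ Suc n * (h v / c) ^ Suc n"
        using that by (intro mult_left_mono) auto
      also have "\<dots> = h v ^ Suc n"
        using that by (simp add: power_divide)
      also have "c ^ Suc n * (1 + real (Suc n) * (h v / c - 1)) = real (Suc n) * c ^ n * h v - real n * c ^ Suc n"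
        using that by (simp add: field_simps)
      finally show ?thesis by linarith
    qed
    have int: "ennreal (real (Suc n) * c ^ n) * I \<le> J + ennreal (real n * c ^ Suc n) * ennreal A" if "0 < c" for c
    proof -
      have "ennreal (real (Suc n) * c ^ n) * I = (\<integral>\<^sup>+v. d v * ennreal (real (Suc n) * c ^ n * h v) \<partial>V)"
      proof -
        have "d v * ennreal (k * h v) = ennreal k * (d v * ennreal (h v))" if "0 \<le> k" for k v
          using that h by (simp add: ennreal_mult mult_ac)
        then show ?thesis
          unfolding I_def using that by (subst nn_integral_cmult[symmetric]) (auto simp del: of_nat_Suc)
      qed
      also have "\<dots> \<le> (\<integral>\<^sup>+v. d v * ennreal (h v ^ Suc n + real n * c ^ Suc n) \<partial>V)"
        by (intro nn_integral_mono mult_left_mono ennreal_leI young that) auto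
      also have "\<dots> = (\<integral>\<^sup>+v. d v * ennreal (h v ^ Suc n) + ennreal (real n * c ^ Suc n) * d v \<partial>V)"
        using that h by (intro nn_integral_cong) (simp add: ennreal_plus distrib_left mult_ac del: power_Suc)
      also have "\<dots> = J + ennreal (real n * c ^ Suc n) * ennreal A"
        unfolding J_def A'(1)[symmetric] by (subst nn_integral_add) (auto simp: nn_integral_cmult)
      finally show ?thesis .
    qed
    \<comment> \<open>Any fixed c shows finiteness of I; afterwards c may be chosen depending on
      I.\<close>
    have "I \<noteq> \<top>"
    proof
      assume "I = \<top>"
      then have "\<top> \<le> J + ennreal (real n * 1 ^ Suc n) * ennreal A"
        using int[of 1] by (simp add: ennreal_mult_top del: of_nat_Suc)
      then show False using J A' by (simp add: top_unique ennreal_mult[symmetric] ennreal_plus[symmetric] del: ennreal_plus)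
    qed
    then obtain Ir where I: "I = ennreal Ir" "0 \<le> Ir" by (cases I) auto
    have "Ir ^ Suc n \<le> A ^ n * Jr"
    proof (cases "Ir = 0")
      case True
      then show ?thesis using A' J by simp
    next
      case False
      then have Ir: "0 < Ir" using I by simp
      \<comment> \<open>The tangent point is the mean of h with respect to the density d, for which
        the tangent bound is sharpest.\<close>
      define c where "c = Ir / A"
      have c: "0 < c" using Ir \<open>0 < A\<close> by (simp add: c_def)
      have "ennreal (real (Suc n) * c ^ n * Ir) \<le> ennreal (Jr + real n * c ^ Suc n * A)"
        using int[OF c] I J A' c
        by (simp add: ennreal_mult[symmetric] ennreal_plus[symmetric] del: ennreal_plus power_Suc of_nat_Suc)
      then have "real (Suc n) * c ^ n * Ir \<le> Jr + real n * c ^ Suc n * A"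
        using J A' c by (subst (asm) ennreal_le_iff) auto
      moreover have "c ^ Suc n * A = c ^ n * Ir" using \<open>0 < A\<close> by (simp add: c_def)
      then have "real n * c ^ Suc n * A = real n * (c ^ n * Ir)" by (simp only: mult.assoc)
      moreover have "real (Suc n) * c ^ n * Ir = c ^ n * Ir + real n * (c ^ n * Ir)" by (simp add: algebra_simps)
      ultimately have "c ^ n * Ir \<le> Jr" by linarith
      then have "A ^ n * (c ^ n * Ir) \<le> A ^ n * Jr" using A' by (intro mult_left_mono) auto
      moreover have "A ^ n * (c ^ n * Ir) = Ir ^ Suc n" using \<open>0 < A\<close> by (simp add: c_def power_divide)
      ultimately show ?thesis by simp
    qed
    then show ?thesis
      using I J A' by (simp add: I_def[symmetric] J_def[symmetric] ennreal_power[symmetric] ennreal_mult[symmetric] ennreal_leI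
          del: power_Suc ennreal_power) (simp add: ennreal_power ennreal_mult[symmetric] ennreal_leI)
  qed
qed

text \<open>Write D as W times D/W. The power mean inequality with density \<kappa> W gives a factor
  A to the power p - 1, and after Tonelli the N-integral of (D/W)^p is at most C for almost every
  v.\<close>

lemma minkowski_weighted:
  fixes \<kappa> :: "'a \<Rightarrow> real" and W :: "'a \<Rightarrow> real" and D :: "'b \<Rightarrow> 'a \<Rightarrow> real"
  assumes "sigma_finite_measure N" "sigma_finite_measure V"
    and [measurable]: "\<kappa> \<in> borel_measurable V" "W \<in> borel_measurable V"
      "(\<lambda>(n, v). D n v) \<in> borel_measurable (N \<Otimes>\<^sub>M V)"
    and pos: "\<And>v. 0 \<le> \<kappa> v" "AE v in V. 0 < W v" "\<And>n v. 0 \<le> D n v" and p: "0 < p"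
    and bound: "AE v in V. (\<integral>\<^sup>+n. ennreal (D n v ^ p) \<partial>N) \<le> ennreal (C * W v ^ p)" and C: "0 \<le> C"
    and fin: "(\<integral>\<^sup>+v. ennreal (\<kappa> v * W v) \<partial>V) \<le> ennreal A" "0 \<le> A"
  shows "(\<integral>\<^sup>+n. (\<integral>\<^sup>+v. ennreal (\<kappa> v * D n v) \<partial>V) ^ p \<partial>N) \<le> ennreal (C * A ^ p)"
proof -
  interpret N: sigma_finite_measure N by fact
  interpret V: sigma_finite_measure V by fact
  interpret NV: pair_sigma_finite N V ..
  obtain n where pn: "p = Suc n" using p by (cases p) auto
  define d where "d v = ennreal (\<kappa> v * W v)" for v
  have [measurable]: "d \<in> borel_measurable V" unfolding d_def by measurable
  have Dm[measurable]: "D m \<in> borel_measurable V" if "m \<in> space N" for m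
    using measurable_Pair2[OF assms(5) that] by simp
  have dfin: "(\<integral>\<^sup>+v. d v \<partial>V) \<le> ennreal A" using fin by (simp add: d_def)
  have pt: "(\<integral>\<^sup>+v. ennreal (\<kappa> v * D m v) \<partial>V) ^ p \<le> ennreal (A ^ n) * (\<integral>\<^sup>+v. d v * ennreal ((D m v / W v) ^ p) \<partial>V)"
    if m: "m \<in> space N" for m
  proof -
    have [measurable]: "D m \<in> borel_measurable V" by (rule Dm[OF m])
    have "(\<integral>\<^sup>+v. ennreal (\<kappa> v * D m v) \<partial>V) = (\<integral>\<^sup>+v. d v * ennreal (\<bar>D m v / W v\<bar>) \<partial>V)"
      using pos(2) by (intro nn_integral_cong_AE) (elim eventually_mono, use pos in \<open>simp add: d_def ennreal_mult'[symmetric]\<close>)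
    also have "\<dots> ^ p \<le> (\<integral>\<^sup>+v. d v \<partial>V) ^ n * (\<integral>\<^sup>+v. d v * ennreal (\<bar>D m v / W v\<bar> ^ p) \<partial>V)"
      unfolding pn using dfin by (intro weighted_power_mean) (auto simp: top_unique)
    also have "(\<integral>\<^sup>+v. d v * ennreal (\<bar>D m v / W v\<bar> ^ p) \<partial>V) = (\<integral>\<^sup>+v. d v * ennreal ((D m v / W v) ^ p) \<partial>V)"
      using pos(2) by (intro nn_integral_cong_AE) (elim eventually_mono, use pos in simp)
    also have "(\<integral>\<^sup>+v. d v \<partial>V) ^ n \<le> ennreal (A ^ n)"
      using power_mono[OF dfin, of n] fin by (simp add: ennreal_power)
    finally show ?thesis by (simp add: mult_right_mono)
  qed
  have "(\<integral>\<^sup>+n. (\<integral>\<^sup>+v. ennreal (\<kappa> v * D n v) \<partial>V) ^ p \<partial>N)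
      \<le> (\<integral>\<^sup>+m. ennreal (A ^ n) * (\<integral>\<^sup>+v. d v * ennreal ((D m v / W v) ^ p) \<partial>V) \<partial>N)"
    by (intro nn_integral_mono pt)
  also have "\<dots> = ennreal (A ^ n) * (\<integral>\<^sup>+m. \<integral>\<^sup>+v. d v * ennreal ((D m v / W v) ^ p) \<partial>V \<partial>N)"
    by (rule nn_integral_cmult) measurable
  also have "(\<integral>\<^sup>+m. \<integral>\<^sup>+v. d v * ennreal ((D m v / W v) ^ p) \<partial>V \<partial>N)
      = (\<integral>\<^sup>+v. \<integral>\<^sup>+m. d v * ennreal ((D m v / W v) ^ p) \<partial>N \<partial>V)"
    by (rule NV.Fubini'[symmetric]) measurable
  also have "\<dots> \<le> (\<integral>\<^sup>+v. d v * ennreal C \<partial>V)"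
  proof (rule nn_integral_mono_AE, use pos(2) bound AE_space in eventually_elim)
    case (elim v)
    have [measurable]: "(\<lambda>m. D m v) \<in> borel_measurable N"
      using measurable_Pair1[OF assms(5) elim(3)] by simp
    have "(\<integral>\<^sup>+m. d v * ennreal ((D m v / W v) ^ p) \<partial>N) = (\<integral>\<^sup>+m. (d v * ennreal (1 / W v ^ p)) * ennreal (D m v ^ p) \<partial>N)"
      using elim pos by (intro nn_integral_cong) (simp add: mult.assoc ennreal_mult'[symmetric] power_divide)
    also have "\<dots> = (d v * ennreal (1 / W v ^ p)) * (\<integral>\<^sup>+m. ennreal (D m v ^ p) \<partial>N)"
      by (rule nn_integral_cmult) measurable
    also have "\<dots> \<le> (d v * ennreal (1 / W v ^ p)) * ennreal (C * W v ^ p)"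
      by (intro mult_left_mono elim) auto
    also have "\<dots> = d v * ennreal C"
      using elim C by (simp add: mult.assoc ennreal_mult'[symmetric])
    finally show ?case .
  qed
  also have "(\<integral>\<^sup>+v. d v * ennreal C \<partial>V) = (\<integral>\<^sup>+v. d v \<partial>V) * ennreal C"
    by (rule nn_integral_multc) measurable
  also have "\<dots> \<le> ennreal A * ennreal C" using dfin by (rule mult_right_mono) simp
  also have "ennreal (A ^ n) * (ennreal A * ennreal C) = ennreal (C * A ^ p)"
    using fin C by (simp add: pn ennreal_mult'[symmetric] mult_ac)
  finally show ?thesis by (simp add: mult_left_mono)
qed

text \<open>Rounding the point to a grid leaves countably many values, so the rounded field is
  jointly measurable; continuity in the point gives the limit as the mesh tends to 0.\<close>

lemma caratheodory_measurable:
  fixes U :: "'w \<Rightarrow> real \<times> real \<Rightarrow> real"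
  assumes cont: "\<And>\<omega>. \<omega> \<in> space M \<Longrightarrow> continuous_on UNIV (U \<omega>)"
    and meas[measurable]: "\<And>z. (\<lambda>\<omega>. U \<omega> z) \<in> borel_measurable M"
  shows "(\<lambda>(\<omega>, z). U \<omega> z) \<in> borel_measurable (M \<Otimes>\<^sub>M borel)"
proof -
  define r where "r n x = real_of_int \<lfloor>real (Suc n) * x\<rfloor> / real (Suc n)" for n x
  have r: "(\<lambda>n. r n x) \<longlonglongrightarrow> x" for x
  proof (rule LIMSEQ_I)
    fix e :: real assume "0 < e"
    then obtain N where N: "inverse (real (Suc N)) < e" using reals_Archimedean by blast
    show "\<exists>no. \<forall>n\<ge>no. norm (r n x - x) < e"
    proof (intro exI[of _ N] allI impI)
      fix n assume "N \<le> n"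
      have "norm (r n x - x) = \<bar>real_of_int \<lfloor>real (Suc n) * x\<rfloor> - real (Suc n) * x\<bar> / real (Suc n)"
        unfolding r_def real_norm_def by (subst abs_of_nat[of "Suc n", where 'a=real, symmetric], subst abs_divide[symmetric])
          (simp add: diff_divide_distrib del: of_nat_Suc)
      also have "\<dots> \<le> 1 / real (Suc n)"
        by (intro divide_right_mono) linarith+
      also have "\<dots> \<le> inverse (real (Suc N))" using \<open>N \<le> n\<close> by (simp add: inverse_eq_divide frac_le)
      finally show "norm (r n x - x) < e" using N by simp
    qed
  qed
  define V where "V n \<omega>z = U (fst \<omega>z) (r n (fst (snd \<omega>z)), r n (snd (snd \<omega>z)))" for n \<omega>z
  have [measurable]: "V n \<in> borel_measurable (M \<Otimes>\<^sub>M borel)" for n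
  proof -
    define f where "f ab \<omega>z = U (fst \<omega>z) (real_of_int (fst ab) / real (Suc n), real_of_int (snd ab) / real (Suc n))"
      for ab :: "int \<times> int" and \<omega>z :: "'w \<times> real \<times> real"
    define g where "g \<omega>z = (\<lfloor>real (Suc n) * fst (snd \<omega>z)\<rfloor>, \<lfloor>real (Suc n) * snd (snd \<omega>z)\<rfloor>)" for \<omega>z :: "'w \<times> real \<times> real"
    have "(\<lambda>\<omega>z. f (g \<omega>z) \<omega>z) \<in> borel_measurable (M \<Otimes>\<^sub>M borel)"
    proof (rule measurable_compose_countable)
      show "f i \<in> borel_measurable (M \<Otimes>\<^sub>M borel)" for i unfolding f_def by measurable
      have "g \<in> M \<Otimes>\<^sub>M borel \<rightarrow>\<^sub>M count_space UNIV \<Otimes>\<^sub>M count_space UNIV"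
        unfolding g_def by measurable
      then show "g \<in> M \<Otimes>\<^sub>M borel \<rightarrow>\<^sub>M count_space UNIV" by (simp add: pair_measure_countable)
    qed
    moreover have "(\<lambda>\<omega>z. f (g \<omega>z) \<omega>z) = V n"
      by (rule ext) (simp only: f_def g_def V_def r_def fst_conv snd_conv)
    ultimately show ?thesis by (simp only:)
  qed
  have "(\<lambda>\<omega>z. U (fst \<omega>z) (snd \<omega>z)) \<in> borel_measurable (M \<Otimes>\<^sub>M borel)"
  proof (rule borel_measurable_LIMSEQ_real)
    fix \<omega>z assume "\<omega>z \<in> space (M \<Otimes>\<^sub>M (borel :: (real \<times> real) measure))"
    then have "isCont (U (fst \<omega>z)) (snd \<omega>z)"
      using cont by (auto simp: space_pair_measure continuous_on_eq_continuous_at)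
    moreover have "(\<lambda>n. (r n (fst (snd \<omega>z)), r n (snd (snd \<omega>z)))) \<longlonglongrightarrow> snd \<omega>z"
      using tendsto_Pair[OF r[of "fst (snd \<omega>z)"] r[of "snd (snd \<omega>z)"]] by simp
    ultimately show "(\<lambda>n. V n \<omega>z) \<longlonglongrightarrow> U (fst \<omega>z) (snd \<omega>z)"
      unfolding V_def by (rule isCont_tendsto_compose)
  qed measurable
  then show ?thesis by (simp add: case_prod_unfold)
qed

section \<open>A sufficient condition for finite Besov norm\<close>

lemma ennreal_rpow_mono: "x \<le> y \<Longrightarrow> 0 < r \<Longrightarrow> ennreal_rpow x r \<le> ennreal_rpow y r"
  unfolding ennreal_rpow_def
  by (auto simp: top_unique less_top[symmetric] intro!: ennreal_leI powr_mono2 enn2real_mono)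

lemma ennreal_rpow_one [simp]: "ennreal_rpow x 1 = x"
  by (cases x) (auto simp: ennreal_rpow_def)

lemma ennreal_rpow_inverse:
  assumes "0 < q"
  shows "ennreal_rpow (ennreal_rpow x (1 / q)) q = x"
  using assms by (cases x) (auto simp: ennreal_rpow_def powr_powr)

lemma ennreal_rpow_less_top: "ennreal_rpow x r < \<top> \<longleftrightarrow> x < \<top>"
  by (cases "x = \<top>") (auto simp: ennreal_rpow_def less_top)

lemma ennreal_rpow_cmult:
  assumes "0 < c"
  shows "ennreal_rpow (ennreal c * x) q = ennreal (c powr q) * ennreal_rpow x q"
  using assms by (cases x)
    (auto simp: ennreal_rpow_def ennreal_mult[symmetric] powr_mult ennreal_mult_top ennreal_mult_eq_top_iff)

text \<open>Let n be the p-th root of x. If n <= s then n^q <= s^q; otherwise n^q = n^(q - p) n^p,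
  and the exponent q - p is not positive, so n may be replaced by s in the first factor.\<close>

lemma ennreal_rpow_split:
  assumes "0 < s" "0 < q" "q \<le> p"
  shows "ennreal_rpow (ennreal_rpow x (1 / p)) q \<le> ennreal (s powr q) + ennreal (s powr (q - p)) * x"
proof (cases x)
  case (real v)
  define n where "n = v powr (1 / p)"
  have n: "0 \<le> n" "n powr p = v" using real assms by (auto simp: n_def powr_powr)
  have "n powr q \<le> s powr q + s powr (q - p) * v"
  proof (cases "n \<le> s")
    case True
    then have "n powr q \<le> s powr q" using n assms by (intro powr_mono2) auto
    then show ?thesis using real by (simp add: add_increasing2)
  next
    case False
    have "n powr q = n powr (q - p) * n powr p" by (simp add: powr_add[symmetric])
    also have "\<dots> \<le> s powr (q - p) * n powr p"
      using False assms by (intro mult_right_mono powr_mono2') auto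
    finally show ?thesis using n by (simp add: add_increasing)
  qed
  then have "ennreal (n powr q) \<le> ennreal (s powr q + s powr (q - p) * v)" by (rule ennreal_leI)
  then show ?thesis using real by (simp add: ennreal_rpow_def n_def ennreal_mult ennreal_plus)
next
  case top
  then show ?thesis using assms by (simp add: ennreal_mult_top)
qed

lemma lq_norm_weighted_power:
  assumes "0 < q" "\<And>j. 0 < c j"
  shows "ennreal_rpow (lq_norm q (\<lambda>j. ennreal (c j) * a j)) q
    = (\<Sum>i. ennreal (c (int i - 1) powr q) * ennreal_rpow (a (int i - 1)) q)"
  using assms by (simp add: lq_norm_def ennreal_rpow_inverse ennreal_rpow_cmult)

context dyadic_decomposition
begin

text \<open>The p-th power of the mixed norm of the block: linear in the p-th powers of pointwise
  values, hence its expectation can be taken under the integrals.\<close>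

definition block_energy :: "real \<Rightarrow> (real \<times> real \<Rightarrow> complex) \<Rightarrow> int \<Rightarrow> int \<Rightarrow> ennreal" where
  "block_energy p g j k = (\<integral>\<^sup>+x1. (\<integral>\<^sup>+x2\<in>{-pi..pi}. ennreal (norm (block_fun j k g (x1, x2)) powr p) \<partial>lborel) \<partial>lborel)"

definition scale :: "real \<Rightarrow> real \<Rightarrow> int \<Rightarrow> int \<Rightarrow> real" where
  "scale b1 b2 j k = 2 powr (- of_int j * exponent b1 j) * 2 powr (- of_int k * exponent b2 k)"

text \<open>\<open>x powr q\<close> is replaced by \<open>s powr q + s powr (q - p) * x powr p\<close> with \<open>s\<close> the expected size of the
  block, so that only \<open>p\<close>-th moments are needed.\<close>

definition besov_bound ::
  "real \<times> real \<Rightarrow> real \<Rightarrow> real \<Rightarrow> real \<Rightarrow> real \<Rightarrow> (real \<times> real \<Rightarrow> complex) \<Rightarrow> ennreal" where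
  "besov_bound \<alpha> p q b1 b2 g =
     (\<Sum>i. ennreal ((2 powr (fst \<alpha> * of_int (int i - 1))) powr q) *
       (\<Sum>l. ennreal ((2 powr (snd \<alpha> * of_int (int l - 1))) powr q) *
         (ennreal (scale b1 b2 (int i - 1) (int l - 1) powr q)
          + ennreal (scale b1 b2 (int i - 1) (int l - 1) powr (q - p)) * block_energy p g (int i - 1) (int l - 1))))"

text \<open>The norm of a block is an infimum over representatives, so the explicit convolution
  bounds it from above; then q-th powers are split at the sizes \<open>scale\<close>.\<close>

lemma besov_norm_finite:
  assumes q: "0 < q" "q \<le> p" and g: "g \<in> borel_measurable borel" "\<And>z. norm (g z) \<le> C"
    and fin: "besov_bound \<alpha> p q b1 b2 g < \<top>"
  shows "besov_norm \<theta> \<rho> \<alpha> (p, p) (q, q) (dist_of g) < \<top>"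
proof -
  have p: "0 < p" using q by simp
  define n where "n j k = dist_mixed_norm (p, p) (block \<theta> \<rho> j k (dist_of g))" for j k
  have n_le: "ennreal_rpow (n j k) q \<le> ennreal (scale b1 b2 j k powr q) + ennreal (scale b1 b2 j k powr (q - p)) * block_energy p g j k"
    if "-1 \<le> j" "-1 \<le> k" for j k
  proof -
    have "n j k \<le> mixed_norm (p, p) (block_fun j k g)"
      unfolding n_def dist_mixed_norm_def
      using that g by (intro INF_lower) (auto intro: block_represented[OF that g])
    also have "\<dots> = ennreal_rpow (block_energy p g j k) (1 / p)"
      using p by (simp add: mixed_norm_def block_energy_def)
    finally have "ennreal_rpow (n j k) q \<le> ennreal_rpow (ennreal_rpow (block_energy p g j k) (1 / p)) q"
      by (rule ennreal_rpow_mono[OF _ q(1)])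
    also have "\<dots> \<le> ennreal (scale b1 b2 j k powr q) + ennreal (scale b1 b2 j k powr (q - p)) * block_energy p g j k"
      using q by (intro ennreal_rpow_split) (auto simp: scale_def)
    finally show ?thesis .
  qed
  have "ennreal_rpow (besov_norm \<theta> \<rho> \<alpha> (p, p) (q, q) (dist_of g)) q
      = (\<Sum>i. ennreal ((2 powr (fst \<alpha> * of_int (int i - 1))) powr q) *
          ennreal_rpow (lq_norm q (\<lambda>k. ennreal (2 powr (snd \<alpha> * of_int k)) * n (int i - 1) k)) q)"
    unfolding besov_norm_def n_def fst_conv snd_conv by (rule lq_norm_weighted_power[OF q(1)]) simp
  also have "\<dots> = (\<Sum>i. ennreal ((2 powr (fst \<alpha> * of_int (int i - 1))) powr q) *
       (\<Sum>l. ennreal ((2 powr (snd \<alpha> * of_int (int l - 1))) powr q) * ennreal_rpow (n (int i - 1) (int l - 1)) q))"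
    using q by (subst lq_norm_weighted_power) auto
  also have "\<dots> \<le> besov_bound \<alpha> p q b1 b2 g"
    unfolding besov_bound_def by (intro suminf_le mult_left_mono n_le) auto
  finally show ?thesis using fin ennreal_rpow_less_top order.strict_trans1 by blast
qed

text \<open>A geometric series with ratio 2^(-q (b - \<beta>)), which is where the strict inequality
  between the exponents enters.\<close>

lemma besov_bound_weights_finite:
  assumes "0 < q" "\<beta> < b"
  shows "(\<Sum>i. ennreal ((2 powr (\<beta> * of_int (int i - 1))) powr q * (2 powr (- of_int (int i - 1) * exponent b (int i - 1))) powr q)) < \<top>"
proof -
  define c where "c i = (2 powr (\<beta> * of_int (int i - 1))) powr q * (2 powr (- of_int (int i - 1) * exponent b (int i - 1))) powr q" for i
  define r where "r = 2 powr (- (q * (b - \<beta>)))"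
  have r: "0 < r" "r < 1" using assms by (auto simp: r_def powr_less_one)
  \<comment> \<open>Index 0 stands for the low-frequency block, whose exponent is 0 and which does
    not follow the geometric law; it is split off by the shift.\<close>
  have "c (Suc i) = r ^ i" for i
  proof -
    have "c (Suc i) = 2 powr (real i * (- (q * (b - \<beta>))))"
      by (simp add: c_def exponent_def powr_powr powr_add[symmetric] algebra_simps)
    also have "\<dots> = (2 powr (- (q * (b - \<beta>)))) powr real i" by (simp add: powr_powr mult.commute)
    finally show ?thesis using r by (simp add: r_def powr_realpow)
  qed
  then have "summable (\<lambda>i. c (Suc i))" using r by (simp add: summable_geometric)
  then have "summable c" by (simp add: summable_Suc_iff)
  moreover have "0 \<le> c i" for i by (simp add: c_def)
  ultimately have "(\<Sum>i. ennreal (c i)) \<noteq> \<top>" by (intro ennreal_suminf_neq_top) auto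
  then show ?thesis by (simp add: c_def less_top)
qed

end


text \<open>For a non-integrable function the left-hand side is 0, the default value of the Bochner
  integral.\<close>

lemma norm_integral_le_nn_integral:
  fixes f :: "'a \<Rightarrow> complex"
  shows "ennreal (norm (LINT x|M. f x)) \<le> (\<integral>\<^sup>+x. ennreal (norm (f x)) \<partial>M)"
  by (cases "integrable M f") (auto simp: integral_norm_bound_ennreal not_integrable_integral_eq)

section \<open>Random fields with rectangular increments of small moments\<close>

lemma abs_diff_power_le:
  fixes x y k :: real
  assumes "\<bar>k\<bar> \<le> 1"
  shows "\<bar>x - k * y\<bar> ^ p \<le> 2 ^ p * (\<bar>x\<bar> ^ p + \<bar>y\<bar> ^ p)"
proof -
  have "\<bar>k * y\<bar> \<le> 1 * \<bar>y\<bar>" unfolding abs_mult using assms by (intro mult_right_mono) auto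
  then have "\<bar>x - k * y\<bar> \<le> 2 * max \<bar>x\<bar> \<bar>y\<bar>" by linarith
  then have "\<bar>x - k * y\<bar> ^ p \<le> (2 * max \<bar>x\<bar> \<bar>y\<bar>) ^ p" by (intro power_mono) auto
  also have "\<dots> = 2 ^ p * max \<bar>x\<bar> \<bar>y\<bar> ^ p" by (simp add: power_mult_distrib)
  also have "\<dots> \<le> 2 ^ p * (\<bar>x\<bar> ^ p + \<bar>y\<bar> ^ p)" by (intro mult_left_mono) (auto simp: max_def)
  finally show ?thesis .
qed

definition moment :: "'w measure \<Rightarrow> nat \<Rightarrow> ('w \<Rightarrow> real) \<Rightarrow> ennreal" where
  "moment M p X = (\<integral>\<^sup>+\<omega>. ennreal (\<bar>X \<omega>\<bar> ^ p) \<partial>M)"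

lemma moment_diff:
  assumes [measurable]: "X \<in> borel_measurable M" "Y \<in> borel_measurable M"
    and "\<bar>k\<bar> \<le> 1" "moment M p X \<le> ennreal A" "moment M p Y \<le> ennreal B" "0 \<le> A" "0 \<le> B"
  shows "moment M p (\<lambda>\<omega>. X \<omega> - k * Y \<omega>) \<le> ennreal (2 ^ p * (A + B))"
proof -
  have "moment M p (\<lambda>\<omega>. X \<omega> - k * Y \<omega>) \<le> (\<integral>\<^sup>+\<omega>. ennreal (2 ^ p) * (ennreal (\<bar>X \<omega>\<bar> ^ p) + ennreal (\<bar>Y \<omega>\<bar> ^ p)) \<partial>M)"
    unfolding moment_def
    using abs_diff_power_le[OF assms(3), of _ _ p]
    by (intro nn_integral_mono) (simp add: ennreal_plus[symmetric] ennreal_mult'[symmetric] ennreal_leI del: ennreal_plus)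
  also have "\<dots> = ennreal (2 ^ p) * (moment M p X + moment M p Y)"
    unfolding moment_def by (subst nn_integral_cmult) (auto simp: nn_integral_add)
  also have "\<dots> \<le> ennreal (2 ^ p) * (ennreal A + ennreal B)"
    by (intro mult_left_mono add_mono assms) auto
  finally show ?thesis using assms by (simp add: ennreal_plus[symmetric] ennreal_mult'[symmetric] del: ennreal_plus)
qed

lemma moment_cmult:
  assumes [measurable]: "X \<in> borel_measurable M"
  shows "moment M p (\<lambda>\<omega>. k * X \<omega>) = ennreal (\<bar>k\<bar> ^ p) * moment M p X"
  unfolding moment_def by (subst nn_integral_cmult[symmetric]) (auto simp: abs_mult power_mult_distrib ennreal_mult')

text \<open>A positive m is m^a m^(1 - a), and each factor is estimated by its own bound.\<close>

lemma le_geometric_interpolation: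
  fixes m x y a :: real
  assumes "0 < x" "0 < y" "0 < a" "a < 1" "m \<le> x" "m \<le> y"
  shows "m \<le> x powr a * y powr (1 - a)"
proof (cases "0 < m")
  case True
  then have "m = m powr a * m powr (1 - a)" by (simp add: powr_add[symmetric])
  also have "\<dots> \<le> x powr a * y powr (1 - a)"
    using assms True by (intro mult_mono powr_mono2) auto
  finally show ?thesis .
next
  case False
  then show ?thesis by (auto intro: order_trans[of m 0])
qed

text \<open>The real counterpart of \<open>increment\<close>, with c1 and c2 as the switches in time
  and space.\<close>

definition rectangle :: "real \<Rightarrow> real \<Rightarrow> (real \<times> real \<Rightarrow> real) \<Rightarrow> real \<times> real \<Rightarrow> real \<times> real \<Rightarrow> real" where
  "rectangle c1 c2 G w z = (G (fst w - fst z, snd w - snd z) - c1 * G (fst w, snd w - snd z))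
     - c2 * (G (fst w - fst z, snd w) - c1 * G w)"

text \<open>The exponents of the one-parameter increments are such that interpolation between the two bounds
  with weights \<open>a\<close> and \<open>1 - a\<close> gives the exponents \<open>p * \<beta>1\<close> and \<open>p * \<beta>2\<close> for rectangular increments.\<close>

locale cutoff_field = prob_space M + dyadic_decomposition \<theta> \<rho>
  for M :: "'w measure" and \<theta> \<rho> :: "real \<Rightarrow> real" +
  fixes U :: "'w \<Rightarrow> real \<times> real \<Rightarrow> real" and \<eta> :: "real \<Rightarrow> real"
    and T c cx a \<beta>1 \<beta>2 :: real and p :: nat
  assumes U_cont: "\<And>\<omega>. \<omega> \<in> space M \<Longrightarrow> continuous_on UNIV (U \<omega>)"
    and U_meas: "\<And>z. (\<lambda>\<omega>. U \<omega> z) \<in> borel_measurable M"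
    and U_neg: "\<And>\<omega> t x. \<omega> \<in> space M \<Longrightarrow> t < 0 \<Longrightarrow> U \<omega> (t, x) = 0"
    and U_periodic: "\<And>\<omega> t x. \<omega> \<in> space M \<Longrightarrow> U \<omega> (t, x + 2 * pi) = U \<omega> (t, x)"
    and p: "0 < p" and a: "0 < a" "a < 1" and c: "0 \<le> c" "0 \<le> cx" and T: "0 < T"
    and \<beta>: "0 \<le> \<beta>1" "\<beta>1 \<le> 1" "0 \<le> \<beta>2" "\<beta>2 \<le> 1"
    and moment_time: "\<And>t s x. s \<noteq> 0 \<Longrightarrow>
      moment M p (\<lambda>\<omega>. U \<omega> (t - s, x) - U \<omega> (t, x)) \<le> ennreal (c * \<bar>s\<bar> powr (p * \<beta>1 / a))"
    and moment_space: "\<And>t x y. y \<noteq> 0 \<Longrightarrow>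
      moment M p (\<lambda>\<omega>. U \<omega> (t, x - y) - U \<omega> (t, x)) \<le> ennreal (c * \<bar>y\<bar> powr (p * \<beta>2 / (1 - a)))"
    and moment_U: "\<And>z. moment M p (\<lambda>\<omega>. U \<omega> z) \<le> ennreal c"
    and \<eta>_meas [measurable]: "\<eta> \<in> borel_measurable borel"
    and \<eta>: "\<And>t. 0 \<le> \<eta> t" "\<And>t. \<eta> t \<le> 1" "\<And>t. T < t \<Longrightarrow> \<eta> t = 0"
    and \<eta>_increment: "\<And>s. s \<noteq> 0 \<Longrightarrow>
      (\<integral>\<^sup>+t. ennreal (indicator ({0..T} \<union> {s..T + s}) t * \<bar>\<eta> (t - s) - \<eta> t\<bar> ^ p) \<partial>lborel)
        \<le> ennreal (cx * \<bar>s\<bar> powr (p * \<beta>1))"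
begin

lemma U_joint: "(\<lambda>(\<omega>, z). U \<omega> z) \<in> borel_measurable (M \<Otimes>\<^sub>M borel)"
  by (rule caratheodory_measurable[OF U_cont U_meas])

lemma U_measurable [measurable (raw)]:
  assumes "f \<in> N \<rightarrow>\<^sub>M M" "h \<in> borel_measurable N"
  shows "(\<lambda>x. U (f x) (h x)) \<in> borel_measurable N"
  using measurable_compose[OF measurable_Pair[OF assms] U_joint] by simp

definition G :: "'w \<Rightarrow> real \<times> real \<Rightarrow> real" where
  "G \<omega> z = \<eta> (fst z) * U \<omega> z"

definition g :: "'w \<Rightarrow> real \<times> real \<Rightarrow> complex" where
  "g \<omega> z = complex_of_real (G \<omega> z)"

lemma G_measurable [measurable (raw)]:
  assumes [measurable]: "f \<in> N \<rightarrow>\<^sub>M M" "h \<in> borel_measurable N"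
  shows "(\<lambda>x. G (f x) (h x)) \<in> borel_measurable N"
  unfolding G_def by measurable

lemma g_measurable: "\<omega> \<in> space M \<Longrightarrow> g \<omega> \<in> borel_measurable borel"
  unfolding g_def by measurable

lemma G_support: "\<omega> \<in> space M \<Longrightarrow> fst z \<notin> {0..T} \<Longrightarrow> G \<omega> z = 0"
  using U_neg[of \<omega> "fst z" "snd z"] \<eta>(3)[of "fst z"] by (cases z) (auto simp: G_def not_le)

text \<open>Periodicity moves the space variable into one period and the cut-off confines time to
  [0,T], leaving a continuous function on a compact set. The bound depends on \<omega>.\<close>

lemma g_bounded:
  assumes "\<omega> \<in> space M"
  obtains C where "\<And>z. norm (g \<omega> z) \<le> C"
proof -
  have "compact (U \<omega> ` ({0..T} \<times> {-pi..pi}))"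
    using U_cont[OF assms] by (intro compact_continuous_image compact_Times) (auto intro: continuous_on_subset)
  then have "bounded (U \<omega> ` ({0..T} \<times> {-pi..pi}))" by (rule compact_imp_bounded)
  then obtain C where C: "\<And>z. z \<in> {0..T} \<times> {-pi..pi} \<Longrightarrow> \<bar>U \<omega> z\<bar> \<le> C"
    unfolding bounded_iff by (metis imageI real_norm_def)
  have per: "U \<omega> (t, x + 2 * pi * of_nat n) = U \<omega> (t, x)" for t x n
    using U_periodic[OF assms, of t "x + 2 * pi * of_nat _"]
    by (induction n) (auto simp: algebra_simps)
  have per': "U \<omega> (t, x + 2 * pi * of_int n) = U \<omega> (t, x)" for t x n
  proof (cases n rule: int_cases2)
    case (nonneg m)
    then show ?thesis using per[of t x m] by simp
  next
    case (nonpos m)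
    then show ?thesis using per[of t "x + 2 * pi * of_int n" m] by simp
  qed
  have "norm (g \<omega> z) \<le> \<bar>C\<bar>" for z
  proof (cases "fst z \<in> {0..T}")
    case True
    define n where "n = \<lfloor>(snd z + pi) / (2 * pi)\<rfloor>"
    define r where "r = snd z - 2 * pi * of_int n"
    have "of_int n \<le> (snd z + pi) / (2 * pi)" "(snd z + pi) / (2 * pi) < of_int n + 1"
      by (auto simp: n_def)
    then have "of_int n * (2 * pi) \<le> snd z + pi" "snd z + pi < (of_int n + 1) * (2 * pi)"
      by (simp_all add: pos_le_divide_eq pos_divide_less_eq)
    then have r: "r \<in> {-pi..pi}" by (auto simp: r_def algebra_simps)
    have "U \<omega> z = U \<omega> (fst z, r)" using per'[of "fst z" r n] by (simp add: r_def)
    then have "\<bar>U \<omega> z\<bar> \<le> C" using C[of "(fst z, r)"] True r by simp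
    moreover have "\<bar>\<eta> (fst z)\<bar> * \<bar>U \<omega> z\<bar> \<le> 1 * \<bar>U \<omega> z\<bar>"
      using \<eta>(1,2)[of "fst z"] by (intro mult_right_mono) auto
    ultimately show ?thesis by (simp add: g_def G_def norm_mult)
  next
    case False
    then show ?thesis using G_support[OF assms] by (simp add: g_def)
  qed
  then show ?thesis using that by blast
qed

lemma g_periodic: "\<omega> \<in> space M \<Longrightarrow> g \<omega> (t, x + 2 * pi) = g \<omega> (t, x)"
  by (simp add: g_def G_def U_periodic)

text \<open>The gain from a variable with switch k: none when no increment is taken, a power of the
  step otherwise.\<close>

definition \<tau> :: "real \<Rightarrow> real \<Rightarrow> real \<Rightarrow> real" where
  "\<tau> k r s = (if k = 0 then 1 else \<bar>s\<bar> powr r)"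

lemma \<tau>_pos: "s \<noteq> 0 \<Longrightarrow> 0 < \<tau> k r s" by (simp add: \<tau>_def)

text \<open>The rectangle can be grouped as a difference of two time increments or of two space
  increments. Its moment obeys both bounds, hence the bound by the minimum, which interpolation
  turns into a product.\<close>

lemma rectangle_U_moment:
  assumes c12: "c1 \<in> {0, 1}" "c2 \<in> {0, 1}" and z: "fst z \<noteq> 0" "snd z \<noteq> 0"
  shows "moment M p (\<lambda>\<omega>. rectangle c1 c2 (U \<omega>) w z)
    \<le> ennreal (2 * 2 ^ p * c * (\<tau> c1 (p * \<beta>1) (fst z) * \<tau> c2 (p * \<beta>2) (snd z)))"
proof -
  let ?s = "fst z" and ?y = "snd z"
  define t1 where "t1 = \<tau> c1 (p * \<beta>1 / a) ?s"
  define t2 where "t2 = \<tau> c2 (p * \<beta>2 / (1 - a)) ?y"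
  have pos: "0 < t1" "0 < t2" using z by (auto simp: t1_def t2_def \<tau>_pos)
  have d1: "moment M p (\<lambda>\<omega>. U \<omega> (t - ?s, x) - c1 * U \<omega> (t, x)) \<le> ennreal (c * t1)" for t x
    using moment_time[OF z(1), of t x] moment_U[of "(t - ?s, x)"] c12 by (auto simp: t1_def \<tau>_def)
  have d2: "moment M p (\<lambda>\<omega>. U \<omega> (t, x - ?y) - c2 * U \<omega> (t, x)) \<le> ennreal (c * t2)" for t x
    using moment_space[OF z(2), of t x] moment_U[of "(t, x - ?y)"] c12 by (auto simp: t2_def \<tau>_def)
  have 1: "moment M p (\<lambda>\<omega>. rectangle c1 c2 (U \<omega>) w z) \<le> ennreal (2 ^ p * (c * t1 + c * t1))"
  proof -
    have "moment M p (\<lambda>\<omega>. (U \<omega> (fst w - ?s, snd w - ?y) - c1 * U \<omega> (fst w, snd w - ?y))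
        - c2 * (U \<omega> (fst w - ?s, snd w) - c1 * U \<omega> (fst w, snd w))) \<le> ennreal (2 ^ p * (c * t1 + c * t1))"
      using c12 c pos by (intro moment_diff d1) auto
    then show ?thesis by (simp add: rectangle_def)
  qed
  have 2: "moment M p (\<lambda>\<omega>. rectangle c1 c2 (U \<omega>) w z) \<le> ennreal (2 ^ p * (c * t2 + c * t2))"
  proof -
    have "moment M p (\<lambda>\<omega>. (U \<omega> (fst w - ?s, snd w - ?y) - c2 * U \<omega> (fst w - ?s, snd w))
        - c1 * (U \<omega> (fst w, snd w - ?y) - c2 * U \<omega> (fst w, snd w))) \<le> ennreal (2 ^ p * (c * t2 + c * t2))"
      using c12 c pos by (intro moment_diff d2) auto
    then show ?thesis by (simp add: rectangle_def algebra_simps)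
  qed
  have tau: "t1 powr a = \<tau> c1 (p * \<beta>1) ?s" "t2 powr (1 - a) = \<tau> c2 (p * \<beta>2) ?y"
    using a z by (auto simp: t1_def t2_def \<tau>_def powr_powr)
  have "min t1 t2 \<le> t1 powr a * t2 powr (1 - a)"
    using pos a by (intro le_geometric_interpolation) auto
  then have m: "min t1 t2 \<le> \<tau> c1 (p * \<beta>1) ?s * \<tau> c2 (p * \<beta>2) ?y" by (simp add: tau)
  have "moment M p (\<lambda>\<omega>. rectangle c1 c2 (U \<omega>) w z) \<le> ennreal (2 * 2 ^ p * c * min t1 t2)"
    using 1 2 by (cases "t1 \<le> t2") (auto simp: min_def algebra_simps)
  also have "\<dots> \<le> ennreal (2 * 2 ^ p * c * (\<tau> c1 (p * \<beta>1) ?s * \<tau> c2 (p * \<beta>2) ?y))"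
    using m c by (intro ennreal_leI mult_left_mono) auto
  finally show ?thesis .
qed

text \<open>The available space exponent p \<beta>2 / (1 - a) is larger than required. Interpolating
  with the constant bound lowers it to p \<beta>2 for small and large steps alike.\<close>

lemma space_difference_moment:
  assumes c2: "c2 \<in> {0, 1}" and y: "y \<noteq> 0"
  shows "moment M p (\<lambda>\<omega>. U \<omega> (t, x - y) - c2 * U \<omega> (t, x)) \<le> ennreal (2 * 2 ^ p * c * \<tau> c2 (p * \<beta>2) y)"
proof -
  define t2 where "t2 = \<tau> c2 (p * \<beta>2 / (1 - a)) y"
  have pos: "0 < t2" using y by (auto simp: t2_def \<tau>_pos)
  have 1: "moment M p (\<lambda>\<omega>. U \<omega> (t, x - y) - c2 * U \<omega> (t, x)) \<le> ennreal (c * t2)"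
    using moment_space[OF y, of t x] moment_U[of "(t, x - y)"] c2 by (auto simp: t2_def \<tau>_def)
  have 2: "moment M p (\<lambda>\<omega>. U \<omega> (t, x - y) - c2 * U \<omega> (t, x)) \<le> ennreal (2 ^ p * (c + c))"
    using c2 c by (intro moment_diff moment_U) auto
  have "1 \<le> 2 * (2 :: real) ^ p" using one_le_power[of "2 :: real" p] by linarith
  then have "1 * (c * t2) \<le> (2 * 2 ^ p) * (c * t2)" using c pos by (intro mult_right_mono) auto
  then have "moment M p (\<lambda>\<omega>. U \<omega> (t, x - y) - c2 * U \<omega> (t, x)) \<le> ennreal (2 * 2 ^ p * c * min 1 t2)"
    using order_trans[OF 1 ennreal_leI[of "c * t2" "2 * 2 ^ p * (c * t2)"]] 2
    by (cases "1 \<le> t2") (auto simp: min_def algebra_simps)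
  also have "\<dots> \<le> ennreal (2 * 2 ^ p * c * (1 powr a * t2 powr (1 - a)))"
    using c pos a by (intro ennreal_leI mult_left_mono le_geometric_interpolation) auto
  also have "1 powr a * t2 powr (1 - a) = \<tau> c2 (p * \<beta>2) y"
    using a y by (auto simp: t2_def \<tau>_def powr_powr)
  finally show ?thesis .
qed

text \<open>A discrete product rule: a time increment of \<eta> U is the shifted cut-off times an
  increment of U, plus an increment of the cut-off times U. The increment of \<eta> is left
  unestimated, since for a jump it is small only after integration in time.\<close>

lemma rectangle_G_moment:
  assumes c12: "c1 \<in> {0, 1}" "c2 \<in> {0, 1}" and z: "fst z \<noteq> 0" "snd z \<noteq> 0"
  shows "moment M p (\<lambda>\<omega>. rectangle c1 c2 (G \<omega>) w z)
    \<le> ennreal (indicator ({0..T} \<union> {fst z..T + fst z}) (fst w) * (2 ^ p * (2 * 2 ^ p * c)) * \<tau> c2 (p * \<beta>2) (snd z)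
         * (\<tau> c1 (p * \<beta>1) (fst z) + c1 * \<bar>\<eta> (fst w - fst z) - \<eta> (fst w)\<bar> ^ p))"
proof (cases "fst w \<in> {0..T} \<union> {fst z..T + fst z}")
  case False
  then have "rectangle c1 c2 (G \<omega>) w z = 0" if "\<omega> \<in> space M" for \<omega>
    using G_support[OF that] by (auto simp: rectangle_def)
  then have "moment M p (\<lambda>\<omega>. rectangle c1 c2 (G \<omega>) w z) = (\<integral>\<^sup>+\<omega>. 0 \<partial>M)"
    unfolding moment_def using p by (intro nn_integral_cong) simp
  then show ?thesis by simp
next
  case True
  let ?s = "fst z" and ?y = "snd z" and ?t = "fst w" and ?x = "snd w"
  define d where "d = \<eta> (?t - ?s) - \<eta> ?t"
  define t1 where "t1 = \<tau> c1 (p * \<beta>1) ?s"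
  define t2 where "t2 = \<tau> c2 (p * \<beta>2) ?y"
  have pos: "0 < t1" "0 < t2" using z by (auto simp: t1_def t2_def \<tau>_pos)
  \<comment> \<open>The sum is written as a difference with factor -1 to match
    \<open>moment_diff\<close>; with c1 = 0 the term from the cut-off disappears.\<close>
  have "rectangle c1 c2 (G \<omega>) w z = \<eta> (?t - ?s) * rectangle c1 c2 (U \<omega>) w z
      - (- 1) * ((c1 * d) * (U \<omega> (?t, ?x - ?y) - c2 * U \<omega> (?t, ?x)))" for \<omega>
    by (simp add: rectangle_def G_def d_def algebra_simps)
  then have "moment M p (\<lambda>\<omega>. rectangle c1 c2 (G \<omega>) w z)
      = moment M p (\<lambda>\<omega>. \<eta> (?t - ?s) * rectangle c1 c2 (U \<omega>) w z
          - (- 1) * ((c1 * d) * (U \<omega> (?t, ?x - ?y) - c2 * U \<omega> (?t, ?x))))" by (simp only:)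
  also have "\<dots> \<le> ennreal (2 ^ p * (2 * 2 ^ p * c * (t1 * t2) + c1 * \<bar>d\<bar> ^ p * (2 * 2 ^ p * c * t2)))"
  proof (rule moment_diff)
    have rm: "(\<lambda>\<omega>. rectangle c1 c2 (U \<omega>) w z) \<in> borel_measurable M" unfolding rectangle_def by measurable
    show "(\<lambda>\<omega>. \<eta> (?t - ?s) * rectangle c1 c2 (U \<omega>) w z) \<in> borel_measurable M" using rm by measurable
    show "(\<lambda>\<omega>. c1 * d * (U \<omega> (?t, ?x - ?y) - c2 * U \<omega> (?t, ?x))) \<in> borel_measurable M" by measurable
    have "moment M p (\<lambda>\<omega>. \<eta> (?t - ?s) * rectangle c1 c2 (U \<omega>) w z)
        = ennreal (\<bar>\<eta> (?t - ?s)\<bar> ^ p) * moment M p (\<lambda>\<omega>. rectangle c1 c2 (U \<omega>) w z)"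
      by (rule moment_cmult[OF rm])
    also have "\<dots> \<le> ennreal 1 * ennreal (2 * 2 ^ p * c * (t1 * t2))"
      unfolding t1_def t2_def using \<eta> by (intro mult_mono ennreal_leI rectangle_U_moment c12 z power_le_one) auto
    finally show "moment M p (\<lambda>\<omega>. \<eta> (?t - ?s) * rectangle c1 c2 (U \<omega>) w z) \<le> ennreal (2 * 2 ^ p * c * (t1 * t2))"
      by simp
    have "moment M p (\<lambda>\<omega>. c1 * d * (U \<omega> (?t, ?x - ?y) - c2 * U \<omega> (?t, ?x)))
        = ennreal (\<bar>c1 * d\<bar> ^ p) * moment M p (\<lambda>\<omega>. U \<omega> (?t, ?x - ?y) - c2 * U \<omega> (?t, ?x))"
      by (rule moment_cmult) measurable
    also have "\<dots> \<le> ennreal (\<bar>c1 * d\<bar> ^ p) * ennreal (2 * 2 ^ p * c * t2)"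
      unfolding t2_def by (intro mult_left_mono space_difference_moment c12 z) auto
    also have "\<bar>c1 * d\<bar> ^ p = c1 * \<bar>d\<bar> ^ p" using c12 p by auto
    finally show "moment M p (\<lambda>\<omega>. c1 * d * (U \<omega> (?t, ?x - ?y) - c2 * U \<omega> (?t, ?x)))
        \<le> ennreal (c1 * \<bar>d\<bar> ^ p * (2 * 2 ^ p * c * t2))"
      using c12 by (simp add: ennreal_mult''[symmetric] c pos less_imp_le)
  qed (use c c12 pos in auto)
  finally show ?thesis
    unfolding t1_def[symmetric] t2_def[symmetric] d_def[symmetric] using True by (simp add: algebra_simps)
qed

text \<open>The rectangle vanishes unless the time or the shifted time lies in [0,T], a set of
  measure at most 2 T. Integration over it yields the constant 2 T for the first term of the product
  rule and cx for the cut-off term.\<close>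

lemma rectangle_G_energy:
  assumes c12: "c1 \<in> {0, 1}" "c2 \<in> {0, 1}" and z: "fst z \<noteq> 0" "snd z \<noteq> 0"
  shows "(\<integral>\<^sup>+w. ennreal (indicator {-pi..pi} (snd w)) * moment M p (\<lambda>\<omega>. rectangle c1 c2 (G \<omega>) w z) \<partial>lborel)
    \<le> ennreal (2 * pi * (2 ^ p * (2 * 2 ^ p * c)) * (2 * T + cx) * (\<tau> c1 (p * \<beta>1) (fst z) * \<tau> c2 (p * \<beta>2) (snd z)))"
proof -
  let ?s = "fst z" and ?y = "snd z"
  define I where "I = {0..T} \<union> {?s..T + ?s}"
  define A where "A = 2 ^ p * (2 * 2 ^ p * c)"
  define t1 where "t1 = \<tau> c1 (p * \<beta>1) ?s"
  define t2 where "t2 = \<tau> c2 (p * \<beta>2) ?y"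
  have pos: "0 < t1" "0 < t2" "0 \<le> A" using z c by (auto simp: t1_def t2_def \<tau>_pos A_def)
  have [measurable]: "I \<in> sets borel" unfolding I_def by simp
  define F where "F t = ennreal (indicator I t * (A * t2) * (t1 + c1 * \<bar>\<eta> (t - ?s) - \<eta> t\<bar> ^ p))" for t
  have [measurable]: "F \<in> borel_measurable borel" unfolding F_def by measurable
  have c1: "0 \<le> c1" using c12 by auto
  have "(\<integral>\<^sup>+w. ennreal (indicator {-pi..pi} (snd w)) * moment M p (\<lambda>\<omega>. rectangle c1 c2 (G \<omega>) w z) \<partial>lborel)
      \<le> (\<integral>\<^sup>+w. ennreal (indicator {-pi..pi} (snd w)) * F (fst w) \<partial>lborel)"
    using rectangle_G_moment[OF c12 z] by (intro nn_integral_mono mult_left_mono) (auto simp: F_def I_def A_def t1_def t2_def mult.assoc)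
  also have "\<dots> = (\<integral>\<^sup>+w. ennreal (indicator {-pi..pi} (snd w)) * F (fst w) \<partial>(lborel \<Otimes>\<^sub>M lborel))"
    by (simp add: lborel_prod)
  also have "\<dots> = (\<integral>\<^sup>+t. \<integral>\<^sup>+x. ennreal (indicator {-pi..pi} x) * F t \<partial>lborel \<partial>lborel)"
    by (subst lborel.nn_integral_fst[symmetric]) auto
  also have "\<dots> = (\<integral>\<^sup>+t. ennreal (2 * pi) * F t \<partial>lborel)"
    by (simp add: nn_integral_multc ennreal_indicator)
  also have "\<dots> = ennreal (2 * pi) * (\<integral>\<^sup>+t. F t \<partial>lborel)"
    by (rule nn_integral_cmult) measurable
  also have "(\<integral>\<^sup>+t. F t \<partial>lborel) \<le> ennreal (A * t2 * ((2 * T + cx) * t1))"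
  proof -
    have "F t = ennreal (A * t2 * t1) * indicator I t
        + ennreal (A * t2 * c1) * ennreal (indicator I t * \<bar>\<eta> (t - ?s) - \<eta> t\<bar> ^ p)" for t
      unfolding F_def using pos c1
      by (auto simp: indicator_def ennreal_plus[symmetric] ennreal_mult'[symmetric] algebra_simps simp del: ennreal_plus)
    then have "(\<integral>\<^sup>+t. F t \<partial>lborel) = ennreal (A * t2 * t1) * emeasure lborel I
        + ennreal (A * t2 * c1) * (\<integral>\<^sup>+t. ennreal (indicator I t * \<bar>\<eta> (t - ?s) - \<eta> t\<bar> ^ p) \<partial>lborel)"
      by (simp add: nn_integral_add nn_integral_cmult)
    also have "\<dots> \<le> ennreal (A * t2 * t1) * ennreal (2 * T) + ennreal (A * t2 * c1) * ennreal (cx * \<bar>?s\<bar> powr (p * \<beta>1))"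
    proof (intro add_mono mult_left_mono)
      have "emeasure lborel I \<le> emeasure lborel {0..T} + emeasure lborel {?s..T + ?s}"
        unfolding I_def by (rule emeasure_subadditive) auto
      also have "\<dots> = ennreal (2 * T)" using T by (simp add: ennreal_plus[symmetric] del: ennreal_plus)
      finally show "emeasure lborel I \<le> ennreal (2 * T)" .
      show "(\<integral>\<^sup>+t. ennreal (indicator I t * \<bar>\<eta> (t - ?s) - \<eta> t\<bar> ^ p) \<partial>lborel) \<le> ennreal (cx * \<bar>?s\<bar> powr (p * \<beta>1))"
        unfolding I_def by (rule \<eta>_increment[OF z(1)])
    qed auto
    also have "\<dots> = ennreal (A * t2 * t1 * (2 * T) + A * t2 * c1 * (cx * \<bar>?s\<bar> powr (p * \<beta>1)))"
      using pos T c c1 by (simp add: ennreal_plus[symmetric] ennreal_mult'[symmetric] del: ennreal_plus)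
    also have "\<dots> \<le> ennreal (A * t2 * ((2 * T + cx) * t1))"
    proof (rule ennreal_leI)
      have "c1 * (cx * \<bar>?s\<bar> powr (p * \<beta>1)) \<le> cx * t1" using c12 c pos by (auto simp: t1_def \<tau>_def)
      then have "A * t2 * (c1 * (cx * \<bar>?s\<bar> powr (p * \<beta>1))) \<le> A * t2 * (cx * t1)"
        using pos by (intro mult_left_mono) auto
      then show "A * t2 * t1 * (2 * T) + A * t2 * c1 * (cx * \<bar>?s\<bar> powr (p * \<beta>1)) \<le> A * t2 * ((2 * T + cx) * t1)"
        by (simp add: algebra_simps)
    qed
    finally show ?thesis .
  qed
  also have "ennreal (2 * pi) * ennreal (A * t2 * ((2 * T + cx) * t1))
      = ennreal (2 * pi * A * (2 * T + cx) * (t1 * t2))"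
    by (simp add: ennreal_mult'[symmetric] mult_ac)
  finally show ?thesis by (simp add: A_def t1_def t2_def mult_left_mono)
qed

definition weight :: "int \<Rightarrow> int \<Rightarrow> real \<times> real \<Rightarrow> real" where
  "weight j k z = \<bar>fst z\<bar> powr exponent \<beta>1 j * \<bar>snd z\<bar> powr exponent \<beta>2 k"

definition detail_real :: "int \<Rightarrow> real" where "detail_real j = (if j = -1 then 0 else 1)"

text \<open>Minkowski's inequality with the sample space times the plane as outer measure space and
  the convolution variable as inner one. The power weight cancels the size of the increments and is
  integrated against the kernels, which gives the dyadic scale.\<close>

lemma block_energy_expectation:
  "\<exists>D\<ge>0. \<forall>j\<ge>-1. \<forall>k\<ge>-1. (\<integral>\<^sup>+\<omega>. block_energy p (g \<omega>) j k \<partial>M) \<le> ennreal (D * scale \<beta>1 \<beta>2 j k ^ p)"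
proof -
  obtain A1 where A1: "0 < A1" "\<And>j. j \<ge> -1 \<Longrightarrow> (\<integral>\<^sup>+y. ennreal (norm (K j y) * \<bar>y\<bar> powr exponent \<beta>1 j) \<partial>lborel)
    \<le> ennreal (A1 * 2 powr (- of_int j * exponent \<beta>1 j))" using K_weighted_integral[OF \<beta>(1,2)] by blast
  obtain A2 where A2: "0 < A2" "\<And>j. j \<ge> -1 \<Longrightarrow> (\<integral>\<^sup>+y. ennreal (norm (K j y) * \<bar>y\<bar> powr exponent \<beta>2 j) \<partial>lborel)
    \<le> ennreal (A2 * 2 powr (- of_int j * exponent \<beta>2 j))" using K_weighted_integral[OF \<beta>(3,4)] by blast
  define C where "C = 2 * pi * (2 ^ p * (2 * 2 ^ p * c)) * (2 * T + cx)"
  have C: "0 \<le> C" using c T by (simp add: C_def)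
  have "(\<integral>\<^sup>+\<omega>. block_energy p (g \<omega>) j k \<partial>M) \<le> ennreal ((C * (A1 * A2) ^ p) * scale \<beta>1 \<beta>2 j k ^ p)"
    if jk: "-1 \<le> j" "-1 \<le> k" for j k
  proof -
    have [measurable]: "K j \<in> borel_measurable borel" "K k \<in> borel_measurable borel" using jk by auto
    define \<kappa> where "\<kappa> z = norm (K j (fst z)) * norm (K k (snd z))" for z :: "real \<times> real"
    \<comment> \<open>The restriction to one period is part of D, so that the outer integral may run
      over the whole plane.\<close>
    define D where "D \<omega>w z = indicator {-pi..pi} (snd (snd \<omega>w)) * \<bar>rectangle (detail_real j) (detail_real k) (G (fst \<omega>w)) (snd \<omega>w) z\<bar>"
      for \<omega>w :: "'w \<times> real \<times> real" and z
    have djk: "detail_real j \<in> {0, 1}" "detail_real k \<in> {0, 1}" by (auto simp: detail_real_def)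
    have [measurable]: "\<kappa> \<in> borel_measurable borel" unfolding \<kappa>_def by measurable
    have Dm[measurable]: "(\<lambda>(n, v). D n v) \<in> borel_measurable ((M \<Otimes>\<^sub>M lborel) \<Otimes>\<^sub>M lborel)"
      unfolding D_def rectangle_def by measurable
    define H where "H n = (\<integral>\<^sup>+v. ennreal (\<kappa> v * D n v) \<partial>lborel) ^ p" for n
    have Hm: "H \<in> borel_measurable (M \<Otimes>\<^sub>M lborel)" unfolding H_def by measurable
    have sc: "0 \<le> A1 * A2 * scale \<beta>1 \<beta>2 j k" using A1 A2 by (simp add: scale_def)
    have "(\<integral>\<^sup>+n. (\<integral>\<^sup>+v. ennreal (\<kappa> v * D n v) \<partial>lborel) ^ p \<partial>(M \<Otimes>\<^sub>M lborel))
        \<le> ennreal (C * (A1 * A2 * scale \<beta>1 \<beta>2 j k) ^ p)"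
    proof (rule minkowski_weighted[where W="weight j k"])
      show "sigma_finite_measure (M \<Otimes>\<^sub>M (lborel :: (real \<times> real) measure))"
        by (intro sigma_finite_pair_measure sigma_finite_measure_axioms sigma_finite_lborel)
      \<comment> \<open>On the axes the weight is 0 even for exponent 0, because
        \<open>0 powr 0 = 0\<close>; the axes form a null set.\<close>
      have nz: "AE z in lborel. fst z \<noteq> (0::real) \<and> snd z \<noteq> (0::real)"
      proof -
        have "AE z in lborel \<Otimes>\<^sub>M lborel. fst z \<noteq> (0::real) \<and> snd z \<noteq> (0::real)"
        proof (rule lborel_pair.AE_pair_measure)
          show "{z \<in> space (lborel \<Otimes>\<^sub>M lborel). fst z \<noteq> (0::real) \<and> snd z \<noteq> (0::real)} \<in> sets (lborel \<Otimes>\<^sub>M lborel)"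
            by measurable
          show "AE x in lborel. AE y in lborel. fst (x, y) \<noteq> (0::real) \<and> snd (x, y) \<noteq> (0::real)"
            using AE_lborel_singleton[of "0::real"] by (auto elim!: eventually_mono)
        qed
        then show ?thesis by (simp only: lborel_prod)
      qed
      show "AE v in lborel. 0 < weight j k v"
        using nz by (rule eventually_mono) (auto simp: weight_def)
      show "AE v in lborel. (\<integral>\<^sup>+n. ennreal (D n v ^ p) \<partial>(M \<Otimes>\<^sub>M lborel)) \<le> ennreal (C * weight j k v ^ p)"
        using nz
      proof eventually_elim
        case (elim z)
        have "(\<integral>\<^sup>+n. ennreal (D n z ^ p) \<partial>(M \<Otimes>\<^sub>M lborel))
            = (\<integral>\<^sup>+n. ennreal (indicator {-pi..pi} (snd (snd n))) * ennreal (\<bar>rectangle (detail_real j) (detail_real k) (G (fst n)) (snd n) z\<bar> ^ p) \<partial>(M \<Otimes>\<^sub>M lborel))"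
          unfolding D_def using p by (intro nn_integral_cong) (auto simp: indicator_def)
        also have "\<dots> = (\<integral>\<^sup>+w. \<integral>\<^sup>+\<omega>. ennreal (indicator {-pi..pi} (snd w)) * ennreal (\<bar>rectangle (detail_real j) (detail_real k) (G \<omega>) w z\<bar> ^ p) \<partial>M \<partial>lborel)"
        proof -
          interpret MP: pair_sigma_finite M "lborel :: (real \<times> real) measure" ..
          show ?thesis by (subst MP.nn_integral_snd[symmetric]) (auto simp: rectangle_def)
        qed
        also have "\<dots> = (\<integral>\<^sup>+w. ennreal (indicator {-pi..pi} (snd w)) * moment M p (\<lambda>\<omega>. rectangle (detail_real j) (detail_real k) (G \<omega>) w z) \<partial>lborel)"
          unfolding moment_def by (intro nn_integral_cong nn_integral_cmult) (simp add: rectangle_def)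
        also have "\<dots> \<le> ennreal (C * (\<tau> (detail_real j) (p * \<beta>1) (fst z) * \<tau> (detail_real k) (p * \<beta>2) (snd z)))"
          unfolding C_def using elim by (intro rectangle_G_energy djk) auto
        also have "\<tau> (detail_real j) (p * \<beta>1) (fst z) * \<tau> (detail_real k) (p * \<beta>2) (snd z) = weight j k z ^ p"
        proof -
          have pw: "(x powr b) ^ p = x powr (p * b)" if "0 < x" for x b :: real
            using that by (simp add: powr_realpow[symmetric] powr_powr mult.commute)
          show ?thesis using elim by (simp add: weight_def \<tau>_def detail_real_def exponent_def power_mult_distrib pw)
        qed
        finally show ?case .
      qed
      show "(\<integral>\<^sup>+v. ennreal (\<kappa> v * weight j k v) \<partial>lborel) \<le> ennreal (A1 * A2 * scale \<beta>1 \<beta>2 j k)"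
      proof -
        define h1 where "h1 x = ennreal (norm (K j x) * \<bar>x\<bar> powr exponent \<beta>1 j)" for x
        define h2 where "h2 x = ennreal (norm (K k x) * \<bar>x\<bar> powr exponent \<beta>2 k)" for x
        have [measurable]: "h1 \<in> borel_measurable borel" "h2 \<in> borel_measurable borel"
          unfolding h1_def h2_def by measurable
        have "(\<integral>\<^sup>+v. ennreal (\<kappa> v * weight j k v) \<partial>lborel) = (\<integral>\<^sup>+v. h1 (fst v) * h2 (snd v) \<partial>(lborel \<Otimes>\<^sub>M lborel))"
          unfolding lborel_prod \<kappa>_def weight_def h1_def h2_def
          by (intro nn_integral_cong) (simp add: ennreal_mult[symmetric] mult_ac)
        also have "\<dots> = (\<integral>\<^sup>+x. \<integral>\<^sup>+y. h1 x * h2 y \<partial>lborel \<partial>lborel)"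
          by (subst lborel.nn_integral_fst[symmetric]) auto
        also have "\<dots> = (\<integral>\<^sup>+x. h1 x \<partial>lborel) * (\<integral>\<^sup>+y. h2 y \<partial>lborel)"
          by (simp add: nn_integral_cmult nn_integral_multc)
        also have "\<dots> \<le> ennreal (A1 * 2 powr (- of_int j * exponent \<beta>1 j)) * ennreal (A2 * 2 powr (- of_int k * exponent \<beta>2 k))"
          unfolding h1_def h2_def using jk A1 A2 by (intro mult_mono) auto
        also have "\<dots> = ennreal (A1 * A2 * scale \<beta>1 \<beta>2 j k)"
          using A1 A2 by (simp add: ennreal_mult[symmetric] scale_def mult_ac)
        finally show ?thesis .
      qed
      show "0 < p" by (rule p)
      show "(\<lambda>(n, v). D n v) \<in> borel_measurable ((M \<Otimes>\<^sub>M lborel) \<Otimes>\<^sub>M lborel)" by (rule Dm)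
      show "weight j k \<in> borel_measurable lborel" unfolding weight_def by measurable
    qed (use C sc in \<open>auto simp: \<kappa>_def D_def intro: sigma_finite_lborel\<close>)
    moreover have "(\<integral>\<^sup>+\<omega>. block_energy p (g \<omega>) j k \<partial>M)
        \<le> (\<integral>\<^sup>+n. (\<integral>\<^sup>+v. ennreal (\<kappa> v * D n v) \<partial>lborel) ^ p \<partial>(M \<Otimes>\<^sub>M lborel))"
    proof -
      have pt: "indicator {-pi..pi} x2 * ennreal (norm (block_fun j k (g \<omega>) (x1, x2)) powr p)
          \<le> (\<integral>\<^sup>+v. ennreal (\<kappa> v * D (\<omega>, x1, x2) v) \<partial>lborel) ^ p" if \<omega>: "\<omega> \<in> space M" for \<omega> x1 x2
      proof (cases "x2 \<in> {-pi..pi}")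
        case True
        obtain B where B: "\<And>z. norm (g \<omega> z) \<le> B" using g_bounded[OF \<omega>] by blast
        have eq: "norm (block_fun j k (g \<omega>) (x1, x2))
            = norm (LINT z|lborel. K j (fst z) * K k (snd z) * increment (detail j) (detail k) (g \<omega>) (x1, x2) z)"
          using block_fun_increment[OF jk g_measurable[OF \<omega>] B] by simp
        have "ennreal (norm (block_fun j k (g \<omega>) (x1, x2))) \<le> (\<integral>\<^sup>+z. ennreal (norm (K j (fst z) * K k (snd z) * increment (detail j) (detail k) (g \<omega>) (x1, x2) z)) \<partial>lborel)"
          unfolding eq by (rule norm_integral_le_nn_integral)
        also have "\<dots> = (\<integral>\<^sup>+v. ennreal (\<kappa> v * D (\<omega>, x1, x2) v) \<partial>lborel)"
        proof (intro nn_integral_cong arg_cong[where f=ennreal])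
          fix z :: "real \<times> real"
          have "increment (detail j) (detail k) (g \<omega>) (x1, x2) z = of_real (rectangle (detail_real j) (detail_real k) (G \<omega>) (x1, x2) z)"
            by (cases z) (simp add: increment_def rectangle_def g_def detail_def detail_real_def)
          then show "norm (K j (fst z) * K k (snd z) * increment (detail j) (detail k) (g \<omega>) (x1, x2) z) = \<kappa> z * D (\<omega>, x1, x2) z"
            using True by (simp add: norm_mult \<kappa>_def D_def)
        qed
        finally have "ennreal (norm (block_fun j k (g \<omega>) (x1, x2))) ^ p \<le> (\<integral>\<^sup>+v. ennreal (\<kappa> v * D (\<omega>, x1, x2) v) \<partial>lborel) ^ p"
          by (intro power_mono) auto
        moreover have "norm (block_fun j k (g \<omega>) (x1, x2)) powr p = norm (block_fun j k (g \<omega>) (x1, x2)) ^ p"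
          using p by (cases "block_fun j k (g \<omega>) (x1, x2) = 0") (auto simp: powr_realpow)
        ultimately show ?thesis using True by (simp add: ennreal_power)
      qed simp
      have "(\<integral>\<^sup>+\<omega>. block_energy p (g \<omega>) j k \<partial>M)
          \<le> (\<integral>\<^sup>+\<omega>. \<integral>\<^sup>+x1. \<integral>\<^sup>+x2. (\<integral>\<^sup>+v. ennreal (\<kappa> v * D (\<omega>, x1, x2) v) \<partial>lborel) ^ p \<partial>lborel \<partial>lborel \<partial>M)"
        unfolding block_energy_def using pt by (intro nn_integral_mono) (simp add: mult.commute)
      also have "\<dots> = (\<integral>\<^sup>+\<omega>. \<integral>\<^sup>+w. (\<integral>\<^sup>+v. ennreal (\<kappa> v * D (\<omega>, w) v) \<partial>lborel) ^ p \<partial>(lborel \<Otimes>\<^sub>M lborel) \<partial>M)"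
      proof (rule nn_integral_cong)
        fix \<omega> assume \<omega>: "\<omega> \<in> space M"
        have "(\<lambda>w. H (\<omega>, w)) \<in> borel_measurable lborel"
          using measurable_Pair2[OF Hm \<omega>] by simp
        then have "(\<lambda>w. (\<integral>\<^sup>+v. ennreal (\<kappa> v * D (\<omega>, w) v) \<partial>lborel) ^ p) \<in> borel_measurable (lborel \<Otimes>\<^sub>M lborel)"
          by (simp only: H_def lborel_prod)
        then show "(\<integral>\<^sup>+x1. \<integral>\<^sup>+x2. (\<integral>\<^sup>+v. ennreal (\<kappa> v * D (\<omega>, x1, x2) v) \<partial>lborel) ^ p \<partial>lborel \<partial>lborel)
            = (\<integral>\<^sup>+w. (\<integral>\<^sup>+v. ennreal (\<kappa> v * D (\<omega>, w) v) \<partial>lborel) ^ p \<partial>(lborel \<Otimes>\<^sub>M lborel))"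
          by (rule lborel.nn_integral_fst)
      qed
      also have "\<dots> = (\<integral>\<^sup>+n. (\<integral>\<^sup>+v. ennreal (\<kappa> v * D n v) \<partial>lborel) ^ p \<partial>(M \<Otimes>\<^sub>M lborel))"
        unfolding lborel_prod using lborel.nn_integral_fst[OF Hm] by (simp only: H_def[abs_def])
      finally show ?thesis .
    qed
    ultimately show ?thesis by (simp add: power_mult_distrib mult_ac)
  qed
  moreover have "0 \<le> C * (A1 * A2) ^ p" using C A1 A2 by simp
  ultimately show ?thesis by blast
qed

text \<open>Used to exchange the expectation with the double series over the blocks.\<close>

lemma block_energy_measurable:
  assumes "-1 \<le> j" "-1 \<le> k"
  shows "(\<lambda>\<omega>. block_energy p (g \<omega>) j k) \<in> borel_measurable M"
proof -
  have [measurable]: "K j \<in> borel_measurable borel" "K k \<in> borel_measurable borel" using assms by auto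
  have [measurable]: "(\<lambda>x. block_fun j k (g (fst (fst x))) (snd (fst x), snd x)) \<in> borel_measurable ((M \<Otimes>\<^sub>M lborel) \<Otimes>\<^sub>M lborel)"
    unfolding block_fun_def g_def by measurable
  show ?thesis
    unfolding block_energy_def by measurable
qed

text \<open>The bound for the Besov norm has finite expectation, dominated by a product of two
  geometric series, so it is finite almost surely. The other membership conditions hold for every
  \<omega>.\<close>

theorem besov_membership:
  fixes q :: real and \<alpha> :: "real \<times> real"
  assumes q: "0 < q" "q \<le> p" and \<alpha>: "fst \<alpha> < \<beta>1" "snd \<alpha> < \<beta>2"
  shows "AE \<omega> in M. dist_of (g \<omega>) \<in> besov_strip \<theta> \<rho> \<alpha> (real p, real p) (q, q) T \<and> represents (g \<omega>) (dist_of (g \<omega>))"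
proof -
  obtain D where D: "0 \<le> D" "\<And>j k. -1 \<le> j \<Longrightarrow> -1 \<le> k \<Longrightarrow>
      (\<integral>\<^sup>+\<omega>. block_energy p (g \<omega>) j k \<partial>M) \<le> ennreal (D * scale \<beta>1 \<beta>2 j k ^ p)"
    using block_energy_expectation by blast
  note [measurable] = block_energy_measurable
  define s where "s i l = scale \<beta>1 \<beta>2 (int i - 1) (int l - 1)" for i l
  define c1 where "c1 i = (2 powr (fst \<alpha> * of_int (int i - 1))) powr q" for i
  define c2 where "c2 l = (2 powr (snd \<alpha> * of_int (int l - 1))) powr q" for l
  define s1 where "s1 i = 2 powr (- of_int (int i - 1) * exponent \<beta>1 (int i - 1))" for i
  define s2 where "s2 l = 2 powr (- of_int (int l - 1) * exponent \<beta>2 (int l - 1))" for l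
  have s: "s i l = s1 i * s2 l" "0 < s i l" for i l
    by (auto simp: s_def s1_def s2_def scale_def)
  have bb: "besov_bound \<alpha> p q \<beta>1 \<beta>2 (g \<omega>) = (\<Sum>i. ennreal (c1 i) * (\<Sum>l. ennreal (c2 l) *
      (ennreal (s i l powr q) + ennreal (s i l powr (q - p)) * block_energy p (g \<omega>) (int i - 1) (int l - 1))))" for \<omega>
    by (simp add: besov_bound_def c1_def c2_def s_def)
  have [measurable]: "(\<lambda>\<omega>. besov_bound \<alpha> p q \<beta>1 \<beta>2 (g \<omega>)) \<in> borel_measurable M"
    unfolding bb by measurable
  have "(\<integral>\<^sup>+\<omega>. besov_bound \<alpha> p q \<beta>1 \<beta>2 (g \<omega>) \<partial>M)
      = (\<Sum>i. ennreal (c1 i) * (\<Sum>l. ennreal (c2 l) *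
      (ennreal (s i l powr q) + ennreal (s i l powr (q - p)) * (\<integral>\<^sup>+\<omega>. block_energy p (g \<omega>) (int i - 1) (int l - 1) \<partial>M))))"
    unfolding bb by (simp add: nn_integral_suminf nn_integral_cmult nn_integral_add emeasure_space_1)
  also have "\<dots> \<le> (\<Sum>i. ennreal (c1 i) * (\<Sum>l. ennreal (c2 l) * ennreal ((1 + D) * s i l powr q)))"
  proof (intro suminf_le mult_left_mono)
    fix i l
    have "ennreal (s i l powr q) + ennreal (s i l powr (q - p)) * (\<integral>\<^sup>+\<omega>. block_energy p (g \<omega>) (int i - 1) (int l - 1) \<partial>M)
        \<le> ennreal (s i l powr q) + ennreal (s i l powr (q - p)) * ennreal (D * s i l ^ p)"
      unfolding s_def by (intro add_left_mono mult_left_mono D) auto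
    also have "\<dots> = ennreal (s i l powr q + D * (s i l powr (q - p) * s i l ^ p))"
      using D(1) s(2)[of i l] by (simp add: ennreal_mult[symmetric] ennreal_plus[symmetric] mult_ac del: ennreal_plus)
    \<comment> \<open>At the splitting point s both terms have the same order s^q; this is why s was
      taken as the expected block size.\<close>
    also have "s i l powr (q - p) * s i l ^ p = s i l powr q"
      using s(2)[of i l] by (simp add: powr_realpow[symmetric] powr_add[symmetric])
    finally show "ennreal (s i l powr q) + ennreal (s i l powr (q - p)) * (\<integral>\<^sup>+\<omega>. block_energy p (g \<omega>) (int i - 1) (int l - 1) \<partial>M)
        \<le> ennreal ((1 + D) * s i l powr q)" by (simp add: distrib_right)
  qed auto
  also have "\<dots> = (\<Sum>i. \<Sum>l. ennreal (1 + D) * (ennreal (c1 i * s1 i powr q) * ennreal (c2 l * s2 l powr q)))"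
    using D(1) by (intro suminf_cong) (simp add: ennreal_suminf_cmult[symmetric] s powr_mult ennreal_mult'[symmetric] c1_def c2_def s1_def s2_def mult_ac del: ennreal_suminf_cmult ennreal_plus)
  also have "\<dots> = ennreal (1 + D) * ((\<Sum>i. ennreal (c1 i * s1 i powr q)) * (\<Sum>l. ennreal (c2 l * s2 l powr q)))"
    by simp
  also have "\<dots> < \<top>"
    using besov_bound_weights_finite[OF q(1) \<alpha>(1)] besov_bound_weights_finite[OF q(1) \<alpha>(2)]
    by (simp add: ennreal_mult_less_top c1_def c2_def s1_def s2_def)
  finally have "AE \<omega> in M. besov_bound \<alpha> p q \<beta>1 \<beta>2 (g \<omega>) \<noteq> \<top>"
    using nn_integral_PInf_AE[of "\<lambda>\<omega>. besov_bound \<alpha> p q \<beta>1 \<beta>2 (g \<omega>)" M] by (simp add: less_top)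
  then show ?thesis
  proof (rule AE_mp, intro AE_I2 impI)
    fix \<omega> assume \<omega>: "\<omega> \<in> space M" and fin: "besov_bound \<alpha> p q \<beta>1 \<beta>2 (g \<omega>) \<noteq> \<top>"
    obtain C where C: "\<And>z. norm (g \<omega> z) \<le> C" using g_bounded[OF \<omega>] by blast
    note gm = g_measurable[OF \<omega>]
    have "dist_support (dist_of (g \<omega>)) \<subseteq> {0..T} \<times> UNIV"
      by (rule dist_support_dist_of) (use G_support[OF \<omega>] in \<open>simp add: g_def\<close>)
    then show "dist_of (g \<omega>) \<in> besov_strip \<theta> \<rho> \<alpha> (real p, real p) (q, q) T \<and> represents (g \<omega>) (dist_of (g \<omega>))"
      unfolding besov_strip_def besov_def
      using dist_of_tempered[OF gm C] dist_of_periodic2[OF gm g_periodic[OF \<omega>]] represents_dist_of[OF gm C]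
        besov_norm_finite[OF q gm C, of \<alpha> \<beta>1 \<beta>2] fin
      by (simp add: less_top)
  qed
qed

end


section \<open>The solution as a cut-off random field\<close>

lemma moment_cong_AE:
  "AE \<omega> in M. X \<omega> = Y \<omega> \<Longrightarrow> moment M p X = moment M p Y"
  unfolding moment_def by (rule nn_integral_cong_AE) auto

text \<open>Reduces uncountably many almost sure statements, one for each point, to countably many
  on a continuous path.\<close>

lemma continuous_zero_from_rationals:
  fixes f :: "real \<Rightarrow> real"
  assumes f: "continuous_on {a..b} f" and z: "\<And>x. x \<in> \<rat> \<Longrightarrow> x \<in> {a..b} \<Longrightarrow> f x = 0"
    and x: "x \<in> {a..b}" and ab: "a < b"
  shows "f x = 0"
proof (rule ccontr)
  assume "f x \<noteq> 0"
  then have "\<exists>d>0. \<forall>y\<in>{a..b}. dist y x < d \<longrightarrow> dist (f y) (f x) < \<bar>f x\<bar>"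
    using f x unfolding continuous_on_iff by (metis zero_less_abs_iff)
  then obtain d where d: "0 < d" "\<And>y. y \<in> {a..b} \<Longrightarrow> dist y x < d \<Longrightarrow> dist (f y) (f x) < \<bar>f x\<bar>" by blast
  have "max a (x - d) < min b (x + d)" using d(1) x ab by auto
  then obtain r where r: "r \<in> \<rat>" "max a (x - d) < r" "r < min b (x + d)"
    using Rats_dense_in_real by blast
  then have "r \<in> {a..b}" "dist r x < d" by (auto simp: dist_real_def)
  then show False using d(2)[of r] z[OF r(1)] by (simp add: dist_real_def)
qed

section \<open>Periodization in space\<close>

definition residue :: "real \<Rightarrow> real" where
  "residue x = x - 2 * pi * of_int \<lfloor>(x + pi) / (2 * pi)\<rfloor>"

lemma periodize_residue: "periodize h x = h (residue x)"
  by (simp add: periodize_def residue_def)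

lemma residue_bounds: "-pi \<le> residue x" "residue x < pi"
proof -
  define n where "n = \<lfloor>(x + pi) / (2 * pi)\<rfloor>"
  have "of_int n \<le> (x + pi) / (2 * pi)" "(x + pi) / (2 * pi) < of_int n + 1"
    by (auto simp: n_def)
  then have "of_int n * (2 * pi) \<le> x + pi" "x + pi < (of_int n + 1) * (2 * pi)"
    by (simp_all add: pos_le_divide_eq pos_divide_less_eq)
  then show "-pi \<le> residue x" "residue x < pi"
    unfolding residue_def n_def[symmetric] by (auto simp: algebra_simps)
qed

lemma residue_in: "residue x \<in> {-pi..pi}"
  using residue_bounds[of x] by auto

lemma residue_periodic: "residue (x + 2 * pi) = residue x"
proof -
  have "(x + 2 * pi + pi) / (2 * pi) = (x + pi) / (2 * pi) + 1" by (simp add: field_simps)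
  then show ?thesis by (simp add: residue_def algebra_simps)
qed

text \<open>Either x and y lie in the same period, or a period boundary lies between them, and then
  their distances to the boundary add up to at most y - x. In the second case the zero boundary
  values are exploited.\<close>

lemma residue_difference:
  assumes "x < y"
  shows "\<bar>residue x - residue y\<bar> = y - x \<or> (pi - residue x) + (residue y + pi) \<le> y - x"
proof -
  define n where "n = \<lfloor>(x + pi) / (2 * pi)\<rfloor>"
  define k where "k = \<lfloor>(y + pi) / (2 * pi)\<rfloor>"
  have r: "residue x = x - 2 * pi * of_int n" "residue y = y - 2 * pi * of_int k"
    by (auto simp: residue_def n_def k_def)
  have "n \<le> k" unfolding n_def k_def using assms by (intro floor_mono divide_right_mono) auto
  show ?thesis
  proof (cases "n = k")
    case True
    then show ?thesis using assms by (simp add: r)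
  next
    case False
    then have "of_int n + 1 \<le> (of_int k :: real)" using \<open>n \<le> k\<close> by linarith
    then have "2 * pi * (of_int n + 1) \<le> 2 * pi * of_int k" by (intro mult_left_mono) auto
    then show ?thesis by (simp add: r algebra_simps)
  qed
qed

text \<open>Near any point the periodization of \<open>w\<close> is a sum of two of its translates.\<close>

lemma continuous_on_periodized:
  fixes w :: "real \<times> real \<Rightarrow> real"
  assumes w: "continuous_on UNIV w" and z: "\<And>t x. pi \<le> \<bar>x\<bar> \<Longrightarrow> w (t, x) = 0"
  shows "continuous_on UNIV (\<lambda>z. w (fst z, residue (snd z)))"
proof -
  have "isCont (\<lambda>z. w (fst z, residue (snd z))) z" for z :: "real \<times> real"
  proof -
    define n where "n = \<lfloor>(snd z + pi) / (2 * pi)\<rfloor>"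
    define b where "b = 2 * pi * of_int n"
    define V where "V = {z :: real \<times> real. b - 3 * pi < snd z \<and> snd z < b + pi}"
    have "open V" unfolding V_def by (intro open_Collect_conj open_Collect_less continuous_intros)
    have "z \<in> V" using residue_bounds[of "snd z"] by (auto simp: V_def b_def n_def residue_def)
    let ?h = "\<lambda>z. w (fst z, snd z - b) + w (fst z, snd z - (b - 2 * pi))"
    have eq: "w (fst y, residue (snd y)) = ?h y" if "y \<in> V" for y
    proof -
      define k where "k = \<lfloor>(snd y + pi) / (2 * pi)\<rfloor>"
      have "of_int (n - 1) * (2 * pi) \<le> snd y + pi" "snd y + pi < of_int (n + 1) * (2 * pi)"
        using that by (auto simp: V_def b_def algebra_simps)
      then have *: "of_int (n - 1) \<le> (snd y + pi) / (2 * pi)" "(snd y + pi) / (2 * pi) < of_int (n + 1)"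
        by (simp_all only: pos_le_divide_eq pos_divide_less_eq pi_gt_zero mult_pos_pos zero_less_numeral)
      have "n - 1 \<le> k" "k < n + 1"
        unfolding k_def le_floor_iff floor_less_iff by (rule *)+
      moreover have r0: "residue (snd y) = snd y - 2 * pi * of_int k" by (simp add: residue_def k_def)
      ultimately consider "k = n" | "k = n - 1" by linarith
      then show ?thesis
      proof cases
        case 1
        then have r: "residue (snd y) = snd y - b" by (simp add: r0 b_def)
        then have "pi \<le> \<bar>snd y - (b - 2 * pi)\<bar>" using residue_bounds[of "snd y"] by linarith
        then show ?thesis using z r by simp
      next
        case 2
        then have "of_int n = (of_int k + 1 :: real)" by simp
        then have r: "residue (snd y) = snd y - (b - 2 * pi)"
          by (simp add: r0 b_def algebra_simps)
        then have "pi \<le> \<bar>snd y - b\<bar>" using residue_bounds[of "snd y"] by linarith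
        then show ?thesis using z r by simp
      qed
    qed
    have "continuous_on UNIV ?h"
      by (intro continuous_intros continuous_on_compose2[OF w]) auto
    then have c: "isCont ?h z" using continuous_on_eq_continuous_at[OF open_UNIV, of ?h] by blast
    have "\<forall>\<^sub>F y in nhds z. w (fst y, residue (snd y)) = ?h y"
      using eventually_nhds_in_open[OF \<open>open V\<close> \<open>z \<in> V\<close>] by (rule eventually_mono) (rule eq)
    from iffD2[OF isCont_cong[OF this] c] show ?thesis .
  qed
  then show ?thesis by (simp add: continuous_at_imp_continuous_on)
qed

section \<open>Pathwise properties and moments of the extended solution\<close>

context heat_solution
begin

definition moment_const :: "nat \<Rightarrow> real" where
  "moment_const m = fact (2 * m) / (2 ^ m * fact m)"

lemma moment_const_nonneg: "0 \<le> moment_const m"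
  by (simp add: moment_const_def)

lemma gaussian_moment_le:
  assumes "centered_gaussian M X w" "w \<le> V"
  shows "moment M (2 * m) X \<le> ennreal (moment_const m * V ^ m)"
proof -
  have "0 \<le> w" using assms by (simp add: centered_gaussian_def)
  then have "moment_const m * w ^ m \<le> moment_const m * V ^ m"
    using assms(2) moment_const_nonneg by (intro mult_left_mono power_mono)
  then show ?thesis
    using centered_gaussian_moment[OF assms(1), of m] unfolding moment_def moment_const_def
    by (simp add: ennreal_leI)
qed

lemma solution_time_moment:
  assumes "0 \<le> t" "0 \<le> s" "x \<in> {-pi..pi}"
  shows "moment M (2 * m) (\<lambda>\<omega>. u t x \<omega> - u s x \<omega>) \<le> ennreal (moment_const m * (8 * sqrt \<bar>t - s\<bar>) ^ m)"
  using solution_time_increment[OF assms] gaussian_moment_le by blast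

lemma solution_space_moment:
  assumes "0 \<le> t" "x \<in> {-pi..pi}" "y \<in> {-pi..pi}"
  shows "moment M (2 * m) (\<lambda>\<omega>. u t x \<omega> - u t y \<omega>) \<le> ennreal (moment_const m * \<bar>x - y\<bar> ^ m)"
  using solution_space_increment[OF assms] gaussian_moment_le by blast

lemma solution_boundary:
  assumes t: "0 \<le> t" and x: "x = -pi \<or> x = pi"
  shows "AE \<omega> in M. u t x \<omega> = 0"
proof -
  have xI: "x \<in> {-pi..pi}" using x by auto
  have [measurable]: "u t x \<in> borel_measurable M" by (rule solution_measurable[OF t xI])
  have "(\<lambda>n::nat. \<integral>\<^sup>+\<omega>. ennreal (((\<Sum>j=1..n. mode j t \<omega> * \<phi> j x) - u t x \<omega>)\<^sup>2) \<partial>M) \<longlonglongrightarrow> 0"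
    using mode(2)[OF t xI] by (simp add: L2_limit_def)
  moreover have "(\<Sum>j=1..n. mode j t \<omega> * \<phi> j x) = 0" for n \<omega>
    using x phi_boundary by (intro sum.neutral) auto
  ultimately have "(\<integral>\<^sup>+\<omega>. ennreal ((u t x \<omega>)\<^sup>2) \<partial>M) = 0"
    by (simp add: LIMSEQ_const_iff)
  then show ?thesis by (simp add: nn_integral_0_iff_AE)
qed

text \<open>At time 0 the kernels live on a single point, so an increment in space has variance 0;
  comparison with the boundary point gives the value itself.\<close>

lemma solution_initial:
  assumes x: "x \<in> {-pi..pi}"
  shows "AE \<omega> in M. u 0 x \<omega> = 0"
proof -
  have z: "(LINT r|lborel. (\<phi> j x * heat_kernel (lam j) 0 r - \<phi> j y * heat_kernel (lam j) 0 r)\<^sup>2) = 0"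
    and i: "integrable lborel (\<lambda>r. (\<phi> j x * heat_kernel (lam j) 0 r - \<phi> j y * heat_kernel (lam j) 0 r)\<^sup>2)" for j y
  proof -
    have "AE r in lborel. r \<noteq> (0::real)" by (rule AE_lborel_singleton)
    then have ae: "AE r in lborel. (\<phi> j x * heat_kernel (lam j) 0 r - \<phi> j y * heat_kernel (lam j) 0 r)\<^sup>2 = 0"
      by (rule eventually_mono) (auto simp: heat_kernel_def indicator_def)
    have m: "(\<lambda>r. (\<phi> j x * heat_kernel (lam j) 0 r - \<phi> j y * heat_kernel (lam j) 0 r)\<^sup>2) \<in> borel_measurable lborel"
      unfolding heat_kernel_def by measurable
    show "(LINT r|lborel. (\<phi> j x * heat_kernel (lam j) 0 r - \<phi> j y * heat_kernel (lam j) 0 r)\<^sup>2) = 0"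
      by (rule integral_eq_zero_AE[OF ae])
    show "integrable lborel (\<lambda>r. (\<phi> j x * heat_kernel (lam j) 0 r - \<phi> j y * heat_kernel (lam j) 0 r)\<^sup>2)"
      using integrable_cong_AE[OF m _ ae] by simp
  qed
  have "\<exists>w\<le>0. centered_gaussian M (\<lambda>\<omega>. u 0 x \<omega> - u 0 (-pi) \<omega>) w"
    by (rule solution_combination_gaussian) (use x z i in auto)
  then have "moment M (2 * 1) (\<lambda>\<omega>. u 0 x \<omega> - u 0 (-pi) \<omega>) \<le> ennreal (moment_const 1 * 0 ^ 1)"
    using gaussian_moment_le by blast
  moreover have [measurable]: "u 0 x \<in> borel_measurable M" "u 0 (-pi) \<in> borel_measurable M"
    using x by (auto intro: solution_measurable)
  ultimately have "AE \<omega> in M. u 0 x \<omega> - u 0 (-pi) \<omega> = 0"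
    by (simp add: moment_def nn_integral_0_iff_AE)
  moreover have "AE \<omega> in M. u 0 (-pi) \<omega> = 0" by (rule solution_boundary) auto
  ultimately show ?thesis by eventually_elim simp
qed

definition regular :: "'w \<Rightarrow> bool" where
  "regular \<omega> \<longleftrightarrow> continuous_on ({0..} \<times> {-pi..pi}) (\<lambda>(t, x). u t x \<omega>) \<and>
     (\<forall>t\<ge>0. u t (-pi) \<omega> = 0 \<and> u t pi \<omega> = 0) \<and> (\<forall>x\<in>{-pi..pi}. u 0 x \<omega> = 0)"

text \<open>The boundary and initial values are known almost surely for each fixed point; rational
  points and continuity give one exceptional null set.\<close>

lemma AE_regular: "AE \<omega> in M. regular \<omega>"
proof -
  have c: "AE \<omega> in M. continuous_on ({0..} \<times> {-pi..pi}) (\<lambda>(t, x). u t x \<omega>)"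
    using solution by (auto simp: stochastic_heat_solution_def)
  have b: "AE \<omega> in M. \<forall>t\<in>\<rat> \<inter> {0..}. u t (-pi) \<omega> = 0 \<and> u t pi \<omega> = 0"
    using countable_rat solution_boundary by (subst AE_ball_countable) auto
  have i: "AE \<omega> in M. \<forall>x\<in>\<rat> \<inter> {-pi..pi}. u 0 x \<omega> = 0"
    using countable_rat solution_initial by (subst AE_ball_countable) auto
  from c b i show ?thesis
  proof eventually_elim
    case (elim \<omega>)
    have ct: "continuous_on {0..} (\<lambda>t. u t x \<omega>)" if "x \<in> {-pi..pi}" for x
      using that by (intro continuous_on_compose2[OF elim(1), of _ "\<lambda>t. (t, x)", simplified] continuous_intros) auto
    have cx: "continuous_on {-pi..pi} (\<lambda>x. u 0 x \<omega>)"
      by (intro continuous_on_compose2[OF elim(1), of _ "\<lambda>x. (0, x)", simplified] continuous_intros) auto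
    have "u t x \<omega> = 0" if t: "0 \<le> t" and x: "x = -pi \<or> x = pi" for t x
    proof (rule continuous_zero_from_rationals[where f="\<lambda>t. u t x \<omega>" and a=0 and b="t + 1"])
      show "continuous_on {0..t + 1} (\<lambda>t. u t x \<omega>)"
        using x by (intro continuous_on_subset[OF ct]) auto
    qed (use elim(2) t x in auto)
    moreover have "u 0 x \<omega> = 0" if "x \<in> {-pi..pi}" for x
      by (rule continuous_zero_from_rationals[OF cx _ that]) (use elim(3) in auto)
    ultimately show ?case using elim(1) by (simp add: regular_def)
  qed
qed

text \<open>The set of regular \<omega> may fail to be measurable, so a measurable subset of full
  measure is fixed.\<close>

definition good :: "'w set" where
  "good = (SOME A. A \<in> sets M \<and> (AE \<omega> in M. \<omega> \<in> A) \<and> (\<forall>\<omega>\<in>A. regular \<omega>))"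

lemma good: "good \<in> sets M" "AE \<omega> in M. \<omega> \<in> good" "\<omega> \<in> good \<Longrightarrow> regular \<omega>"
proof -
  obtain N where N: "{\<omega> \<in> space M. \<not> regular \<omega>} \<subseteq> N" "emeasure M N = 0" "N \<in> sets M"
    using AE_E[OF AE_regular] by blast
  have "N \<in> null_sets M" using N by (simp add: null_sets_def)
  then have ae: "AE \<omega> in M. \<omega> \<notin> N" by (rule AE_not_in)
  have "space M - N \<in> sets M \<and> (AE \<omega> in M. \<omega> \<in> space M - N) \<and> (\<forall>\<omega>\<in>space M - N. regular \<omega>)"
    using N ae AE_space by (auto elim: eventually_elim2)
  then have *: "good \<in> sets M \<and> (AE \<omega> in M. \<omega> \<in> good) \<and> (\<forall>\<omega>\<in>good. regular \<omega>)"
    unfolding good_def by (rule someI)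
  then show "good \<in> sets M" "AE \<omega> in M. \<omega> \<in> good" "\<omega> \<in> good \<Longrightarrow> regular \<omega>" by auto
qed

text \<open>The periodic extension, continued to negative times by the initial value, which is 0 on
  regular paths. Setting it to 0 off \<open>good\<close> makes continuity and support hold for every
  \<omega>, as \<open>cutoff_field\<close> demands.\<close>

definition U :: "'w \<Rightarrow> real \<times> real \<Rightarrow> real" where
  "U \<omega> z = (if \<omega> \<in> good then u (max 0 (fst z)) (residue (snd z)) \<omega> else 0)"

lemma U_AE: "AE \<omega> in M. U \<omega> z = u (max 0 (fst z)) (residue (snd z)) \<omega>"
  using good(2) by eventually_elim (simp add: U_def)

lemma U_measurable: "(\<lambda>\<omega>. U \<omega> z) \<in> borel_measurable M"
proof -
  have [measurable]: "u (max 0 (fst z)) (residue (snd z)) \<in> borel_measurable M"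
    using residue_in by (intro solution_measurable) auto
  note [measurable] = good(1)
  show ?thesis unfolding U_def by measurable
qed

lemma U_continuous: "continuous_on UNIV (U \<omega>)"
proof (cases "\<omega> \<in> good")
  case True
  then have r: "regular \<omega>" by (rule good(3))
  define w where "w z = u (max 0 (fst z)) (max (-pi) (min pi (snd z))) \<omega>" for z :: "real \<times> real"
  have "continuous_on UNIV w"
    unfolding w_def
    by (rule continuous_on_compose2[of "{0..} \<times> {-pi..pi}" "\<lambda>(t, x). u t x \<omega>" _
          "\<lambda>z. (max 0 (fst z), max (-pi) (min pi (snd z)))", simplified])
       (use r in \<open>auto simp: regular_def intro!: continuous_intros\<close>)
  moreover have "w (t, x) = 0" if "pi \<le> \<bar>x\<bar>" for t x
  proof (cases "0 \<le> x")
    case True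
    then have "max (-pi) (min pi x) = pi" using that pi_gt_zero by auto
    then show ?thesis using r by (simp add: w_def regular_def)
  next
    case False
    then have "x \<le> -pi" using that by simp
    then have "max (-pi) (min pi x) = -pi" using pi_gt_zero by (simp add: min_absorb2 max_absorb1)
    then show ?thesis using r by (simp add: w_def regular_def)
  qed
  ultimately have "continuous_on UNIV (\<lambda>z. w (fst z, residue (snd z)))" by (rule continuous_on_periodized)
  moreover have "w (fst z, residue (snd z)) = U \<omega> z" for z
    using True residue_bounds[of "snd z"] by (simp add: w_def U_def min_absorb2 max_absorb2)
  ultimately show ?thesis by simp
next
  case False
  then show ?thesis by (simp add: U_def[abs_def])
qed

lemma U_periodic: "U \<omega> (t, x + 2 * pi) = U \<omega> (t, x)"
  by (simp add: U_def residue_periodic)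

lemma U_negative: "t < 0 \<Longrightarrow> U \<omega> (t, x) = 0"
  using good(3)[of \<omega>] residue_in[of x] by (auto simp: U_def regular_def)

lemma U_diff_moment:
  "moment M p (\<lambda>\<omega>. U \<omega> z - U \<omega> z')
    = moment M p (\<lambda>\<omega>. u (max 0 (fst z)) (residue (snd z)) \<omega> - u (max 0 (fst z')) (residue (snd z')) \<omega>)"
  using U_AE[of z] U_AE[of z'] by (intro moment_cong_AE) (auto elim: eventually_elim2)

text \<open>The value at a point is an increment from the boundary, where the solution vanishes; its
  moment is therefore controlled by the distance to either end of the period.\<close>

lemma U_moment_boundary:
  assumes "b = -pi \<or> b = pi"
  shows "moment M (2 * m) (\<lambda>\<omega>. U \<omega> z) \<le> ennreal (moment_const m * \<bar>residue (snd z) - b\<bar> ^ m)"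
proof -
  have "AE \<omega> in M. u (max 0 (fst z)) b \<omega> = 0" using assms by (intro solution_boundary) auto
  then have "moment M (2 * m) (\<lambda>\<omega>. U \<omega> z)
      = moment M (2 * m) (\<lambda>\<omega>. u (max 0 (fst z)) (residue (snd z)) \<omega> - u (max 0 (fst z)) b \<omega>)"
    using U_AE[of z] by (intro moment_cong_AE) (auto elim: eventually_elim2)
  also have "\<dots> \<le> ennreal (moment_const m * \<bar>residue (snd z) - b\<bar> ^ m)"
    using assms residue_in by (intro solution_space_moment) auto
  finally show ?thesis .
qed

lemma U_moment: "moment M (2 * m) (\<lambda>\<omega>. U \<omega> z) \<le> ennreal (moment_const m * (2 * pi) ^ m)"
proof -
  have "moment_const m * \<bar>residue (snd z) - (-pi)\<bar> ^ m \<le> moment_const m * (2 * pi) ^ m"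
    using residue_bounds[of "snd z"] moment_const_nonneg by (intro mult_left_mono power_mono) auto
  then show ?thesis using order_trans[OF U_moment_boundary[of "-pi" m z] ennreal_leI] by simp
qed

text \<open>Within a period this is the increment bound. Across a period boundary the two values are
  estimated separately by their distances to the boundary, at the price of the constant from
  \<open>moment_diff\<close>.\<close>

lemma U_space_moment:
  "moment M (2 * m) (\<lambda>\<omega>. U \<omega> (t, x - y) - U \<omega> (t, x)) \<le> ennreal (2 * 2 ^ (2 * m) * moment_const m * \<bar>y\<bar> ^ m)"
proof -
  have c: "0 \<le> moment_const m" by (rule moment_const_nonneg)
  have *: "moment M (2 * m) (\<lambda>\<omega>. U \<omega> (t, x1) - U \<omega> (t, x2)) \<le> ennreal (2 * 2 ^ (2 * m) * moment_const m * \<bar>x2 - x1\<bar> ^ m)"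
    if "x1 < x2" for x1 x2
    using residue_difference[OF that]
  proof
    assume d: "\<bar>residue x1 - residue x2\<bar> = x2 - x1"
    have "moment M (2 * m) (\<lambda>\<omega>. U \<omega> (t, x1) - U \<omega> (t, x2)) \<le> ennreal (moment_const m * \<bar>residue x1 - residue x2\<bar> ^ m)"
      unfolding U_diff_moment fst_conv snd_conv using residue_in by (intro solution_space_moment) auto
    also have "moment_const m * \<bar>residue x1 - residue x2\<bar> ^ m \<le> (2 * 2 ^ (2 * m)) * (moment_const m * \<bar>x2 - x1\<bar> ^ m)"
    proof -
      have "1 \<le> 2 * (2::real) ^ (2 * m)" using one_le_power[of "2 :: real" "2 * m"] by linarith
      then have "1 * (moment_const m * \<bar>x2 - x1\<bar> ^ m) \<le> (2 * 2 ^ (2 * m)) * (moment_const m * \<bar>x2 - x1\<bar> ^ m)"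
        using c by (intro mult_right_mono) auto
      then show ?thesis using d that by simp
    qed
    finally show ?thesis by (simp add: ennreal_leI mult.assoc)
  next
    \<comment> \<open>The left point is compared with the right end of its period and the right
      point with the left end; both distances are at most x2 - x1.\<close>
    assume d: "pi - residue x1 + (residue x2 + pi) \<le> x2 - x1"
    have "moment M (2 * m) (\<lambda>\<omega>. U \<omega> (t, x1)) \<le> ennreal (moment_const m * (x2 - x1) ^ m)"
    proof (rule order_trans[OF U_moment_boundary[of pi] ennreal_leI])
      show "moment_const m * \<bar>residue (snd (t, x1)) - pi\<bar> ^ m \<le> moment_const m * (x2 - x1) ^ m"
        using d c residue_bounds[of x1] residue_bounds[of x2] by (intro mult_left_mono power_mono) auto
    qed simp
    moreover have "moment M (2 * m) (\<lambda>\<omega>. U \<omega> (t, x2)) \<le> ennreal (moment_const m * (x2 - x1) ^ m)"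
    proof (rule order_trans[OF U_moment_boundary[of "-pi"] ennreal_leI])
      show "moment_const m * \<bar>residue (snd (t, x2)) - (-pi)\<bar> ^ m \<le> moment_const m * (x2 - x1) ^ m"
        using d c residue_bounds[of x1] residue_bounds[of x2] by (intro mult_left_mono power_mono) auto
    qed simp
    ultimately have "moment M (2 * m) (\<lambda>\<omega>. U \<omega> (t, x1) - 1 * U \<omega> (t, x2))
        \<le> ennreal (2 ^ (2 * m) * (moment_const m * (x2 - x1) ^ m + moment_const m * (x2 - x1) ^ m))"
      using c that by (intro moment_diff U_measurable) auto
    then show ?thesis using that by (simp add: algebra_simps)
  qed
  have sym: "moment M (2 * m) (\<lambda>\<omega>. U \<omega> z - U \<omega> z') = moment M (2 * m) (\<lambda>\<omega>. U \<omega> z' - U \<omega> z)" for z z'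
    by (simp add: moment_def abs_minus_commute)
  consider "y = 0" | "0 < y" | "y < 0" by linarith
  then show ?thesis
  proof cases
    case 1
    then show ?thesis by (cases m) (simp_all add: moment_def moment_const_def emeasure_space_1)
  next
    case 2
    then show ?thesis using *[of "x - y" x] by simp
  next
    case 3
    then show ?thesis using *[of x "x - y"] by (simp add: sym[of "(t, x - y)"])
  qed
qed

text \<open>One constant for all moment bounds: 8^m stems from the time increments, (2 pi)^m from
  the length of the space interval, and the prefactor from differences of two terms.\<close>

definition field_const :: "nat \<Rightarrow> real" where
  "field_const m = 2 * 2 ^ (2 * m) * moment_const m * (8 ^ m + (2 * pi) ^ m)"

lemma field_const:
  "moment_const m * 8 ^ m \<le> field_const m" "2 * 2 ^ (2 * m) * moment_const m \<le> field_const m"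
  "2 * 2 ^ (2 * m) * (moment_const m * (2 * pi) ^ m) \<le> field_const m"
  "moment_const m * (2 * pi) ^ m \<le> field_const m"
proof -
  define A where "A = 2 * (2::real) ^ (2 * m)"
  have A: "1 \<le> A" using one_le_power[of "2 :: real" "2 * m"] unfolding A_def by linarith
  have c: "0 \<le> moment_const m" by (rule moment_const_nonneg)
  have P: "1 \<le> (8::real) ^ m" "0 \<le> (2 * pi) ^ m" by auto
  have f: "field_const m = A * (moment_const m * 8 ^ m) + A * (moment_const m * (2 * pi) ^ m)"
    by (simp add: field_const_def A_def distrib_left mult.assoc)
  have n: "0 \<le> moment_const m * 8 ^ m" "0 \<le> moment_const m * (2 * pi) ^ m" using c P by auto
  have 1: "1 * (moment_const m * 8 ^ m) \<le> A * (moment_const m * 8 ^ m)"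
    "1 * (moment_const m * (2 * pi) ^ m) \<le> A * (moment_const m * (2 * pi) ^ m)"
    by (rule mult_right_mono[OF A n(1)] mult_right_mono[OF A n(2)])+
  have 2: "A * (moment_const m * 1) \<le> A * (moment_const m * 8 ^ m)"
    using A c P by (intro mult_left_mono) auto
  show "moment_const m * 8 ^ m \<le> field_const m" "moment_const m * (2 * pi) ^ m \<le> field_const m"
    using 1 n unfolding f by linarith+
  show "2 * 2 ^ (2 * m) * moment_const m \<le> field_const m"
    using 1 2 n unfolding f A_def[symmetric] by linarith
  show "2 * 2 ^ (2 * m) * (moment_const m * (2 * pi) ^ m) \<le> field_const m"
    using 1 n unfolding f A_def[symmetric] by linarith
qed

text \<open>The natural exponent is m/2. Smaller exponents are weaker for |s| <= 1, while for larger
  |s| the bounded moments suffice. The freedom in r serves the jump cut-off, where the time exponent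
  is capped.\<close>

lemma U_time_moment:
  assumes s: "s \<noteq> 0" and r: "0 \<le> r" "r \<le> m / 2"
  shows "moment M (2 * m) (\<lambda>\<omega>. U \<omega> (t - s, x) - U \<omega> (t, x)) \<le> ennreal (field_const m * \<bar>s\<bar> powr r)"
proof (cases "\<bar>s\<bar> \<le> 1")
  case True
  have "moment M (2 * m) (\<lambda>\<omega>. U \<omega> (t - s, x) - U \<omega> (t, x))
      \<le> ennreal (moment_const m * (8 * sqrt \<bar>max 0 (t - s) - max 0 t\<bar>) ^ m)"
    unfolding U_diff_moment fst_conv snd_conv using residue_in by (intro solution_time_moment) auto
  also have "\<dots> \<le> ennreal (field_const m * \<bar>s\<bar> powr r)"
  proof (rule ennreal_leI)
    have "(8 * sqrt \<bar>max 0 (t - s) - max 0 t\<bar>) ^ m \<le> (8 * sqrt \<bar>s\<bar>) ^ m"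
      by (intro power_mono mult_left_mono real_sqrt_le_mono) auto
    also have "\<dots> = 8 ^ m * \<bar>s\<bar> powr (m / 2)"
      using s by (simp add: power_mult_distrib powr_half_sqrt[symmetric] powr_realpow[symmetric] powr_powr)
    also have "\<dots> \<le> 8 ^ m * \<bar>s\<bar> powr r"
      using True r s by (intro mult_left_mono powr_mono') auto
    finally have "moment_const m * (8 * sqrt \<bar>max 0 (t - s) - max 0 t\<bar>) ^ m \<le> moment_const m * (8 ^ m * \<bar>s\<bar> powr r)"
      using moment_const_nonneg by (rule mult_left_mono)
    also have "\<dots> \<le> field_const m * \<bar>s\<bar> powr r"
      unfolding mult.assoc[symmetric] by (intro mult_right_mono field_const) auto
    finally show "moment_const m * (8 * sqrt \<bar>max 0 (t - s) - max 0 t\<bar>) ^ m \<le> field_const m * \<bar>s\<bar> powr r" .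
  qed
  finally show ?thesis .
next
  case False
  have c: "0 \<le> moment_const m * (2 * pi) ^ m" using moment_const_nonneg by simp
  have "moment M (2 * m) (\<lambda>\<omega>. U \<omega> (t - s, x) - 1 * U \<omega> (t, x))
      \<le> ennreal (2 ^ (2 * m) * (moment_const m * (2 * pi) ^ m + moment_const m * (2 * pi) ^ m))"
    using c by (intro moment_diff U_measurable U_moment) auto
  also have "\<dots> \<le> ennreal (field_const m * \<bar>s\<bar> powr r)"
  proof (rule ennreal_leI)
    have "2 ^ (2 * m) * (moment_const m * (2 * pi) ^ m + moment_const m * (2 * pi) ^ m) \<le> field_const m * 1"
    proof -
      have "2 ^ (2 * m) * (C + C) = 2 * 2 ^ (2 * m) * C" for C :: real by simp
      then show ?thesis using field_const(3)[of m] by (simp only: mult_1_right)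
    qed
    also have "\<dots> \<le> field_const m * \<bar>s\<bar> powr r"
      using False r c field_const(4)[of m] by (intro mult_left_mono ge_one_powr_ge_zero) auto
    finally show "2 ^ (2 * m) * (moment_const m * (2 * pi) ^ m + moment_const m * (2 * pi) ^ m) \<le> field_const m * \<bar>s\<bar> powr r" .
  qed
  finally show ?thesis by simp
qed

text \<open>With p = 2m the requirement p \<beta> / a <= m/2 on the time exponent is exactly \<beta>
  <= a/4, and (1 - a)/2 is the value for which the space exponent p \<beta>2 / (1 - a) equals
  m.\<close>

lemma cutoff_field_solution:
  assumes "dyadic_partition \<theta> \<rho>" and m: "0 < m" and a: "0 < a" "a < 1" and \<beta>: "0 \<le> \<beta>" "\<beta> \<le> a / 4"
    and T: "0 < T" and cx: "0 \<le> cx"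
    and \<eta>: "\<eta> \<in> borel_measurable borel" "\<And>t. 0 \<le> \<eta> t" "\<And>t. \<eta> t \<le> 1" "\<And>t. T < t \<Longrightarrow> \<eta> t = 0"
    and inc: "\<And>s. s \<noteq> 0 \<Longrightarrow>
      (\<integral>\<^sup>+t. ennreal (indicator ({0..T} \<union> {s..T + s}) t * \<bar>\<eta> (t - s) - \<eta> t\<bar> ^ (2 * m)) \<partial>lborel)
        \<le> ennreal (cx * \<bar>s\<bar> powr (real (2 * m) * \<beta>))"
  shows "cutoff_field M \<theta> \<rho> U \<eta> T (field_const m) cx a \<beta> ((1 - a) / 2) (2 * m)"
proof unfold_locales
  show "dyadic_partition \<theta> \<rho>" by fact
  show "continuous_on UNIV (U \<omega>)" for \<omega> by (rule U_continuous)
  show "(\<lambda>\<omega>. U \<omega> z) \<in> borel_measurable M" for z by (rule U_measurable)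
  show "t < 0 \<Longrightarrow> U \<omega> (t, x) = 0" for \<omega> t x by (rule U_negative)
  show "U \<omega> (t, x + 2 * pi) = U \<omega> (t, x)" for \<omega> t x by (rule U_periodic)
  show "0 < 2 * m" using m by simp
  show "0 \<le> field_const m"
    using field_const(1)[of m] moment_const_nonneg[of m] by (intro order_trans[OF _ field_const(1)]) simp
  show "moment M (2 * m) (\<lambda>\<omega>. U \<omega> (t - s, x) - U \<omega> (t, x)) \<le> ennreal (field_const m * \<bar>s\<bar> powr (real (2 * m) * \<beta> / a))"
    if "s \<noteq> 0" for t s x
  proof (rule U_time_moment[OF that])
    have "real (2 * m) * \<beta> \<le> real (2 * m) * (a / 4)" using \<beta> by (intro mult_left_mono) auto
    then show "real (2 * m) * \<beta> / a \<le> real m / 2" using a by (simp add: pos_divide_le_eq mult.commute[of a])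
  qed (use a \<beta> in simp)
  show "moment M (2 * m) (\<lambda>\<omega>. U \<omega> (t, x - y) - U \<omega> (t, x))
      \<le> ennreal (field_const m * \<bar>y\<bar> powr (real (2 * m) * ((1 - a) / 2) / (1 - a)))" if "y \<noteq> 0" for t x y
  proof -
    have "real (2 * m) * ((1 - a) / 2) / (1 - a) = real m" using a by simp
    then have e: "\<bar>y\<bar> powr (real (2 * m) * ((1 - a) / 2) / (1 - a)) = \<bar>y\<bar> ^ m"
      using that by (simp add: powr_realpow)
    show ?thesis unfolding e
      by (rule order_trans[OF U_space_moment ennreal_leI]) (intro mult_right_mono field_const; simp)
  qed
  show "moment M (2 * m) (\<lambda>\<omega>. U \<omega> z) \<le> ennreal (field_const m)" for z
    by (rule order_trans[OF U_moment ennreal_leI[OF field_const(4)]])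
qed (use assms in auto)

lemma strip_extension_U:
  assumes "\<omega> \<in> good"
  shows "strip_extension T (\<lambda>t x. u t x \<omega>) (t, x) = (if t \<in> {0..T} then of_real (U \<omega> (t, x)) else 0)"
  using assms by (simp add: strip_extension_def periodize_residue U_def)

text \<open>Extension by zero is multiplication by the indicator of times up to T. Its jump limits
  the time exponent to 1/p, which is still above \<open>fst \<alpha>\<close> by assumption.\<close>

lemma jump_cutoff:
  assumes dy: "dyadic_partition \<theta> \<rho>" and m: "0 < m" and a: "0 < a" "a < 1" and T: "0 < T"
    and q: "0 < q" "q \<le> real (2 * m)" and \<alpha>: "fst \<alpha> < a / 4" "fst \<alpha> < 1 / real (2 * m)" "snd \<alpha> < (1 - a) / 2"
  shows "AE \<omega> in M. in_besov_strip \<theta> \<rho> \<alpha> (real (2 * m), real (2 * m)) (q, q) T (\<lambda>t x. u t x \<omega>)"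
proof -
  define \<beta> where "\<beta> = min (a / 4) (1 / real (2 * m))"
  define \<eta> :: "real \<Rightarrow> real" where "\<eta> t = indicator {..T} t" for t
  have \<beta>: "0 \<le> \<beta>" "\<beta> \<le> a / 4" "real (2 * m) * \<beta> \<le> 1"
  proof -
    have "real (2 * m) * \<beta> \<le> real (2 * m) * (1 / real (2 * m))"
      unfolding \<beta>_def by (intro mult_left_mono) auto
    then show "real (2 * m) * \<beta> \<le> 1" using m by simp
  qed (use a in \<open>auto simp: \<beta>_def\<close>)
  interpret cutoff_field M \<theta> \<rho> U \<eta> T "field_const m" "1 + 2 * T" a \<beta> "(1 - a) / 2" "2 * m"
  proof (rule cutoff_field_solution[OF dy m a \<beta>(1,2) T])
    fix s :: real assume s: "s \<noteq> 0"
    let ?I = "\<integral>\<^sup>+t. ennreal (indicator ({0..T} \<union> {s..T + s}) t * \<bar>\<eta> (t - s) - \<eta> t\<bar> ^ (2 * m)) \<partial>lborel"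
    \<comment> \<open>The indicator and its shift differ only between T and T + s, a set of length
      |s|. This serves |s| <= 1; the next bound, by the total length 2 T, serves larger
      shifts.\<close>
    have "?I \<le> (\<integral>\<^sup>+t. indicator ({min T (T + s)..max T (T + s)}) t \<partial>lborel)"
      using m by (intro nn_integral_mono) (auto simp: \<eta>_def indicator_def power_0_left)
    also have "\<dots> = ennreal \<bar>s\<bar>" by (simp add: min_def max_def)
    finally have 1: "?I \<le> ennreal \<bar>s\<bar>" .
    have "?I \<le> (\<integral>\<^sup>+t. indicator {0..T} t + indicator {s..T + s} t \<partial>lborel)"
      using m by (intro nn_integral_mono) (auto simp: \<eta>_def indicator_def power_0_left)
    also have "\<dots> = ennreal (2 * T)"
      using T by (simp add: nn_integral_add ennreal_plus[symmetric] del: ennreal_plus)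
    finally have 2: "?I \<le> ennreal (2 * T)" .
    show "?I \<le> ennreal ((1 + 2 * T) * \<bar>s\<bar> powr (real (2 * m) * \<beta>))"
    proof (cases "\<bar>s\<bar> \<le> 1")
      case True
      have "\<bar>s\<bar> = \<bar>s\<bar> powr 1" using s by simp
      also have "\<dots> \<le> \<bar>s\<bar> powr (real (2 * m) * \<beta>)" using True \<beta> s by (intro powr_mono') auto
      also have "\<dots> \<le> (1 + 2 * T) * \<bar>s\<bar> powr (real (2 * m) * \<beta>)"
        using T mult_right_mono[of 1 "1 + 2 * T" "\<bar>s\<bar> powr (real (2 * m) * \<beta>)"] by simp
      finally show ?thesis by (rule order_trans[OF 1 ennreal_leI])
    next
      case False
      have "1 \<le> \<bar>s\<bar> powr (real (2 * m) * \<beta>)" using False \<beta> by (intro ge_one_powr_ge_zero) auto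
      then have "(2 * T) * 1 \<le> (1 + 2 * T) * \<bar>s\<bar> powr (real (2 * m) * \<beta>)"
        using T by (intro mult_mono) auto
      then show ?thesis using order_trans[OF 2 ennreal_leI] by simp
    qed
  next
    show "\<eta> \<in> borel_measurable borel" unfolding \<eta>_def[abs_def] by measurable
  qed (use T in \<open>auto simp: \<eta>_def\<close>)
  have "AE \<omega> in M. dist_of (g \<omega>) \<in> besov_strip \<theta> \<rho> \<alpha> (real (2 * m), real (2 * m)) (q, q) T
      \<and> represents (g \<omega>) (dist_of (g \<omega>))"
    using q \<alpha> by (intro besov_membership) (auto simp: \<beta>_def)
  then show ?thesis
    using good(2)
  proof eventually_elim
    case (elim \<omega>)
    have "g \<omega> = strip_extension T (\<lambda>t x. u t x \<omega>)"
    proof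
      fix z :: "real \<times> real"
      show "g \<omega> z = strip_extension T (\<lambda>t x. u t x \<omega>) z"
        using strip_extension_U[OF elim(2), of T "fst z" "snd z"] U_negative[of "fst z" \<omega> "snd z"]
        by (cases z) (auto simp: g_def G_def \<eta>_def indicator_def not_le)
    qed
    then show ?case using elim(1) unfolding in_besov_strip_def by metis
  qed
qed

text \<open>Between T and T' there is room for a Lipschitz cut-off, so the full time exponent a/4
  remains available, while on [0,T] the field is unchanged.\<close>

lemma continuous_cutoff:
  assumes dy: "dyadic_partition \<theta> \<rho>" and m: "0 < m" and a: "0 < a" "a < 1" and T: "0 < T" "T < T'"
    and q: "0 < q" "q \<le> real (2 * m)" and \<alpha>: "fst \<alpha> < a / 4" "snd \<alpha> < (1 - a) / 2"
  shows "AE \<omega> in M. \<exists>F \<in> besov_strip \<theta> \<rho> \<alpha> (real (2 * m), real (2 * m)) (q, q) T'. \<exists>g. represents g F \<and>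
     (\<forall>t\<in>{0..T}. \<forall>x. g (t, x) = strip_extension T (\<lambda>t x. u t x \<omega>) (t, x))"
proof -
  define d where "d = T' - T"
  \<comment> \<open>A linear ramp from 1 at T to 0 at T', with Lipschitz constant 1/d.\<close>
  define \<eta> :: "real \<Rightarrow> real" where "\<eta> t = max 0 (min 1 ((T' - t) / d))" for t
  have d: "0 < d" using T by (simp add: d_def)
  \<comment> \<open>The factor 2 T' is the length of the set of relevant times; 1 / d^(2m) comes
    from the slope when |s| <= 1 and the added 1 from the bound of the cut-off by 1
    otherwise.\<close>
  define k where "k = 2 * T' * (1 / d ^ (2 * m) + 1)"
  have k: "0 \<le> k" using T d by (simp add: k_def)
  interpret cutoff_field M \<theta> \<rho> U \<eta> T' "field_const m" k a "a / 4" "(1 - a) / 2" "2 * m"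
  proof (rule cutoff_field_solution[OF dy m a _ _ _ k])
    fix s :: real assume s: "s \<noteq> 0"
    let ?I = "\<integral>\<^sup>+t. ennreal (indicator ({0..T'} \<union> {s..T' + s}) t * \<bar>\<eta> (t - s) - \<eta> t\<bar> ^ (2 * m)) \<partial>lborel"
    define b where "b = min 1 (\<bar>s\<bar> / d)"
    have b: "0 \<le> b" "b \<le> 1" "b \<le> \<bar>s\<bar> / d" using d by (auto simp: b_def)
    have lip: "\<bar>\<eta> (t - s) - \<eta> t\<bar> \<le> b" for t
    proof -
      have e: "(T' - (t - s)) / d - (T' - t) / d = s / d" by (simp add: diff_divide_distrib[symmetric])
      have "\<bar>\<eta> (t - s) - \<eta> t\<bar> \<le> \<bar>(T' - (t - s)) / d - (T' - t) / d\<bar>"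
        unfolding \<eta>_def by linarith
      also have "\<dots> = \<bar>s\<bar> / d" unfolding e using d by simp
      finally show ?thesis unfolding b_def \<eta>_def by linarith
    qed
    have pw: "b ^ (2 * m) \<le> (1 / d ^ (2 * m) + 1) * \<bar>s\<bar> powr (real (2 * m) * (a / 4))"
    proof (cases "\<bar>s\<bar> \<le> 1")
      case True
      have "b ^ (2 * m) \<le> (\<bar>s\<bar> / d) ^ (2 * m)" using b by (intro power_mono)
      also have "\<dots> = 1 / d ^ (2 * m) * \<bar>s\<bar> powr (real (2 * m))"
        using s by (subst powr_realpow) (auto simp: power_divide)
      also have "\<dots> \<le> (1 / d ^ (2 * m) + 1) * \<bar>s\<bar> powr (real (2 * m) * (a / 4))"
      proof (intro mult_mono powr_mono')
        show "real (2 * m) * (a / 4) \<le> real (2 * m)" using a mult_left_mono[of "a / 4" 1 "real (2 * m)"] by simp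
      qed (use True s d in auto)
      finally show ?thesis .
    next
      case False
      have "b ^ (2 * m) \<le> 1 * 1" using b by (simp add: power_le_one)
      also have "\<dots> \<le> (1 / d ^ (2 * m) + 1) * \<bar>s\<bar> powr (real (2 * m) * (a / 4))"
        using False a d by (intro mult_mono ge_one_powr_ge_zero) auto
      finally show ?thesis .
    qed
    have "?I \<le> (\<integral>\<^sup>+t. ennreal (b ^ (2 * m)) * (indicator {0..T'} t + indicator {s..T' + s} t) \<partial>lborel)"
      using lip b by (intro nn_integral_mono) (auto simp: indicator_def distrib_left intro!: ennreal_leI power_mono add_increasing2)
    also have "\<dots> = ennreal (b ^ (2 * m)) * ennreal (2 * T')"
      using T by (simp add: nn_integral_cmult nn_integral_add ennreal_plus[symmetric] del: ennreal_plus)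
    also have "\<dots> = ennreal (b ^ (2 * m) * (2 * T'))" using T b by (simp add: ennreal_mult[symmetric])
    also have "\<dots> \<le> ennreal ((1 / d ^ (2 * m) + 1) * \<bar>s\<bar> powr (real (2 * m) * (a / 4)) * (2 * T'))"
      using T by (intro ennreal_leI mult_right_mono pw) auto
    also have "(1 / d ^ (2 * m) + 1) * \<bar>s\<bar> powr (real (2 * m) * (a / 4)) * (2 * T')
        = k * \<bar>s\<bar> powr (real (2 * m) * (a / 4))"
      unfolding k_def by (simp only: mult_ac)
    finally show "?I \<le> ennreal (k * \<bar>s\<bar> powr (real (2 * m) * (a / 4)))" .
  next
    show "\<eta> \<in> borel_measurable borel" unfolding \<eta>_def by measurable
    show "\<eta> t = 0" if "T' < t" for t
      using that d by (simp add: \<eta>_def divide_nonpos_pos)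
  qed (use T a in \<open>auto simp: \<eta>_def\<close>)
  have "AE \<omega> in M. dist_of (g \<omega>) \<in> besov_strip \<theta> \<rho> \<alpha> (real (2 * m), real (2 * m)) (q, q) T'
      \<and> represents (g \<omega>) (dist_of (g \<omega>))"
    using q \<alpha> by (intro besov_membership) auto
  then show ?thesis
    using good(2)
  proof eventually_elim
    case (elim \<omega>)
    have "g \<omega> (t, x) = strip_extension T (\<lambda>t x. u t x \<omega>) (t, x)" if "t \<in> {0..T}" for t x
    proof -
      have "1 \<le> (T' - t) / d" using that d by (simp add: d_def)
      then show ?thesis using that by (simp add: strip_extension_U[OF elim(2)] g_def G_def \<eta>_def)
    qed
    then show ?case using elim(1) by blast
  qed
qed

text \<open>The exceptional null set depends on T', so T' is first taken from a sequence decreasing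
  to T; a member of the space on a shorter strip belongs to it on every longer one.\<close>

lemma locally_in_besov_strip_solution:
  assumes dy: "dyadic_partition \<theta> \<rho>" and m: "0 < m" and a: "0 < a" "a < 1" and T: "0 < T"
    and q: "0 < q" "q \<le> real (2 * m)" and \<alpha>: "fst \<alpha> < a / 4" "snd \<alpha> < (1 - a) / 2"
  shows "AE \<omega> in M. locally_in_besov_strip \<theta> \<rho> \<alpha> (real (2 * m), real (2 * m)) (q, q) T (\<lambda>t x. u t x \<omega>)"
proof -
  have "AE \<omega> in M. \<forall>n::nat. \<exists>F \<in> besov_strip \<theta> \<rho> \<alpha> (real (2 * m), real (2 * m)) (q, q) (T + inverse (real (Suc n))).
     \<exists>g. represents g F \<and> (\<forall>t\<in>{0..T}. \<forall>x. g (t, x) = strip_extension T (\<lambda>t x. u t x \<omega>) (t, x))"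
    unfolding AE_all_countable using assms by (intro allI continuous_cutoff) auto
  then show ?thesis
  proof eventually_elim
    case (elim \<omega>)
    show ?case
      unfolding locally_in_besov_strip_def
    proof (intro allI impI)
      fix T' assume "T < T'"
      then obtain n where n: "inverse (real (Suc n)) < T' - T" using reals_Archimedean[of "T' - T"] by auto
      have "besov_strip \<theta> \<rho> \<alpha> (real (2 * m), real (2 * m)) (q, q) (T + inverse (real (Suc n)))
          \<subseteq> besov_strip \<theta> \<rho> \<alpha> (real (2 * m), real (2 * m)) (q, q) T'"
        using n by (auto simp: besov_strip_def)
      then show "\<exists>F\<in>besov_strip \<theta> \<rho> \<alpha> (real (2 * m), real (2 * m)) (q, q) T'. \<exists>g. represents g F \<and>
          (\<forall>t\<in>{0..T}. \<forall>x. g (t, x) = strip_extension T (\<lambda>t x. u t x \<omega>) (t, x))"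
        using elim by blast
    qed
  qed
qed

end

theorem corollary4p6:
  fixes M :: "'w measure"
    and B :: "nat \<Rightarrow> real \<Rightarrow> 'w \<Rightarrow> real"
    and lam :: "nat \<Rightarrow> real" and \<phi> :: "nat \<Rightarrow> real \<Rightarrow> real"
    and u :: "real \<Rightarrow> real \<Rightarrow> 'w \<Rightarrow> real"
    and \<theta> \<rho> :: "real \<Rightarrow> real"
    and T a q :: real and p :: nat and \<alpha> :: "real \<times> real"
  assumes "prob_space M"
    and "independent_brownian_motions M B"
    and "dirichlet_eigenbasis lam \<phi>"
    and "stochastic_heat_solution M B lam \<phi> u"
    and "dyadic_partition \<theta> \<rho>"
    and "T > 0" and "0 < a" and "a < 1"
    and "1 \<le> q" and "q \<le> real p" and "even p"
    and "\<alpha> = (a / 4 - 1 / q, (1 - a) / 2 - 1 / q)"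
    and "fst \<alpha> \<in> {0<..1}" and "snd \<alpha> \<in> {0<..1}"
  shows "AE \<omega> in M.
           locally_in_besov_strip \<theta> \<rho> \<alpha> (real p, real p) (q, q) T (\<lambda>t x. u t x \<omega>) \<and>
           (fst \<alpha> < 1 / real p \<longrightarrow>
              in_besov_strip \<theta> \<rho> \<alpha> (real p, real p) (q, q) T (\<lambda>t x. u t x \<omega>))"
proof -
  interpret heat_solution M lam \<phi> B u
    using assms(1-4) by (intro heat_solution.intro dirichlet_basis.intro heat_solution_axioms.intro)
  obtain m where p: "p = 2 * m" using \<open>even p\<close> by (rule evenE)
  have m: "0 < m" using assms(9,10) p by (cases m) auto
  have q: "0 < q" "q \<le> real (2 * m)" using assms(9,10) p by auto
  \<comment> \<open>This positive number is the distance of \<alpha> from the critical exponents,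
    and hence the strictness on which summability rests.\<close>
  have "0 < 1 / q" using q by simp
  then have \<alpha>: "fst \<alpha> < a / 4" "snd \<alpha> < (1 - a) / 2"
    unfolding assms(12) fst_conv snd_conv by linarith+
  show ?thesis
  proof (cases "fst \<alpha> < 1 / real p")
    case True
    then have \<alpha>': "fst \<alpha> < 1 / real (2 * m)" by (simp add: p)
    show ?thesis
      using locally_in_besov_strip_solution[OF assms(5) m assms(7,8,6) q \<alpha>]
        jump_cutoff[OF assms(5) m assms(7,8,6) q \<alpha>(1) \<alpha>' \<alpha>(2)]
      unfolding p by eventually_elim simp
  next
    case False
    then show ?thesis
      using locally_in_besov_strip_solution[OF assms(5) m assms(7,8,6) q \<alpha>] by (simp add: p)
  qed
qed

end
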